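(* Let $M$ be a (nonempty) $2$-dimensional Lorentz manifold (pseudo-Riemannian of index $1$) of constant Gaussian curvature $K\in\{-1,0,1\}$. Then one and only one of the following holds: (i) $K=0$, and $M$ is locally isometric to the Lorentz-Minkowski plane $\mathbb{L}^2$; the metric is expressed as $ds^2=-du^2+dv^2$ in spacelike Fermi-type coordinates $(u,v)$, and as $ds^2=d\tau^2-d\vartheta^2$ in timelike Fermi-type coordinates $(\tau,\vartheta)$; (ii) $K=1$, and $M$ is locally isometric to the de Sitter space $\mathbb{S}^2_1$; the metric is expressed as $ds^2=-du^2+\cosh^2 u\,dv^2$ in spacelike Fermi-type coordinates $(u,v)$, and as $ds^2=d\tau^2-\cos^2\tau\,d\vartheta^2$ in timelike Fermi-type coordinates $(\tau,\vartheta)$; (iii) $K=-1$, and $M$ is locally isometric to the anti-de Sitter space $\mathbb{H}^2_1$; the metric is expressed as $ds^2=-du^2+\cos^2 u\,dv^2$ in spacelike Fermi-type coordinates $(u,v)$, and as $ds^2=d\tau^2-\cosh^2\tau\,d\vartheta^2$ in timelike Fermi-type coordinates $(\tau,\vartheta)$.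
   Context: For $x,y\in\mathbb{R}^n$ put $\langle x,y\rangle_s=\sum_{i=1}^{n-s}x^iy^i-\sum_{i=n-s+1}^{n}x^iy^i$ and $\mathbb{R}^n_s=(\mathbb{R}^n,\langle\cdot,\cdot\rangle_s)$. Then $\mathbb{L}^2=\mathbb{R}^2_1$, $\mathbb{S}^2_1=\{x\in\mathbb{R}^3_1:\langle x,x\rangle_1=1\}$ and $\mathbb{H}^2_1=\{x\in\mathbb{R}^3_2:\langle x,x\rangle_2=-1\}$, the last two with the induced metrics. "$M$ is locally isometric to $N$" means every point of $M$ has an open neighborhood isometric to an open subset of $N$. The Gaussian curvature is the sectional curvature, with the sign convention for which $\mathbb{S}^2_1$ has $K=1$; for an orthogonal metric $E\,du^2+G\,dv^2$ it is $$K=\frac{-1}{\sqrt{|EG|}}\left(\epsilon_1\left(\frac{(\sqrt{|G|})_u}{\sqrt{|E|}}\right)_u+\epsilon_2\left(\frac{(\sqrt{|E|})_v}{\sqrt{|G|}}\right)_v\right),$$ where $\epsilon_1=\pm1$ and $\epsilon_2=\pm1$ are the signs of $E$ and $G$. A tangent vector $X$ is spacelike if $\langle X,X\rangle>0$ or $X=0$, timelike if $\langle X,X\rangle<0$, lightlike if $\langle X,X\rangle=0$ and $X\ne0$; a curve has a given causal type if all its velocity vectors do. "Unit speed" means $\langle\gamma',\gamma'\rangle=\pm1$. Fermi-type coordinates: let $\gamma\colon I\to M$ be a unit speed non-lightlike geodesic on an open interval $I$. For each $v\in I$ let $\gamma_v\colon J_v\to M$ (with $J_v$ the maximal open interval of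 definition) be the unit speed geodesic with $\gamma_v(0)=\gamma(v)$ and $\gamma_v'(0)$ orthogonal to $\gamma'(v)$, the unit normal $\gamma_v'(0)$ being chosen smoothly in $v$. Set $\mathbf{x}(u,v)=\gamma_v(u)$ for $v\in I$, $u\in J_v$. On an open neighborhood of $\{0\}\times I$ on which $\mathbf{x}_u,\mathbf{x}_v$ are linearly independent, $\mathbf{x}$ is called a Fermi-type parametrization and $(u,v)$ Fermi-type coordinates; the metric expressed in these coordinates is the pullback of the metric of $M$ by $\mathbf{x}$. They are called spacelike Fermi-type coordinates if $\gamma$ is spacelike, and timelike Fermi-type coordinates if $\gamma$ is timelike; in the timelike case the parameters $(u,v)$ are denoted $(\tau,\vartheta)$. *)

theory Defs
  imports "HOL-Analysis.Analysis"
begin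

subsection \<open>Smooth maps between open subsets of normed spaces\<close>

text \<open>Only meaningful for open \<open>S\<close>, where the Frechet derivative at a point of \<open>S\<close> is unique and
  does not depend on values outside \<open>S\<close>.\<close>

primrec Ck_on :: "nat \<Rightarrow> 'a::real_normed_vector set \<Rightarrow> ('a \<Rightarrow> 'b::real_normed_vector) \<Rightarrow> bool" where
  "Ck_on 0 S f \<longleftrightarrow> continuous_on S f"
| "Ck_on (Suc k) S f \<longleftrightarrow> (\<forall>x\<in>S. f differentiable (at x)) \<and>
     (\<forall>h. Ck_on k S (\<lambda>x. frechet_derivative f (at x) h))"

definition smooth_on :: "'a::real_normed_vector set \<Rightarrow> ('a \<Rightarrow> 'b::real_normed_vector) \<Rightarrow> bool" where
  "smooth_on S f \<longleftrightarrow> (\<forall>k. Ck_on k S f)"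

definition partial_deriv :: "'n::finite \<Rightarrow> (real^'n \<Rightarrow> 'b::real_normed_vector) \<Rightarrow> real^'n \<Rightarrow> 'b" where
  "partial_deriv i f x = frechet_derivative f (at x) (axis i 1)"

definition jacobian_at :: "(real^'n \<Rightarrow> real^'m) \<Rightarrow> real^'n \<Rightarrow> real^'n^'m" where
  "jacobian_at f x = matrix (frechet_derivative f (at x))"

definition open_interval :: "real set \<Rightarrow> bool" where
  "open_interval I \<longleftrightarrow> open I \<and> is_interval I \<and> I \<noteq> {}"


subsection \<open>Symmetric bilinear forms\<close>

definition form :: "real^'n^'n \<Rightarrow> real^'n \<Rightarrow> real^'n \<Rightarrow> real" where
  "form A v w = v \<bullet> (A *v w)"

definition nondegenerate :: "real^'n^'n \<Rightarrow> bool" where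
  "nondegenerate A \<longleftrightarrow> (\<forall>v. (\<forall>w. form A v w = 0) \<longrightarrow> v = 0)"

definition form_index :: "real^'n^'n \<Rightarrow> nat" where
  "form_index A = Max {dim W | W. subspace W \<and> (\<forall>w\<in>W. w \<noteq> 0 \<longrightarrow> form A w w < 0)}"


subsection \<open>Pseudo-Riemannian manifolds\<close>

text \<open>A chart is a pair \<open>(U, \<phi>)\<close>; the values of \<open>\<phi>\<close> outside \<open>U\<close> are irrelevant. A tangent vector at \<open>p\<close>
  is handled through its coordinate vector in each chart around \<open>p\<close>, and the metric tensor through
  the matrix \<open>metric M (U, \<phi>) x\<close> of its components at the point with coordinates \<open>x \<in> \<phi> ` U\<close>.\<close>

type_synonym ('a, 'n) chart = "'a set \<times> ('a \<Rightarrow> real^'n)"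

record ('a, 'n) geometry =
  mtop :: "'a topology"
  atlas :: "('a, 'n::finite) chart set"
  metric :: "('a, 'n) chart \<Rightarrow> real^'n \<Rightarrow> real^'n^'n"

definition is_chart :: "'a topology \<Rightarrow> ('a, 'n::finite) chart \<Rightarrow> bool" where
  "is_chart X = (\<lambda>(U, \<phi>). openin X U \<and> open (\<phi> ` U) \<and>
     homeomorphic_map (subtopology X U) (top_of_set (\<phi> ` U)) \<phi>)"

definition smooth_manifold :: "('a, 'n::finite) geometry \<Rightarrow> bool" where
  "smooth_manifold M \<longleftrightarrow> Hausdorff_space (mtop M) \<and> second_countable (mtop M) \<and>
     (\<forall>c\<in>atlas M. is_chart (mtop M) c) \<and>
     (\<Union>c\<in>atlas M. fst c) = topspace (mtop M) \<and>
     (\<forall>(U, \<phi>)\<in>atlas M. \<forall>(V, \<psi>)\<in>atlas M. smooth_on (\<phi> ` (U \<inter> V)) (\<psi> \<circ> inv_into U \<phi>))"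

definition pseudo_riemannian :: "('a, 'n::finite) geometry \<Rightarrow> nat \<Rightarrow> bool" where
  "pseudo_riemannian M s \<longleftrightarrow> smooth_manifold M \<and>
     (\<forall>(U, \<phi>)\<in>atlas M. smooth_on (\<phi> ` U) (metric M (U, \<phi>)) \<and>
        (\<forall>x\<in>\<phi> ` U. let A = metric M (U, \<phi>) x in
           transpose A = A \<and> nondegenerate A \<and> form_index A = s)) \<and>
     (\<forall>(U, \<phi>)\<in>atlas M. \<forall>(V, \<psi>)\<in>atlas M. \<forall>p\<in>U \<inter> V.
        let J = jacobian_at (\<psi> \<circ> inv_into U \<phi>) (\<phi> p) in
          metric M (U, \<phi>) (\<phi> p) = transpose J ** metric M (V, \<psi>) (\<psi> p) ** J)"

definition lorentz_surface :: "('a, 2) geometry \<Rightarrow> bool" where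
  "lorentz_surface M \<longleftrightarrow> pseudo_riemannian M 1"

definition tangent_inner ::
    "('a, 'n::finite) geometry \<Rightarrow> ('a, 'n) chart \<Rightarrow> 'a \<Rightarrow> real^'n \<Rightarrow> real^'n \<Rightarrow> real" where
  "tangent_inner M c p X Y = form (metric M c (snd c p)) X Y"


subsection \<open>Levi-Civita connection and curvature\<close>

text \<open>\<open>christoffel g x k i j\<close> is $\Gamma^k_{ij}$, and \<open>riemann g x u v w\<close> is $R(u,v)w$ with
  $R(X,Y)Z = \nabla_X\nabla_Y Z - \nabla_Y\nabla_X Z - \nabla_{[X,Y]}Z$.\<close>

definition christoffel ::
    "(real^'n \<Rightarrow> real^'n^'n) \<Rightarrow> real^'n \<Rightarrow> 'n::finite \<Rightarrow> 'n \<Rightarrow> 'n \<Rightarrow> real" where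
  "christoffel g x k i j = (1/2) * (\<Sum>l\<in>UNIV. matrix_inv (g x) $ k $ l *
     (partial_deriv i (\<lambda>y. g y $ j $ l) x + partial_deriv j (\<lambda>y. g y $ i $ l) x
       - partial_deriv l (\<lambda>y. g y $ i $ j) x))"

definition riemann_comp ::
    "(real^'n \<Rightarrow> real^'n^'n) \<Rightarrow> real^'n \<Rightarrow> 'n::finite \<Rightarrow> 'n \<Rightarrow> 'n \<Rightarrow> 'n \<Rightarrow> real" where
  "riemann_comp g x l i j k =
     partial_deriv i (\<lambda>y. christoffel g y l j k) x - partial_deriv j (\<lambda>y. christoffel g y l i k) x
     + (\<Sum>m\<in>UNIV. christoffel g x l i m * christoffel g x m j k
                 - christoffel g x l j m * christoffel g x m i k)"

definition riemann ::
    "(real^'n \<Rightarrow> real^'n^'n) \<Rightarrow> real^'n \<Rightarrow> real^'n \<Rightarrow> real^'n \<Rightarrow> real^'n \<Rightarrow> real^'n" where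
  "riemann g x u v w = (\<chi> l. \<Sum>i\<in>UNIV. \<Sum>j\<in>UNIV. \<Sum>k\<in>UNIV.
     riemann_comp g x l i j k * u $ i * v $ j * w $ k)"

definition sectional_curvature ::
    "(real^'n \<Rightarrow> real^'n^'n) \<Rightarrow> real^'n \<Rightarrow> real^'n \<Rightarrow> real^'n \<Rightarrow> real" where
  "sectional_curvature g x u v =
     form (g x) (riemann g x u v v) u /
       (form (g x) u u * form (g x) v v - (form (g x) u v)\<^sup>2)"

text \<open>In dimension 2 the tangent plane is the only plane section, and its sectional curvature does
  not depend on the basis; the coordinate basis is used.\<close>

definition gaussian_curvature :: "('a, 2) geometry \<Rightarrow> ('a, 2) chart \<Rightarrow> 'a \<Rightarrow> real" where
  "gaussian_curvature M c p = sectional_curvature (metric M c) (snd c p) (axis 1 1) (axis 2 1)"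

definition has_constant_curvature :: "('a, 2) geometry \<Rightarrow> real \<Rightarrow> bool" where
  "has_constant_curvature M K \<longleftrightarrow> (\<forall>c\<in>atlas M. \<forall>p\<in>fst c. gaussian_curvature M c p = K)"


subsection \<open>Local isometries\<close>

definition smooth_map_on ::
    "('a, 'n::finite) geometry \<Rightarrow> ('b, 'm::finite) geometry \<Rightarrow> 'a set \<Rightarrow> ('a \<Rightarrow> 'b) \<Rightarrow> bool" where
  "smooth_map_on M N U f \<longleftrightarrow> continuous_map (subtopology (mtop M) U) (mtop N) f \<and>
     (\<forall>(C, \<phi>)\<in>atlas M. \<forall>(D, \<psi>)\<in>atlas N.
        smooth_on (\<phi> ` {p \<in> U \<inter> C. f p \<in> D}) (\<psi> \<circ> f \<circ> inv_into C \<phi>))"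

definition isometry_between ::
    "('a, 'n::finite) geometry \<Rightarrow> ('b, 'n) geometry \<Rightarrow> 'a set \<Rightarrow> 'b set \<Rightarrow> ('a \<Rightarrow> 'b) \<Rightarrow> bool" where
  "isometry_between M N U V f \<longleftrightarrow> bij_betw f U V \<and>
     smooth_map_on M N U f \<and> smooth_map_on N M V (inv_into U f) \<and>
     (\<forall>(C, \<phi>)\<in>atlas M. \<forall>(D, \<psi>)\<in>atlas N. \<forall>p \<in> U \<inter> C. f p \<in> D \<longrightarrow>
        (let J = jacobian_at (\<psi> \<circ> f \<circ> inv_into C \<phi>) (\<phi> p) in
          metric M (C, \<phi>) (\<phi> p) = transpose J ** metric N (D, \<psi>) (\<psi> (f p)) ** J))"

definition locally_isometric ::
    "('a, 'n::finite) geometry \<Rightarrow> ('b, 'n) geometry \<Rightarrow> bool" where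
  "locally_isometric M N \<longleftrightarrow> (\<forall>p\<in>topspace (mtop M). \<exists>U V f.
     openin (mtop M) U \<and> p \<in> U \<and> openin (mtop N) V \<and> isometry_between M N U V f)"


subsection \<open>The model surfaces\<close>

text \<open>For \<open>'n = 2\<close> and \<open>'n = 3\<close>, \<open>of_nat\<close> maps \<open>{1..CARD('n)}\<close> bijectively onto \<open>'n\<close>
  (with \<open>of_nat CARD('n) = 0\<close>), so \<open>x $ of_nat i\<close> is the \<open>i\<close>-th coordinate.\<close>

definition pseudo_inner :: "nat \<Rightarrow> real^'n::{finite,ring_1} \<Rightarrow> real^'n::{finite,ring_1} \<Rightarrow> real" where
  "pseudo_inner s x y =
     (\<Sum>i = 1..CARD('n) - s. x $ of_nat i * y $ of_nat i)
     - (\<Sum>i = CARD('n) - s + 1..CARD('n). x $ of_nat i * y $ of_nat i)"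

text \<open>An embedded submanifold \<open>S\<close> of $\mathbb{R}^n_s$ with its induced metric: the charts are the inverses
  of all the regular parametrizations of \<open>S\<close>.\<close>

definition induced_geometry ::
    "nat \<Rightarrow> (real^'m::{finite,ring_1}) set \<Rightarrow> (real^'m::{finite,ring_1}, 'n::finite) geometry" where
  "induced_geometry s S = \<lparr>
     mtop = top_of_set S,
     atlas = {(U, \<phi>). is_chart (top_of_set S) (U, \<phi>) \<and> smooth_on (\<phi> ` U) (inv_into U \<phi>) \<and>
                (\<forall>x\<in>\<phi> ` U. inj (frechet_derivative (inv_into U \<phi>) (at x)))},
     metric = (\<lambda>(U, \<phi>) x. \<chi> i j. pseudo_inner s
        (partial_deriv i (inv_into U \<phi>) x) (partial_deriv j (inv_into U \<phi>) x)) \<rparr>"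

definition minkowski_plane :: "(real^2, 2) geometry" where
  "minkowski_plane = induced_geometry 1 UNIV"

definition de_sitter :: "(real^3, 2) geometry" where
  "de_sitter = induced_geometry 1 {x. pseudo_inner 1 x x = 1}"

definition anti_de_sitter :: "(real^3, 2) geometry" where
  "anti_de_sitter = induced_geometry 2 {x. pseudo_inner 2 x x = -1}"


subsection \<open>Curves and geodesics\<close>

definition smooth_curve :: "('a, 'n::finite) geometry \<Rightarrow> real set \<Rightarrow> (real \<Rightarrow> 'a) \<Rightarrow> bool" where
  "smooth_curve M I \<gamma> \<longleftrightarrow> open_interval I \<and> continuous_map (top_of_set I) (mtop M) \<gamma> \<and>
     (\<forall>(U, \<phi>)\<in>atlas M. smooth_on {t\<in>I. \<gamma> t \<in> U} (\<phi> \<circ> \<gamma>))"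

definition velocity :: "('a, 'n::finite) chart \<Rightarrow> (real \<Rightarrow> 'a) \<Rightarrow> real \<Rightarrow> real^'n" where
  "velocity c \<gamma> t = vector_derivative (snd c \<circ> \<gamma>) (at t)"

definition geodesic :: "('a, 'n::finite) geometry \<Rightarrow> real set \<Rightarrow> (real \<Rightarrow> 'a) \<Rightarrow> bool" where
  "geodesic M I \<gamma> \<longleftrightarrow> smooth_curve M I \<gamma> \<and>
     (\<forall>c\<in>atlas M. \<forall>t\<in>I. \<gamma> t \<in> fst c \<longrightarrow>
        (\<forall>k. vector_derivative (velocity c \<gamma>) (at t) $ k +
          (\<Sum>i\<in>UNIV. \<Sum>j\<in>UNIV. christoffel (metric M c) (snd c (\<gamma> t)) k i j *
             velocity c \<gamma> t $ i * velocity c \<gamma> t $ j) = 0))"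

definition maximal_geodesic :: "('a, 'n::finite) geometry \<Rightarrow> real set \<Rightarrow> (real \<Rightarrow> 'a) \<Rightarrow> bool" where
  "maximal_geodesic M J \<sigma> \<longleftrightarrow> geodesic M J \<sigma> \<and>
     (\<forall>J' \<sigma>'. geodesic M J' \<sigma>' \<and> J \<subseteq> J' \<and> (\<forall>t\<in>J. \<sigma>' t = \<sigma> t) \<longrightarrow> J' = J)"

definition unit_speed :: "('a, 'n::finite) geometry \<Rightarrow> real set \<Rightarrow> (real \<Rightarrow> 'a) \<Rightarrow> bool" where
  "unit_speed M I \<gamma> \<longleftrightarrow> (\<forall>t\<in>I. \<forall>c\<in>atlas M. \<gamma> t \<in> fst c \<longrightarrow>
     tangent_inner M c (\<gamma> t) (velocity c \<gamma> t) (velocity c \<gamma> t) \<in> {1, -1})"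

definition spacelike_curve :: "('a, 'n::finite) geometry \<Rightarrow> real set \<Rightarrow> (real \<Rightarrow> 'a) \<Rightarrow> bool" where
  "spacelike_curve M I \<gamma> \<longleftrightarrow> (\<forall>t\<in>I. \<forall>c\<in>atlas M. \<gamma> t \<in> fst c \<longrightarrow>
     (let X = velocity c \<gamma> t in tangent_inner M c (\<gamma> t) X X > 0 \<or> X = 0))"

definition timelike_curve :: "('a, 'n::finite) geometry \<Rightarrow> real set \<Rightarrow> (real \<Rightarrow> 'a) \<Rightarrow> bool" where
  "timelike_curve M I \<gamma> \<longleftrightarrow> (\<forall>t\<in>I. \<forall>c\<in>atlas M. \<gamma> t \<in> fst c \<longrightarrow>
     (let X = velocity c \<gamma> t in tangent_inner M c (\<gamma> t) X X < 0))"


subsection \<open>Fermi-type coordinates\<close>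

text \<open>A parametrized surface is a map \<open>x u v\<close>; \<open>coord_u c x u v\<close> and \<open>coord_v c x u v\<close> are the
  components of $\mathbf{x}_u$ and $\mathbf{x}_v$ in the chart \<open>c\<close>.\<close>

definition coord_u :: "('a, 2) chart \<Rightarrow> (real \<Rightarrow> real \<Rightarrow> 'a) \<Rightarrow> real \<Rightarrow> real \<Rightarrow> real^2" where
  "coord_u c x u v = velocity c (\<lambda>s. x s v) u"

definition coord_v :: "('a, 2) chart \<Rightarrow> (real \<Rightarrow> real \<Rightarrow> 'a) \<Rightarrow> real \<Rightarrow> real \<Rightarrow> real^2" where
  "coord_v c x u v = velocity c (\<lambda>t. x u t) v"

text \<open>\<open>\<gamma>\<close> is the base geodesic on \<open>I\<close>, and \<open>x _ v\<close> is the normal geodesic $\gamma_v$, defined on \<open>J v\<close>.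
  The parametrization is considered on the open neighbourhood \<open>W\<close> of \<open>{0} \<times> I\<close>. Smoothness of \<open>x\<close>
  is not assumed: it follows from the smooth dependence of geodesics on initial conditions.\<close>

definition fermi_parametrization ::
    "('a, 2) geometry \<Rightarrow> real set \<Rightarrow> (real \<Rightarrow> 'a) \<Rightarrow> (real \<Rightarrow> real set) \<Rightarrow>
       (real \<Rightarrow> real \<Rightarrow> 'a) \<Rightarrow> (real \<times> real) set \<Rightarrow> bool" where
  "fermi_parametrization M I \<gamma> J x W \<longleftrightarrow>
     geodesic M I \<gamma> \<and> unit_speed M I \<gamma> \<and>
     (\<forall>v\<in>I. maximal_geodesic M (J v) (\<lambda>u. x u v) \<and> unit_speed M (J v) (\<lambda>u. x u v) \<and>
        0 \<in> J v \<and> x 0 v = \<gamma> v \<and>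
        (\<forall>c\<in>atlas M. \<gamma> v \<in> fst c \<longrightarrow>
           tangent_inner M c (\<gamma> v) (coord_u c x 0 v) (velocity c \<gamma> v) = 0)) \<and>
     (\<forall>c\<in>atlas M. smooth_on {v\<in>I. \<gamma> v \<in> fst c} (\<lambda>v. coord_u c x 0 v)) \<and>
     open W \<and> {0} \<times> I \<subseteq> W \<and> W \<subseteq> {(u, v). v \<in> I \<and> u \<in> J v} \<and>
     (\<forall>(u, v)\<in>W. \<forall>c\<in>atlas M. x u v \<in> fst c \<longrightarrow>
        (\<forall>a b. a *\<^sub>R coord_u c x u v + b *\<^sub>R coord_v c x u v = 0 \<longrightarrow> a = 0 \<and> b = 0))"

definition spacelike_fermi ::
    "('a, 2) geometry \<Rightarrow> (real \<Rightarrow> real \<Rightarrow> 'a) \<Rightarrow> (real \<times> real) set \<Rightarrow> bool" where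
  "spacelike_fermi M x W \<longleftrightarrow>
     (\<exists>I \<gamma> J. fermi_parametrization M I \<gamma> J x W \<and> spacelike_curve M I \<gamma>)"

definition timelike_fermi ::
    "('a, 2) geometry \<Rightarrow> (real \<Rightarrow> real \<Rightarrow> 'a) \<Rightarrow> (real \<times> real) set \<Rightarrow> bool" where
  "timelike_fermi M x W \<longleftrightarrow>
     (\<exists>I \<gamma> J. fermi_parametrization M I \<gamma> J x W \<and> timelike_curve M I \<gamma>)"

text \<open>The pullback of the metric by \<open>x\<close> on \<open>W\<close> is $E\,du^2 + 2F\,du\,dv + G\,dv^2$.\<close>

definition metric_expressed_as ::
    "('a, 2) geometry \<Rightarrow> (real \<Rightarrow> real \<Rightarrow> 'a) \<Rightarrow> (real \<times> real) set \<Rightarrow>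
       (real \<Rightarrow> real \<Rightarrow> real) \<Rightarrow> (real \<Rightarrow> real \<Rightarrow> real) \<Rightarrow> (real \<Rightarrow> real \<Rightarrow> real) \<Rightarrow> bool" where
  "metric_expressed_as M x W E F G \<longleftrightarrow>
     (\<forall>(u, v)\<in>W. \<forall>c\<in>atlas M. x u v \<in> fst c \<longrightarrow>
        (let xu = coord_u c x u v; xv = coord_v c x u v in
          tangent_inner M c (x u v) xu xu = E u v \<and>
          tangent_inner M c (x u v) xu xv = F u v \<and>
          tangent_inner M c (x u v) xv xv = G u v))"

end

theory Submission
  imports Defs
begin

text \<open>If \<open>K\<close> is constant, the linear system \<open>Hess h = - K h g\<close> is flat, so near each point it has a
  three-dimensional space of solutions, on which \<open>K h k + g(grad h, grad k)\<close> is constant. A basis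
  adapted to this quadratic form immerses the surface isometrically into the model quadric.

  Along a unit speed geodesic with \<open>g(\<gamma>', \<gamma>') = \<epsilon>\<close> every solution satisfies \<open>h'' = - K \<epsilon> h\<close>, so geodesics
  are explicit in coordinates consisting of two solutions. Hence the normal geodesics of a Fermi-type
  parametrization depend differentiably on their starting point, without smooth dependence of solutions
  of nonlinear differential equations, and \<open>x\<^sub>v = f(u) N\<close> with \<open>N\<close> a unit normal field parallel along the
  normal geodesic and \<open>f'' = - K \<epsilon> f\<close>, \<open>f(0) = 1\<close>, \<open>f'(0) = 0\<close>; this is carried along the normal
  geodesic from one chart to the next.\<close>

section \<open>Smooth maps\<close>

text \<open>In dimension two the skew symmetry of the curvature leaves a single free component.
  Constant curvature prescribes it, and this is what makes the mixed derivatives in the Obata system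
  agree. Passing from solutions to an immersion is linear algebra. The conserved form says that the
  square matrix of the values and first derivatives of three solutions has a fixed Gram matrix with
  respect to K and the inverse metric. Inverting that identity yields at once the metric K dh0^2 +
  dh1^2 - dh2^2 and the equation of the quadric. For K = 0 the constants are degenerate, and only
  the block of derivatives of two solutions is inverted. A normal geodesic may run through many
  charts, and nothing is known beforehand about how it depends on its starting point. The propagated
  statement therefore consists of tensorial first-order data. Each step works for either order of
  its two parameters, so a connectedness argument along the geodesic suffices. The number
  \<open>\<epsilon>\<close> is the square of the velocity of the normal geodesics. It is -1 over a
  spacelike and 1 over a timelike base, which interchanges cos and cosh between the two kinds of
  coordinates.\<close>

lemma Ck_on_cong:
  assumes "open S" "\<And>x. x \<in> S \<Longrightarrow> f x = g x" "Ck_on k S f"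
  shows "Ck_on k S g"
  using assms(2,3)
proof (induction k arbitrary: f g)
  case 0
  then show ?case by (simp cong: continuous_on_cong)
next
  case (Suc k)
  have d: "(g has_derivative frechet_derivative f (at x)) (at x)" if "x \<in> S" for x
    using Suc.prems that \<open>open S\<close>
    by (auto simp: frechet_derivative_works intro: has_derivative_transform_within_open)
  show ?case
    unfolding Ck_on.simps
  proof (intro conjI ballI allI)
    fix x assume "x \<in> S" then show "g differentiable at x"
        unfolding differentiable_def by (blast intro: d)
  next
    fix h
    have "frechet_derivative f (at x) h = frechet_derivative g (at x) h" if "x \<in> S" for x
      using frechet_derivative_at[OF d[OF that]] by simp
    then show "Ck_on k S (\<lambda>x. frechet_derivative g (at x) h)"
      using Suc.prems(2) Suc.IH[of "\<lambda>x. frechet_derivative f (at x) h"] by simp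
  qed
qed

text \<open>Lets the inductions below use an explicit derivative in place of the choice operator
  inside \<open>frechet_derivative\<close>.\<close>

lemma Ck_on_SucI:
  assumes "open S" "\<And>x. x \<in> S \<Longrightarrow> (f has_derivative D x) (at x)"
    "\<And>h. Ck_on k S (\<lambda>x. D x h)"
  shows "Ck_on (Suc k) S f"
  unfolding Ck_on.simps
proof (intro conjI ballI allI)
  fix x assume "x \<in> S" then show "f differentiable at x"
    using assms(2) differentiable_def by blast
next
  fix h
  show "Ck_on k S (\<lambda>x. frechet_derivative f (at x) h)"
    by (intro Ck_on_cong[OF assms(1) _ assms(3)[of h]]) (simp add: frechet_derivative_at[OF assms(2), symmetric])
qed

lemma Ck_on_SucD:
  assumes "Ck_on (Suc k) S f"
  shows "\<And>x. x \<in> S \<Longrightarrow> (f has_derivative frechet_derivative f (at x)) (at x)"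
    "\<And>h. Ck_on k S (\<lambda>x. frechet_derivative f (at x) h)"
  using assms by (auto simp: frechet_derivative_works)

lemma Ck_on_subset: "Ck_on k S f \<Longrightarrow> T \<subseteq> S \<Longrightarrow> Ck_on k T f"
  by (induction k arbitrary: f) (auto intro: continuous_on_subset)

lemma Ck_on_lower: "Ck_on (Suc k) S f \<Longrightarrow> Ck_on k S f"
proof (induction k arbitrary: f)
  case 0
  then show ?case
    by (auto intro!: differentiable_imp_continuous_on differentiable_at_imp_differentiable_on)
next
  case (Suc k)
  show ?case
    unfolding Ck_on.simps(2)[of k]
    using Suc.prems Suc.IH by (auto simp del: Ck_on.simps dest: Ck_on_SucD(2)) (simp add: Ck_on.simps)
qed

lemma Ck_on_const: "Ck_on k S (\<lambda>x. c)"
  by (induction k arbitrary: c) auto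

lemma Ck_on_bounded_linear:
  assumes "bounded_linear L" "open S" "Ck_on k S f"
  shows "Ck_on k S (\<lambda>x. L (f x))"
  using assms(3)
proof (induction k arbitrary: f)
  case 0
  then show ?case
    by (simp add: bounded_linear.continuous_on[OF assms(1)])
next
  case (Suc k)
  note D = Ck_on_SucD[OF Suc.prems]
  show ?case
    by (rule Ck_on_SucI[OF \<open>open S\<close> bounded_linear.has_derivative[OF assms(1) D(1)]])
      (auto intro: Suc.IH D(2))
qed

lemma Ck_on_add:
  assumes "open S" "Ck_on k S f" "Ck_on k S g"
  shows "Ck_on k S (\<lambda>x. f x + g x)"
  using assms(2,3)
proof (induction k arbitrary: f g)
  case 0
  then show ?case by (auto intro: continuous_intros)
next
  case (Suc k)
  note D = Ck_on_SucD[OF Suc.prems(1)] Ck_on_SucD[OF Suc.prems(2)]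
  show ?case
    by (rule Ck_on_SucI[OF \<open>open S\<close> has_derivative_add[OF D(1,3)]])
      (auto intro: Suc.IH D)
qed

lemma Ck_on_bounded_bilinear:
  assumes "bounded_bilinear B" "open S" "Ck_on k S f" "Ck_on k S g"
  shows "Ck_on k S (\<lambda>x. B (f x) (g x))"
  using assms(3,4)
proof (induction k arbitrary: f g)
  case 0
  then show ?case by (auto intro: bounded_bilinear.continuous_on[OF assms(1)])
next
  case (Suc k)
  note D = Ck_on_SucD[OF Suc.prems(1)] Ck_on_SucD[OF Suc.prems(2)]
  show ?case
    by (rule Ck_on_SucI[OF \<open>open S\<close> bounded_bilinear.FDERIV[OF assms(1) D(1,3)]], assumption, assumption)
      (intro Ck_on_add \<open>open S\<close> Suc.IH D Ck_on_lower[OF Suc.prems(1)] Ck_on_lower[OF Suc.prems(2)])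
qed

text \<open>\<open>Ck_on\<close> controls derivatives in a fixed direction only, whereas the chain
  rule evaluates the derivative of \<open>f\<close> in the moving direction given by
  \<open>g\<close>. Expanding that direction in a basis turns the derivative into a finite sum of
  products; this is why the intermediate space is Euclidean.\<close>

lemma Ck_on_compose:
  fixes f :: "'b::euclidean_space \<Rightarrow> 'c::real_normed_vector"
  assumes "open S" "open T" "Ck_on k T f" "Ck_on k S g" "g ` S \<subseteq> T"
  shows "Ck_on k S (\<lambda>x. f (g x))"
  using assms(3,4)
proof (induction k arbitrary: f)
  case 0
  then show ?case using assms(5) by (auto intro: continuous_on_compose2)
next
  case (Suc k)
  note Df = Ck_on_SucD[OF Suc.prems(1)] and Dg = Ck_on_SucD[OF Suc.prems(2)]
  have eq: "frechet_derivative f (at (g x)) v = (\<Sum>b\<in>Basis. (v \<bullet> b) *\<^sub>R frechet_derivative f (at (g x)) b)"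
    if "x \<in> S" for x v
  proof -
    interpret linear "frechet_derivative f (at (g x))"
      using Df(1)[of "g x"] that assms(5) has_derivative_linear by auto
    have "frechet_derivative f (at (g x)) v = frechet_derivative f (at (g x)) (\<Sum>b\<in>Basis. (v \<bullet> b) *\<^sub>R b)"
      by (simp add: euclidean_representation)
    then show ?thesis by (simp add: sum scale)
  qed
  have "((\<lambda>x. f (g x)) has_derivative
     (\<lambda>h. \<Sum>b\<in>Basis. (frechet_derivative g (at x) h \<bullet> b) *\<^sub>R frechet_derivative f (at (g x)) b)) (at x)"
    if "x \<in> S" for x
    using has_derivative_compose[OF Dg(1) Df(1), of x] eq that assms(5)
    by (auto simp: image_subset_iff)
  moreover have "Ck_on k S (\<lambda>x. \<Sum>b\<in>B. (frechet_derivative g (at x) h \<bullet> b) *\<^sub>R frechet_derivative f (at (g x)) b)"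
    if "finite B" for B h
    using that
  proof (induction B)
    case empty
    then show ?case by (simp add: Ck_on_const)
  next
    case (insert b B)
    show ?case
      unfolding sum.insert[OF insert.hyps]
      by (intro insert.IH Ck_on_add Ck_on_bounded_bilinear[OF bounded_bilinear_scaleR] \<open>open S\<close>
          Ck_on_bounded_linear[OF bounded_linear_inner_left] Dg(2) Suc.IH[OF Df(2)] Ck_on_lower[OF Suc.prems(2)])
  qed
  ultimately show ?case
    by (intro Ck_on_SucI[OF \<open>open S\<close>]) auto
qed

lemma smooth_on_cong: "open S \<Longrightarrow> (\<And>x. x \<in> S \<Longrightarrow> f x = g x) \<Longrightarrow> smooth_on S f \<Longrightarrow> smooth_on S g"
  unfolding smooth_on_def using Ck_on_cong by blast

lemma smooth_on_subset: "smooth_on S f \<Longrightarrow> T \<subseteq> S \<Longrightarrow> smooth_on T f"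
  unfolding smooth_on_def using Ck_on_subset by blast

lemma smooth_on_const: "smooth_on S (\<lambda>x. c)"
  by (simp add: smooth_on_def Ck_on_const)

lemma smooth_on_bounded_linear:
  "bounded_linear L \<Longrightarrow> open S \<Longrightarrow> smooth_on S f \<Longrightarrow> smooth_on S (\<lambda>x. L (f x))"
  by (simp add: smooth_on_def Ck_on_bounded_linear)

lemma smooth_on_add: "open S \<Longrightarrow> smooth_on S f \<Longrightarrow> smooth_on S g \<Longrightarrow> smooth_on S (\<lambda>x. f x + g x)"
  by (simp add: smooth_on_def Ck_on_add)

lemma smooth_on_minus: "open S \<Longrightarrow> smooth_on S f \<Longrightarrow> smooth_on S (\<lambda>x. - f x)"
  by (rule smooth_on_bounded_linear[OF bounded_linear_minus[OF bounded_linear_ident]])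

lemma smooth_on_diff: "open S \<Longrightarrow> smooth_on S f \<Longrightarrow> smooth_on S g \<Longrightarrow> smooth_on S (\<lambda>x. f x - g x)"
  using smooth_on_add[of S f "\<lambda>x. - g x"] smooth_on_minus[of S g] by simp

lemma smooth_on_sum:
  "open S \<Longrightarrow> (\<And>i. i \<in> I \<Longrightarrow> smooth_on S (f i)) \<Longrightarrow> smooth_on S (\<lambda>x. \<Sum>i\<in>I. f i x)"
  by (induction I rule: infinite_finite_induct) (auto intro: smooth_on_const smooth_on_add)

lemma smooth_on_mult:
  fixes f g :: "'a::real_normed_vector \<Rightarrow> real"
  shows "open S \<Longrightarrow> smooth_on S f \<Longrightarrow> smooth_on S g \<Longrightarrow> smooth_on S (\<lambda>x. f x * g x)"
  by (simp add: smooth_on_def Ck_on_bounded_bilinear[OF bounded_bilinear_mult])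

lemma smooth_on_compose:
  fixes f :: "'b::euclidean_space \<Rightarrow> 'c::real_normed_vector"
  shows "open S \<Longrightarrow> open T \<Longrightarrow> smooth_on T f \<Longrightarrow> smooth_on S g \<Longrightarrow> g ` S \<subseteq> T
    \<Longrightarrow> smooth_on S (\<lambda>x. f (g x))"
  by (simp add: smooth_on_def Ck_on_compose)

lemma smooth_on_vec_nth: "open S \<Longrightarrow> smooth_on S f \<Longrightarrow> smooth_on S (\<lambda>x. f x $ i)"
  by (rule smooth_on_bounded_linear[OF bounded_linear_vec_nth])

lemma bounded_linear_axis: "bounded_linear (axis i :: 'a::real_normed_vector \<Rightarrow> 'a^'n)"
proof (rule bounded_linear_intro[where K = 1])
  fix x :: 'a
  have "norm (axis i x :: 'a^'n) \<le> (\<Sum>j\<in>UNIV. norm ((axis i x :: 'a^'n) $ j))"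
    unfolding norm_vec_def by (rule L2_set_le_sum) simp
  also have "\<dots> = norm x"
    by (simp add: axis_def if_distrib cong: if_cong)
  finally show "norm (axis i x :: 'a^'n) \<le> norm x * 1" by simp
qed (auto simp: vec_eq_iff axis_def)

lemma smooth_on_vec:
  fixes f :: "'a::real_normed_vector \<Rightarrow> 'b::real_normed_vector^'n"
  assumes "open S" "\<And>i. smooth_on S (\<lambda>x. f x $ i)"
  shows "smooth_on S f"
proof -
  have "(\<Sum>i\<in>UNIV. axis i (f x $ i)) = f x" for x
    by (simp add: vec_eq_iff axis_def)
  moreover have "smooth_on S (\<lambda>x. \<Sum>i\<in>UNIV. axis i (f x $ i) :: 'b^'n)"
    by (intro smooth_on_sum smooth_on_bounded_linear[OF bounded_linear_axis] assms)
  ultimately show ?thesis by simp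
qed

lemma Ck_on_id: "Ck_on k S (\<lambda>x. x)"
  by (cases k) (auto simp: Ck_on_const)

lemma smooth_on_id: "smooth_on S (\<lambda>x. x)"
  by (simp add: smooth_on_def Ck_on_id)

text \<open>The derivative of \<open>inverse\<close> is a polynomial in \<open>inverse\<close>
  itself, so each order of differentiability yields the next.\<close>

lemma smooth_on_inverse: "smooth_on {x::real. x \<noteq> 0} inverse"
proof -
  have o: "open {x::real. x \<noteq> 0}" by (simp add: open_Collect_neq continuous_intros)
  have "Ck_on k {x::real. x \<noteq> 0} inverse" for k
  proof (induction k)
    case 0
    then show ?case by (auto intro!: continuous_intros)
  next
    case (Suc k)
    have 1: "Ck_on k {x::real. x \<noteq> 0} (\<lambda>x. - (inverse x * h * inverse x))" for h
      by (intro Ck_on_bounded_linear[OF bounded_linear_minus[OF bounded_linear_ident]]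
          Ck_on_bounded_bilinear[OF bounded_bilinear_mult] o Suc Ck_on_const)
    show ?case
      by (rule Ck_on_SucI[OF o _ 1]) (auto intro: has_derivative_inverse')
  qed
  then show ?thesis by (simp add: smooth_on_def)
qed

lemma smooth_on_divide:
  fixes f g :: "'a::real_normed_vector \<Rightarrow> real"
  assumes "open S" "smooth_on S f" "smooth_on S g" "\<And>x. x \<in> S \<Longrightarrow> g x \<noteq> 0"
  shows "smooth_on S (\<lambda>x. f x / g x)"
proof -
  have "smooth_on S (\<lambda>x. inverse (g x))"
    by (rule smooth_on_compose[OF assms(1) _ smooth_on_inverse assms(3)])
      (use assms(4) in \<open>auto simp: open_Collect_neq continuous_intros\<close>)
  then show ?thesis
    using smooth_on_mult[OF assms(1,2)] by (simp add: divide_inverse)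
qed

text \<open>The derivative of \<open>sqrt\<close> is a smooth function of \<open>sqrt\<close>, which
  drives the same induction as for \<open>inverse\<close>.\<close>

lemma smooth_on_sqrt: "smooth_on {x::real. 0 < x} sqrt"
proof -
  have o: "open {x::real. 0 < x}" by (simp add: open_Collect_less continuous_intros)
  have "Ck_on k {x::real. 0 < x} sqrt" for k
  proof (induction k)
    case 0
    then show ?case by (auto intro!: continuous_intros)
  next
    case (Suc k)
    have 1: "Ck_on k {x::real. 0 < x} (\<lambda>x. h * (inverse (sqrt x) / 2))" for h
    proof -
      have "Ck_on k {x::real. 0 < x} (\<lambda>x. inverse (sqrt x))"
        by (rule Ck_on_compose[OF o _ smooth_on_inverse[unfolded smooth_on_def, rule_format] Suc])
         (auto simp: open_Collect_neq continuous_intros)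
      then show ?thesis
        by (intro Ck_on_bounded_bilinear[OF bounded_bilinear_mult]
            Ck_on_bounded_linear[OF bounded_linear_divide] o Ck_on_const)
    qed
    show ?case
      by (rule Ck_on_SucI[OF o _ 1]) (auto intro!: has_derivative_eq_rhs[OF has_derivative_real_sqrt[OF _ has_derivative_ident]])
  qed
  then show ?thesis by (simp add: smooth_on_def)
qed

lemma smooth_onD:
  assumes "smooth_on S f"
  shows "\<And>x. x \<in> S \<Longrightarrow> (f has_derivative frechet_derivative f (at x)) (at x)"
    "\<And>h. smooth_on S (\<lambda>x. frechet_derivative f (at x) h)"
    "continuous_on S f"
  using assms Ck_on_SucD[of _ S f] unfolding smooth_on_def
  using Ck_on.simps(1) by blast+

section \<open>Partial derivatives and the symmetry of second derivatives\<close>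

lemma smooth_on_partial_deriv: "smooth_on S f \<Longrightarrow> smooth_on S (partial_deriv i f)"
  unfolding partial_deriv_def by (rule smooth_onD(2))

lemma has_derivative_partial_deriv:
  fixes f :: "real^'n \<Rightarrow> 'b::real_normed_vector"
  assumes "(f has_derivative D) (at x)"
  shows "D v = (\<Sum>i\<in>UNIV. v $ i *\<^sub>R partial_deriv i f x)"
proof -
  interpret linear D using assms has_derivative_linear by auto
  have "v = (\<Sum>i\<in>UNIV. v $ i *\<^sub>R axis i 1)"
    using basis_expansion[of v] by (simp add: scalar_mult_eq_scaleR)
  then have "D v = (\<Sum>i\<in>UNIV. v $ i *\<^sub>R D (axis i 1))"
    using sum[of "\<lambda>i. v $ i *\<^sub>R axis i 1" UNIV] by (simp add: scale)
  then show ?thesis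
    using assms by (simp add: partial_deriv_def frechet_derivative_at[symmetric])
qed

lemma smooth_on_has_derivative:
  fixes f :: "real^'n \<Rightarrow> 'b::real_normed_vector"
  assumes "smooth_on S f" "x \<in> S"
  shows "(f has_derivative (\<lambda>v. \<Sum>i\<in>UNIV. v $ i *\<^sub>R partial_deriv i f x)) (at x)"
  using smooth_onD(1)[OF assms] has_derivative_partial_deriv[OF smooth_onD(1)[OF assms]]
  by (metis (no_types, lifting) ext)

text \<open>The second difference over the parallelogram spanned by \<open>u\<close> and
  \<open>v\<close> is symmetric in the two vectors, while the right-hand side differentiates first
  along \<open>u\<close> and then along \<open>v\<close>. Using it in both orders compares the mixed
  derivatives.\<close>

lemma second_difference_mean_value:
  fixes f :: "'a::real_normed_vector \<Rightarrow> real"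
  assumes f: "\<And>y. y \<in> ball x r \<Longrightarrow> (f has_derivative Df y) (at y)"
    and a: "\<And>y. y \<in> ball x r \<Longrightarrow> ((\<lambda>y. Df y u) has_derivative Da y) (at y)"
    and s: "0 < s" "s * (norm u + norm v) < r"
  obtains p where "dist x p \<le> s * (norm u + norm v)"
    "f (x + s *\<^sub>R u + s *\<^sub>R v) - f (x + s *\<^sub>R u) - f (x + s *\<^sub>R v) + f x = s * s * Da p v"
proof -
  have d: "dist x (x + \<sigma> *\<^sub>R u + \<tau> *\<^sub>R v) \<le> s * (norm u + norm v)" if "0 \<le> \<sigma>" "\<sigma> \<le> s" "0 \<le> \<tau>" "\<tau> \<le> s" for \<sigma> \<tau>
  proof -
    have "norm (\<sigma> *\<^sub>R u + \<tau> *\<^sub>R v) \<le> \<bar>\<sigma>\<bar> * norm u + \<bar>\<tau>\<bar> * norm v"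
      by (metis norm_triangle_ineq norm_scaleR)
    also have "\<dots> \<le> s * norm u + s * norm v"
      using that by (intro add_mono mult_right_mono) auto
    finally show ?thesis
      using norm_minus_cancel[of "\<sigma> *\<^sub>R u + \<tau> *\<^sub>R v"] by (simp add: dist_norm algebra_simps)
  qed
  then have b: "x + \<sigma> *\<^sub>R u + \<tau> *\<^sub>R v \<in> ball x r" if "0 \<le> \<sigma>" "\<sigma> \<le> s" "0 \<le> \<tau>" "\<tau> \<le> s" for \<sigma> \<tau>
    using d[OF that] s(2) by simp
  \<comment> \<open>The mean value theorem along \<open>u\<close>, applied to the difference in
    direction \<open>v\<close>, leaves a difference of first derivatives, to which it applies once
    more along \<open>v\<close>.\<close>
  define \<phi> where "\<phi> \<sigma> = f (x + \<sigma> *\<^sub>R u + s *\<^sub>R v) - f (x + \<sigma> *\<^sub>R u)" for \<sigma>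
  have "\<exists>z>0. z < s \<and> \<phi> s - \<phi> 0 = (s - 0) * (Df (x + z *\<^sub>R u + s *\<^sub>R v) u - Df (x + z *\<^sub>R u) u)"
  proof (rule MVT2[OF s(1)])
    fix z assume z: "0 \<le> z" "z \<le> s"
    note f1 = f[OF b[OF z, of s]] and f2 = f[OF b[OF z, of 0]]
    interpret l1: linear "Df (x + z *\<^sub>R u + s *\<^sub>R v)" using f1 s has_derivative_linear by auto
    interpret l2: linear "Df (x + z *\<^sub>R u)" using f2 s has_derivative_linear by auto
    have e: "((\<lambda>\<sigma>. f (x + \<sigma> *\<^sub>R u + t *\<^sub>R v)) has_derivative (\<lambda>h. Df (x + z *\<^sub>R u + t *\<^sub>R v) (h *\<^sub>R u))) (at z)"
      if "0 \<le> t" "t \<le> s" for t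
      by (rule has_derivative_compose[of "\<lambda>\<sigma>. x + \<sigma> *\<^sub>R u + t *\<^sub>R v" "\<lambda>h. h *\<^sub>R u" z UNIV f, OF _ f[OF b[OF z that]]])
        (auto intro!: derivative_eq_intros)
    show "(\<phi> has_real_derivative Df (x + z *\<^sub>R u + s *\<^sub>R v) u - Df (x + z *\<^sub>R u) u) (at z)"
      unfolding \<phi>_def has_field_derivative_def
      by (rule has_derivative_eq_rhs[OF has_derivative_diff[OF e[of s] e[of 0, unfolded scaleR_zero_left add_0_right]]])
        (use s in \<open>auto simp: fun_eq_iff l1.scale l2.scale right_diff_distrib mult.commute\<close>)
  qed
  then obtain z where z: "0 < z" "z < s" "\<phi> s - \<phi> 0 = s * (Df (x + z *\<^sub>R u + s *\<^sub>R v) u - Df (x + z *\<^sub>R u) u)"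
    by auto
  have "\<exists>w>0. w < s \<and> Df (x + z *\<^sub>R u + s *\<^sub>R v) u - Df (x + z *\<^sub>R u + 0 *\<^sub>R v) u = (s - 0) * Da (x + z *\<^sub>R u + w *\<^sub>R v) v"
  proof (rule MVT2[OF s(1)])
    fix w assume w: "0 \<le> w" "w \<le> s"
    note a1 = a[OF b[OF _ _ w, of z]]
    interpret l1: linear "Da (x + z *\<^sub>R u + w *\<^sub>R v)" using a1 z has_derivative_linear by auto
    show "((\<lambda>w. Df (x + z *\<^sub>R u + w *\<^sub>R v) u) has_real_derivative Da (x + z *\<^sub>R u + w *\<^sub>R v) v) (at w)"
      unfolding has_field_derivative_def
      by (rule has_derivative_eq_rhs[OF has_derivative_compose[of "\<lambda>w. x + z *\<^sub>R u + w *\<^sub>R v" "\<lambda>h. h *\<^sub>R v" w UNIV "\<lambda>y. Df y u", OF _ a1]])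
        (use z in \<open>auto intro!: derivative_eq_intros simp: l1.scale\<close>)
  qed
  then obtain w where w: "0 < w" "w < s"
    "Df (x + z *\<^sub>R u + s *\<^sub>R v) u - Df (x + z *\<^sub>R u) u = s * Da (x + z *\<^sub>R u + w *\<^sub>R v) v"
    by auto
  show thesis
    by (rule that[OF d[of z w]]) (use z w in \<open>auto simp: \<phi>_def\<close>)
qed

text \<open>The two mixed derivatives take equal values at points arbitrarily close to
  \<open>x\<close>. Both are continuous, so a gap at \<open>x\<close> itself is impossible.\<close>

lemma frechet_derivative_commute:
  fixes f :: "'a::real_normed_vector \<Rightarrow> real"
  assumes "open S" "smooth_on S f" "x \<in> S"
  shows "frechet_derivative (\<lambda>y. frechet_derivative f (at y) u) (at x) v
    = frechet_derivative (\<lambda>y. frechet_derivative f (at y) v) (at x) u"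
    (is "?A x = ?B x")
proof (rule ccontr)
  assume "?A x \<noteq> ?B x"
  define e where "e = \<bar>?A x - ?B x\<bar> / 2"
  have e: "e > 0" using \<open>?A x \<noteq> ?B x\<close> by (simp add: e_def)
  have cA: "isCont ?A x" and cB: "isCont ?B x"
    using assms(1,3) smooth_onD(3)[OF smooth_onD(2)[OF smooth_onD(2)[OF assms(2)]]]
    by (auto simp: continuous_on_eq_continuous_at)
  obtain r1 where r1: "r1 > 0" "\<And>y. dist x y < r1 \<Longrightarrow> dist (?A y) (?A x) < e"
    using cA e unfolding continuous_at_eps_delta by (metis dist_commute)
  obtain r2 where r2: "r2 > 0" "\<And>y. dist x y < r2 \<Longrightarrow> dist (?B y) (?B x) < e"
    using cB e unfolding continuous_at_eps_delta by (metis dist_commute)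
  obtain r3 where r3: "r3 > 0" "ball x r3 \<subseteq> S" using assms openE by blast
  define r where "r = min r1 (min r2 r3)"
  have r: "r > 0" "r \<le> r1" "r \<le> r2" "r \<le> r3" using r1 r2 r3 by (auto simp: r_def)
  \<comment> \<open>The summand 1 keeps the denominator positive when \<open>u\<close> and
    \<open>v\<close> vanish and makes the bound \<open>s * (norm u + norm v) < r\<close>
    strict.\<close>
  define s where "s = r / (norm u + norm v + 1)"
  have n: "norm u + norm v + 1 > 0" by (simp add: add_nonneg_pos)
  have s: "s > 0" using r n by (simp add: s_def)
  have "s * (norm u + norm v) < s * (norm u + norm v + 1)" using s by (intro mult_strict_left_mono) auto
  also have "\<dots> = r" using n by (simp add: s_def)
  finally have sr: "s * (norm u + norm v) < r" .
  have sub: "y \<in> S" if "y \<in> ball x r" for y using that r r3 by auto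
  note D = smooth_onD[OF assms(2)]
  obtain p where p: "dist x p \<le> s * (norm u + norm v)"
    "f (x + s *\<^sub>R u + s *\<^sub>R v) - f (x + s *\<^sub>R u) - f (x + s *\<^sub>R v) + f x = s * s * ?A p"
    by (rule second_difference_mean_value[OF D(1)[OF sub] smooth_onD(1)[OF D(2) sub] s sr]) auto
  have sr': "s * (norm v + norm u) < r" using sr by (simp add: add.commute)
  obtain q where q: "dist x q \<le> s * (norm v + norm u)"
    "f (x + s *\<^sub>R v + s *\<^sub>R u) - f (x + s *\<^sub>R v) - f (x + s *\<^sub>R u) + f x = s * s * ?B q"
    by (rule second_difference_mean_value[OF D(1)[OF sub] smooth_onD(1)[OF D(2) sub] s sr']) auto
  have "s * s * ?A p = s * s * ?B q" using p q by (simp add: algebra_simps)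
  then have "?A p = ?B q" using s by simp
  moreover have "dist (?A p) (?A x) < e" using r1(2)[of p] p sr r by auto
  moreover have "dist (?B q) (?B x) < e" using r2(2)[of q] q sr' r by auto
  moreover have "dist A B < 2 * e" if "a = b" "dist a A < e" "dist b B < e" for a b A B :: real
    using that unfolding dist_real_def by linarith
  ultimately have "dist (?A x) (?B x) < 2 * e" by blast
  then show False unfolding dist_real_def e_def by simp
qed

lemma partial_deriv_commute:
  fixes f :: "real^'n \<Rightarrow> real"
  assumes "open S" "smooth_on S f" "x \<in> S"
  shows "partial_deriv i (partial_deriv j f) x = partial_deriv j (partial_deriv i f) x"
  unfolding partial_deriv_def using frechet_derivative_commute[OF assms] by simp

section \<open>Jacobian matrices and smooth inverses in the plane\<close>

lemma frechet_derivative_linear: "smooth_on S f \<Longrightarrow> x \<in> S \<Longrightarrow> linear (frechet_derivative f (at x))"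
  using smooth_onD(1) has_derivative_linear by blast

lemma jacobian_at_nth:
  fixes f :: "real^'n \<Rightarrow> real^'m"
  assumes "smooth_on S f" "x \<in> S"
  shows "jacobian_at f x $ a $ i = partial_deriv i f x $ a"
  by (simp add: jacobian_at_def matrix_def partial_deriv_def)

lemma jacobian_at_works:
  fixes f :: "real^'n \<Rightarrow> real^'m"
  assumes "smooth_on S f" "x \<in> S"
  shows "frechet_derivative f (at x) v = jacobian_at f x *v v"
  unfolding jacobian_at_def using matrix_works frechet_derivative_linear[OF assms]
  by (metis linear_matrix_vector_mul_eq)

text \<open>Injectivity is given, so invariance of domain already provides the open image. The
  derivative of the inverse is a smooth matrix function composed with the inverse, hence every order
  of differentiability of the inverse implies the next.\<close>

lemma smooth_inverse_function:
  fixes \<theta> :: "real^2 \<Rightarrow> real^2"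
  assumes E: "open E" "smooth_on E \<theta>" "inj_on \<theta> E" and d: "\<And>x. x \<in> E \<Longrightarrow> det (jacobian_at \<theta> x) \<noteq> 0"
  shows "open (\<theta> ` E)" "smooth_on (\<theta> ` E) (inv_into E \<theta>)"
proof -
  show o: "open (\<theta> ` E)" using invariance_of_domain smooth_onD(3) E by blast
  define J where "J = jacobian_at \<theta>"
  \<comment> \<open>Cramer's rule: the adjugate of the Jacobian matrix divided by its determinant,
    applied to \<open>h\<close>.\<close>
  define A :: "real^2 \<Rightarrow> real^2 \<Rightarrow> real^2" where "A x h = vector [J x $ 2 $ 2 * h $ 1 - J x $ 1 $ 2 * h $ 2, J x $ 1 $ 1 * h $ 2 - J x $ 2 $ 1 * h $ 1] /\<^sub>R det (J x)"
    for x h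
  have "frechet_derivative \<theta> (at x) (A x h) = h" if "x \<in> E" for x h
    using d[OF that] unfolding jacobian_at_works[OF E(2) that] J_def[symmetric] A_def
    by (simp add: vec_eq_iff forall_2 matrix_vector_mult_def sum_2 divide_simps) (simp add: det_2 algebra_simps)
  then have inv: "frechet_derivative \<theta> (at x) \<circ> A x = id" if "x \<in> E" for x
    using that by (auto simp: o_def)
  have der: "(inv_into E \<theta> has_derivative A (inv_into E \<theta> y)) (at y)" if "y \<in> \<theta> ` E" for y
    using has_derivative_inverse_on[where g' = A, OF E(1) smooth_onD(1)[OF E(2)] _ inv, of "inv_into E \<theta>" "inv_into E \<theta> y"] that E(3)
    by (auto simp: inv_into_f_f)
  have sJ: "smooth_on E (\<lambda>x. J x $ i $ j)" for i j
    by (rule smooth_on_cong[OF E(1) _ smooth_on_vec_nth[OF E(1) smooth_on_partial_deriv[OF E(2), of j], where i = i]])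
      (simp add: J_def jacobian_at_nth[OF E(2)])
  have sA: "smooth_on E (\<lambda>x. A x h)" for h
  proof (rule smooth_on_vec[OF E(1)])
    have "smooth_on E (\<lambda>x. A x h $ 1)" "smooth_on E (\<lambda>x. A x h $ 2)"
      unfolding A_def vector_scaleR_component vector_2 det_2 real_scaleR_def
      using d
      by (auto simp: J_def[symmetric] det_2 inverse_eq_divide intro!: smooth_on_mult smooth_on_diff smooth_on_divide E(1) sJ smooth_on_const)
    then show "smooth_on E (\<lambda>x. A x h $ i)" for i
      using exhaust_2[of i] by auto
  qed
  have "Ck_on k (\<theta> ` E) (inv_into E \<theta>)" for k
  proof (induction k)
    case 0
    show ?case
      unfolding Ck_on.simps
      by (intro continuous_at_imp_continuous_on ballI) (rule has_derivative_continuous[OF der])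
  next
    case (Suc k)
    show ?case
      by (rule Ck_on_SucI[OF o der], assumption)
        (rule Ck_on_compose[OF o E(1) sA[unfolded smooth_on_def, rule_format] Suc], auto simp: E inv_into_into)
  qed
  then show "smooth_on (\<theta> ` E) (inv_into E \<theta>)" by (simp add: smooth_on_def)
qed

section \<open>Flat linear systems\<close>

lemma bounded_bilinear_matrix_vector_mult:
  "bounded_bilinear ((*v) :: real^'n^'m \<Rightarrow> real^'n \<Rightarrow> real^'m)"
  unfolding bilinear_conv_bounded_bilinear[symmetric]
  by (auto simp: bilinear_def linear_iff matrix_vector_right_distrib matrix_vector_mult_add_rdistrib
      matrix_vector_mult_scaleR scaleR_matrix_vector_assoc)

lemmas continuous_on_matrix_vector_mult [continuous_intros] =
  bounded_bilinear.continuous_on[OF bounded_bilinear_matrix_vector_mult]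

lemma has_vector_derivative_matrix_vector_mult:
  fixes A :: "real \<Rightarrow> real^'n^'m"
  assumes "(A has_vector_derivative A') (at t within S)" "(y has_vector_derivative y') (at t within S)"
  shows "((\<lambda>t. A t *v y t) has_vector_derivative A t *v y' + A' *v y t) (at t within S)"
  using bounded_bilinear.has_vector_derivative[OF bounded_bilinear_matrix_vector_mult assms] .

text \<open>The differentiated expression is the oriented integral of \<open>k\<close> from 0 to
  \<open>y\<close>, rescaled to the interval from 0 to 1. In this form negative \<open>y\<close>
  needs no separate treatment, and facts on integrals with a parameter over a fixed interval
  apply.\<close>

lemma has_vector_derivative_scaled_integral:
  fixes k :: "real \<Rightarrow> 'a::banach"
  assumes k: "continuous_on {-r<..<r} k" and y: "\<bar>y\<bar> < r"
  shows "((\<lambda>y. y *\<^sub>R integral {0..1} (\<lambda>\<tau>. k (\<tau> * y))) has_vector_derivative k y) (at y)"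
proof -
  obtain R where R: "\<bar>y\<bar> < R" "R < r" using y dense by blast
  have kR: "continuous_on {-R..R} k" using R by (intro continuous_on_subset[OF k]) auto
  obtain G where G: "\<And>z. z \<in> {-R..R} \<Longrightarrow> (G has_vector_derivative k z) (at z within {-R..R})"
    using antiderivative_continuous[OF kR] by blast
  have eq: "z *\<^sub>R integral {0..1} (\<lambda>\<tau>. k (\<tau> * z)) = G z - G 0" if z: "z \<in> {-R<..<R}" for z
  proof -
    have in_R: "\<tau> * z \<in> {-R..R}" if "\<tau> \<in> {0..1}" for \<tau>
    proof -
      have "\<bar>\<tau> * z\<bar> \<le> 1 * \<bar>z\<bar>" unfolding abs_mult using that by (intro mult_right_mono) auto
      then show ?thesis using z by auto
    qed
    then have img: "(\<lambda>\<tau>. \<tau> * z) ` {0..1} \<subseteq> {-R..R}" by blast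
    have "((\<lambda>\<tau>. z *\<^sub>R k (\<tau> * z)) has_integral G (1 * z) - G (0 * z)) {0..1}"
    proof (rule fundamental_theorem_of_calculus)
      fix \<tau> :: real assume \<tau>: "\<tau> \<in> {0..1}"
      have 1: "((\<lambda>\<tau>. \<tau> * z) has_vector_derivative z) (at \<tau> within {0..1})"
        by (auto intro!: derivative_eq_intros)
      show "((\<lambda>\<tau>. G (\<tau> * z)) has_vector_derivative z *\<^sub>R k (\<tau> * z)) (at \<tau> within {0..1})"
        using vector_diff_chain_within[OF 1 has_vector_derivative_within_subset[OF G[OF in_R[OF \<tau>]] img]]
        by (simp add: o_def)
    qed simp
    then have "integral {0..1} (\<lambda>\<tau>. z *\<^sub>R k (\<tau> * z)) = G (1 * z) - G (0 * z)" by (rule integral_unique)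
    then show ?thesis by simp
  qed
  have "(G has_vector_derivative k y) (at y)"
    using G[of y] R by (auto simp: at_within_Icc_at abs_less_iff)
  then have "((\<lambda>z. G z - G 0) has_vector_derivative k y) (at y)"
    by (auto intro!: derivative_eq_intros)
  then show ?thesis
    by (rule has_vector_derivative_transform_within_open[where S = "{-R<..<R}"]) (use R eq in auto)
qed

lemma continuous_on_scaled_integral:
  fixes f :: "'a::topological_space \<Rightarrow> real \<Rightarrow> 'b::banach"
  assumes "continuous_on (U \<times> {0..1}) (\<lambda>(x, t). f x t)"
  shows "continuous_on U (\<lambda>x. integral {0..1} (f x))"
  using integral_continuous_on_param[of U 0 1 f] assms by simp

lemma continuous_on_curried:
  assumes "continuous_on (S \<times> U) (\<lambda>(x, y). h x y)" "continuous_on T f" "continuous_on T g"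
    "\<And>z. z \<in> T \<Longrightarrow> f z \<in> S" "\<And>z. z \<in> T \<Longrightarrow> g z \<in> U"
  shows "continuous_on T (\<lambda>z. h (f z) (g z))"
proof -
  have "continuous_on T (\<lambda>z. (f z, g z))" "(\<lambda>z. (f z, g z)) ` T \<subseteq> S \<times> U"
    using assms by (auto intro!: continuous_intros)
  from continuous_on_compose2[OF assms(1) this] show ?thesis by simp
qed

lemma norm_integral_unit_le:
  fixes f :: "real \<Rightarrow> 'b::banach"
  assumes "continuous_on {0..1} f" "\<And>t. t \<in> {0..1} \<Longrightarrow> norm (f t) \<le> B"
  shows "norm (integral {0..1} f) \<le> B"
  using integral_bound[of 0 1 f B] assms by auto

definition clamp_to :: "real \<Rightarrow> real \<Rightarrow> real" where
  "clamp_to r t = max (- r) (min r t)"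

lemma clamp_to: "0 \<le> r \<Longrightarrow> \<bar>clamp_to r t\<bar> \<le> r" "\<bar>t\<bar> \<le> r \<Longrightarrow> clamp_to r t = t"
  by (auto simp: clamp_to_def)

lemma continuous_on_clamp_to [continuous_intros]:
  "continuous_on S f \<Longrightarrow> continuous_on S (\<lambda>x. clamp_to r (f x))"
  unfolding clamp_to_def by (intro continuous_intros)

text \<open>The solution is the fixed point of the Picard operator; the time variable is clamped so that
  the operator acts on globally bounded functions.\<close>

lemma parametric_linear_ode:
  fixes A :: "real \<times> real \<Rightarrow> real^'n^'n" and P :: "real \<Rightarrow> real^'n"
  assumes A: "continuous_on UNIV A" and M: "\<And>z y. norm (A z *v y) \<le> M * norm y" "0 \<le> M"
    and r: "0 < r" "r * M \<le> 1 / 2" and P: "continuous_on UNIV P" "bounded (range P)"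
  obtains Q where "continuous_on UNIV Q" "bounded (range Q)" "\<And>x. Q (x, 0) = P x"
    "\<And>x y. \<bar>y\<bar> < r \<Longrightarrow> ((\<lambda>y. Q (x, y)) has_vector_derivative A (x, y) *v Q (x, y)) (at y)"
proof -
  define c where "c = clamp_to r"
  define k where "k Q z \<tau> = A (fst z, \<tau> * c (snd z)) *v apply_bcontfun Q (fst z, \<tau> * c (snd z))"
    for Q :: "(real \<times> real) \<Rightarrow>\<^sub>C (real^'n)" and z \<tau>
  \<comment> \<open>Unscaled, the first component of \<open>z\<close> is a parameter
    \<open>x\<close>, and the value is \<open>P x\<close> plus the integral of \<open>A * Q\<close>
    over the line with this \<open>x\<close>, from 0 to the clamped second component.\<close>
  define T where "T Q z = P (fst z) + c (snd z) *\<^sub>R integral {0..1} (k Q z)" for Q z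
  have c: "continuous_on S (\<lambda>z. c (snd z))" for S :: "(real \<times> real) set"
    unfolding c_def by (intro continuous_intros)
  have c_le: "\<bar>c y\<bar> \<le> r" for y using clamp_to(1) r by (simp add: c_def)
  have contk: "continuous_on (S \<times> U) (\<lambda>(z, \<tau>). k Q z \<tau>)" for Q S U
    unfolding k_def c_def split_beta
    by (intro continuous_intros continuous_on_compose2[OF A] continuous_on_compose2[OF continuous_on_apply_bcontfun]) auto
  have contk1: "continuous_on U (k Q z)" for Q z U
    unfolding k_def
    by (intro continuous_intros continuous_on_compose2[OF A] continuous_on_compose2[OF continuous_on_apply_bcontfun]) auto
  have contT: "continuous_on UNIV (T Q)" for Q
    unfolding T_def
    by (intro continuous_intros c continuous_on_compose2[OF P(1)] continuous_on_scaled_integral contk) auto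
  obtain BP where BP: "\<And>x. norm (P x) \<le> BP" using P(2) by (auto simp: bounded_iff)
  have "norm (T Q z) \<le> BP + r * (M * norm Q)" for Q z
  proof -
    have "norm (k Q z \<tau>) \<le> M * norm Q" for \<tau>
      unfolding k_def by (rule order_trans[OF M(1)]) (intro mult_left_mono norm_bounded M)
    then have "norm (integral {0..1} (k Q z)) \<le> M * norm Q"
      by (intro norm_integral_unit_le contk1)
    then have "norm (c (snd z) *\<^sub>R integral {0..1} (k Q z)) \<le> r * (M * norm Q)"
      unfolding norm_scaleR using c_le M r by (intro mult_mono) auto
    then show ?thesis unfolding T_def
      by (intro norm_triangle_le add_mono BP)
  qed
  then have "bounded (range (T Q))" for Q
    unfolding bounded_iff by auto
  then have T: "apply_bcontfun (Bcontfun (T Q)) = T Q" for Q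
    using contT by (intro Bcontfun_inverse) (simp add: bcontfun_def)
  \<comment> \<open>The clamp bounds the length of integration by \<open>r\<close>, so the
    hypothesis \<open>r * M \<le> 1 / 2\<close> is the contraction factor.\<close>
  have "dist (Bcontfun (T Q)) (Bcontfun (T Q')) \<le> 1 / 2 * dist Q Q'" for Q Q'
  proof (rule dist_bound)
    fix z
    have "norm (k Q z \<tau> - k Q' z \<tau>) \<le> M * dist Q Q'" for \<tau>
      unfolding k_def matrix_vector_mult_diff_distrib[symmetric]
      by (rule order_trans[OF M(1)]) (intro mult_left_mono M dist_bounded[of Q _ Q', THEN order_trans[OF eq_refl[OF dist_norm[symmetric]]]])
    then have "norm (integral {0..1} (\<lambda>\<tau>. k Q z \<tau> - k Q' z \<tau>)) \<le> M * dist Q Q'"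
      by (intro norm_integral_unit_le continuous_intros contk1)
    then have "norm (c (snd z) *\<^sub>R integral {0..1} (\<lambda>\<tau>. k Q z \<tau> - k Q' z \<tau>)) \<le> r * (M * dist Q Q')"
      unfolding norm_scaleR using c_le M r by (intro mult_mono) auto
    also have "integral {0..1} (\<lambda>\<tau>. k Q z \<tau> - k Q' z \<tau>) = integral {0..1} (k Q z) - integral {0..1} (k Q' z)"
      by (intro integral_diff integrable_continuous_real contk1)
    also have "r * (M * dist Q Q') \<le> 1 / 2 * dist Q Q'"
      unfolding mult.assoc[symmetric] using r by (intro mult_right_mono) auto
    finally show "dist (apply_bcontfun (Bcontfun (T Q)) z) (apply_bcontfun (Bcontfun (T Q')) z) \<le> 1 / 2 * dist Q Q'"
      unfolding T by (simp add: T_def dist_norm scaleR_diff_right)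
  qed
  then obtain Q where Q: "Bcontfun (T Q) = Q"
    using banach_fix_type[of "1 / 2" "\<lambda>Q. Bcontfun (T Q)"] by auto
  then have fixQ: "apply_bcontfun Q z = T Q z" for z using T by metis
  show thesis
  proof (rule that[of "apply_bcontfun Q"])
    show "apply_bcontfun Q (x, 0) = P x" for x
      using fixQ[of "(x, 0)"] r by (simp add: T_def c_def clamp_to)
  next
    fix x y :: real assume y: "\<bar>y\<bar> < r"
    define kx where "kx s = A (x, s) *v apply_bcontfun Q (x, s)" for s
    have "continuous_on {-r<..<r} kx"
      unfolding kx_def by (intro continuous_intros continuous_on_compose2[OF A] continuous_on_compose2[OF continuous_on_apply_bcontfun]) auto
    from has_vector_derivative_scaled_integral[OF this y]
    have "((\<lambda>y. P x + y *\<^sub>R integral {0..1} (\<lambda>\<tau>. kx (\<tau> * y))) has_vector_derivative 0 + kx y) (at y)"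
      by (intro has_vector_derivative_add has_vector_derivative_const)
    then have "((\<lambda>y. apply_bcontfun Q (x, y)) has_vector_derivative 0 + kx y) (at y)"
    proof (rule has_vector_derivative_transform_within_open[where S = "{-r<..<r}"])
      show "P x + z *\<^sub>R integral {0..1} (\<lambda>\<tau>. kx (\<tau> * z)) = apply_bcontfun Q (x, z)" if "z \<in> {-r<..<r}" for z
      proof -
        have "c z = z" using clamp_to(2)[of z r] that by (auto simp: c_def abs_le_iff)
        then show ?thesis
          using fixQ[of "(x, z)"] by (simp add: T_def k_def[abs_def] kx_def[abs_def])
      qed
    qed (use y in auto)
    then show "((\<lambda>y. apply_bcontfun Q (x, y)) has_vector_derivative A (x, y) *v apply_bcontfun Q (x, y)) (at y)"
      by (simp add: kx_def)
  qed auto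
qed

text \<open>With $R(x,y) = Q(0,y) + \int_0^x A_1 Q$, flatness turns $\partial_y (R - Q)$ into an expression
  that is linear in $R - Q$, so $R - Q$ vanishes on a small square and $\partial_x Q = A_1 Q$.\<close>

lemma flat_system_propagation:
  fixes A1 A2 :: "real \<Rightarrow> real \<Rightarrow> real^'n^'n" and Q :: "real \<Rightarrow> real \<Rightarrow> real^'n"
    and r M :: real
  defines "S \<equiv> {-r<..<r}"
  assumes r: "0 < r" "r \<le> 1" "r * M \<le> 1 / 8" and M: "0 \<le> M"
    and cA1: "continuous_on (S \<times> S) (\<lambda>(x, y). A1 x y)" and cA2: "continuous_on (S \<times> S) (\<lambda>(x, y). A2 x y)"
    and cA1y: "continuous_on (S \<times> S) (\<lambda>(x, y). A1y x y)" and cA2x: "continuous_on (S \<times> S) (\<lambda>(x, y). A2x x y)"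
    and A1y: "\<And>x y. x \<in> S \<Longrightarrow> y \<in> S \<Longrightarrow> (A1 x has_vector_derivative A1y x y) (at y)"
    and A2x: "\<And>x y. x \<in> S \<Longrightarrow> y \<in> S \<Longrightarrow> ((\<lambda>x. A2 x y) has_vector_derivative A2x x y) (at x)"
    and flat: "\<And>x y. x \<in> S \<Longrightarrow> y \<in> S \<Longrightarrow> A1y x y + A1 x y ** A2 x y = A2x x y + A2 x y ** A1 x y"
    and bA2: "\<And>x y v. x \<in> S \<Longrightarrow> y \<in> S \<Longrightarrow> norm (A2 x y *v v) \<le> M * norm v"
    and bA2x: "\<And>x y v. x \<in> S \<Longrightarrow> y \<in> S \<Longrightarrow> norm (A2x x y *v v) \<le> M * norm v"
    and cQ: "continuous_on (S \<times> S) (\<lambda>(x, y). Q x y)"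
    and Qy: "\<And>x y. x \<in> S \<Longrightarrow> y \<in> S \<Longrightarrow> (Q x has_vector_derivative A2 x y *v Q x y) (at y)"
    and Qx0: "\<And>x. x \<in> S \<Longrightarrow> ((\<lambda>x. Q x 0) has_vector_derivative A1 x 0 *v Q x 0) (at x)"
    and xy: "x \<in> S" "y \<in> S"
  shows "((\<lambda>x. Q x y) has_vector_derivative A1 x y *v Q x y) (at x)"
proof -
  have zS: "0 \<in> S" using r by (simp add: S_def)
  have scS: "\<tau> * x \<in> S" if "\<tau> \<in> {0..1}" "x \<in> S" for \<tau> x
  proof -
    have "\<bar>\<tau> * x\<bar> \<le> 1 * \<bar>x\<bar>" unfolding abs_mult using that by (intro mult_right_mono) auto
    then show ?thesis using that by (auto simp: S_def abs_less_iff)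
  qed
  have oS: "open S" by (simp add: S_def)
  note cc = continuous_on_curried[OF cA1] continuous_on_curried[OF cA2] continuous_on_curried[OF cA1y]
    continuous_on_curried[OF cA2x] continuous_on_curried[OF cQ]
  define R where "R x y = Q 0 y + x *\<^sub>R integral {0..1} (\<lambda>\<tau>. A1 (\<tau> * x) y *v Q (\<tau> * x) y)" for x y
  define W where "W x y = R x y - Q x y" for x y
  have Rx: "((\<lambda>x. R x y) has_vector_derivative A1 x y *v Q x y) (at x)" if "x \<in> S" "y \<in> S" for x y
  proof -
    have "continuous_on S (\<lambda>s. A1 s y *v Q s y)"
      using that by (intro continuous_intros cc) auto
    then have "((\<lambda>x. Q 0 y + x *\<^sub>R integral {0..1} (\<lambda>\<tau>. (\<lambda>s. A1 s y *v Q s y) (\<tau> * x))) has_vector_derivative 0 + A1 x y *v Q x y) (at x)"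
      using that(1) unfolding S_def
      by (intro has_vector_derivative_add has_vector_derivative_const has_vector_derivative_scaled_integral) auto
    then show ?thesis by (simp add: R_def)
  qed
  have cR: "continuous_on (S \<times> S) (\<lambda>(x, y). R x y)"
    unfolding R_def split_beta using zS
    by (intro continuous_intros cc continuous_on_scaled_integral; (clarsimp simp: split_beta)?)
      (intro continuous_intros cc scS; auto)+
  have cW: "continuous_on (S \<times> S) (\<lambda>(x, y). W x y)"
    unfolding W_def split_beta
    by (intro continuous_intros cc continuous_on_curried[OF cR]) auto
  note cc = cc continuous_on_curried[OF cR] continuous_on_curried[OF cW]
  \<comment> \<open>On the axis \<open>y = 0\<close> both \<open>R\<close> and \<open>Q\<close> have
    \<open>x\<close>-derivative \<open>A1 * Q\<close>; hence \<open>W\<close> is constant there, and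
    it vanishes at the origin.\<close>
  have W0: "W x 0 = 0" if "x \<in> S" for x
  proof -
    have 0: "((\<lambda>x. W x 0) has_vector_derivative 0) (at x within S)" if "x \<in> S" for x
      using has_vector_derivative_diff[OF Rx[OF that zS] Qx0[OF that]]
      by (simp add: W_def has_vector_derivative_at_within)
    have "convex S" by (simp add: S_def)
    then obtain c where "\<And>x. x \<in> S \<Longrightarrow> W x 0 = c"
      using has_vector_derivative_zero_constant[OF _ 0] by blast
    moreover have "W 0 0 = 0" by (simp add: W_def R_def)
    ultimately show ?thesis using that zS by metis
  qed
  have Wy: "((\<lambda>y. W x y) has_vector_derivative
      A2 x y *v W x y - x *\<^sub>R integral {0..1} (\<lambda>\<tau>. A2x (\<tau> * x) y *v W (\<tau> * x) y)) (at y)"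
    if x: "x \<in> S" and y: "y \<in> S" for x y
  proof -
    let ?I = "integral {0..1}"
    have "((\<lambda>y. integral (cbox 0 1) (\<lambda>\<tau>. A1 (\<tau> * x) y *v Q (\<tau> * x) y)) has_vector_derivative
       integral (cbox 0 1) (\<lambda>\<tau>. A1 (\<tau> * x) y *v (A2 (\<tau> * x) y *v Q (\<tau> * x) y) + A1y (\<tau> * x) y *v Q (\<tau> * x) y)) (at y within S)"
    proof (rule leibniz_rule_vector_derivative[where U = S])
      show "((\<lambda>y. A1 (\<tau> * x) y *v Q (\<tau> * x) y) has_vector_derivative A1 (\<tau> * x) y *v (A2 (\<tau> * x) y *v Q (\<tau> * x) y) + A1y (\<tau> * x) y *v Q (\<tau> * x) y) (at y within S)"
        if "y \<in> S" "\<tau> \<in> cbox 0 1" for \<tau> y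
        by (rule has_vector_derivative_at_within[OF has_vector_derivative_matrix_vector_mult[OF A1y Qy]])
          (use scS[of \<tau> x] that x in auto)
      show "(\<lambda>\<tau>. A1 (\<tau> * x) y *v Q (\<tau> * x) y) integrable_on cbox 0 1" if "y \<in> S" for y
        unfolding box_real using x that by (intro integrable_continuous_real continuous_intros cc scS) auto
      show "continuous_on (S \<times> cbox 0 1) (\<lambda>(y, \<tau>). A1 (\<tau> * x) y *v (A2 (\<tau> * x) y *v Q (\<tau> * x) y) + A1y (\<tau> * x) y *v Q (\<tau> * x) y)"
        unfolding split_beta using x by (intro continuous_intros cc scS) auto
    qed (use y in \<open>auto simp: S_def\<close>)
    then have L: "((\<lambda>y. ?I (\<lambda>\<tau>. A1 (\<tau> * x) y *v Q (\<tau> * x) y)) has_vector_derivative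
       ?I (\<lambda>\<tau>. A1 (\<tau> * x) y *v (A2 (\<tau> * x) y *v Q (\<tau> * x) y) + A1y (\<tau> * x) y *v Q (\<tau> * x) y)) (at y)"
      unfolding at_within_open[OF y oS] by simp
    \<comment> \<open>Flatness replaces A1 A2 + A1y by A2 A1 + A2x. Writing Q = R - W in the A2x
      term alone leaves the exact \<open>x\<close>-derivative of A2 R, since R has derivative A1 Q,
      and a remainder linear in W.\<close>
    have "A1 (\<tau> * x) y *v (A2 (\<tau> * x) y *v Q (\<tau> * x) y) + A1y (\<tau> * x) y *v Q (\<tau> * x) y =
       (A2 (\<tau> * x) y *v (A1 (\<tau> * x) y *v Q (\<tau> * x) y) + A2x (\<tau> * x) y *v R (\<tau> * x) y) - A2x (\<tau> * x) y *v W (\<tau> * x) y"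
      if "\<tau> \<in> {0..1}" for \<tau>
      using arg_cong[OF flat[OF scS[OF that x] y], of "\<lambda>M. M *v Q (\<tau> * x) y"]
      by (simp add: W_def matrix_vector_mult_add_rdistrib matrix_vector_mul_assoc matrix_vector_mult_diff_distrib algebra_simps)
    then have e1: "?I (\<lambda>\<tau>. A1 (\<tau> * x) y *v (A2 (\<tau> * x) y *v Q (\<tau> * x) y) + A1y (\<tau> * x) y *v Q (\<tau> * x) y)
      = ?I (\<lambda>\<tau>. (A2 (\<tau> * x) y *v (A1 (\<tau> * x) y *v Q (\<tau> * x) y) + A2x (\<tau> * x) y *v R (\<tau> * x) y) - A2x (\<tau> * x) y *v W (\<tau> * x) y)"
      by (rule Henstock_Kurzweil_Integration.integral_cong)
    also have "\<dots> = ?I (\<lambda>\<tau>. A2 (\<tau> * x) y *v (A1 (\<tau> * x) y *v Q (\<tau> * x) y) + A2x (\<tau> * x) y *v R (\<tau> * x) y)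
        - ?I (\<lambda>\<tau>. A2x (\<tau> * x) y *v W (\<tau> * x) y)"
      using x y by (intro integral_diff integrable_continuous_real continuous_intros cc scS) auto
    finally have e1: "?I (\<lambda>\<tau>. A1 (\<tau> * x) y *v (A2 (\<tau> * x) y *v Q (\<tau> * x) y) + A1y (\<tau> * x) y *v Q (\<tau> * x) y) = \<dots>" .
    have R0: "R 0 y = Q 0 y" by (simp add: R_def)
    have I: "((\<lambda>\<tau>. x *\<^sub>R (A2 (\<tau> * x) y *v (A1 (\<tau> * x) y *v Q (\<tau> * x) y) + A2x (\<tau> * x) y *v R (\<tau> * x) y)) has_integral
        A2 (1 * x) y *v R (1 * x) y - A2 (0 * x) y *v R (0 * x) y) {0..1}"
    proof (rule fundamental_theorem_of_calculus)
      fix \<tau> :: real assume \<tau>: "\<tau> \<in> {0..1}"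
      have 1: "((\<lambda>\<tau>. \<tau> * x) has_vector_derivative x) (at \<tau> within {0..1})"
        by (auto intro!: derivative_eq_intros)
      have 2: "((\<lambda>s. A2 s y *v R s y) has_vector_derivative A2 (\<tau> * x) y *v (A1 (\<tau> * x) y *v Q (\<tau> * x) y) + A2x (\<tau> * x) y *v R (\<tau> * x) y) (at (\<tau> * x) within ((\<lambda>\<tau>. \<tau> * x) ` {0..1}))"
        by (rule has_vector_derivative_at_within[OF has_vector_derivative_matrix_vector_mult[OF A2x Rx]]) (intro scS \<tau> x y)+
      show "((\<lambda>\<tau>. A2 (\<tau> * x) y *v R (\<tau> * x) y) has_vector_derivative x *\<^sub>R (A2 (\<tau> * x) y *v (A1 (\<tau> * x) y *v Q (\<tau> * x) y) + A2x (\<tau> * x) y *v R (\<tau> * x) y)) (at \<tau> within {0..1})"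
        using vector_diff_chain_within[OF 1 2] by (simp add: o_def)
    qed simp
    then have e2: "x *\<^sub>R ?I (\<lambda>\<tau>. A2 (\<tau> * x) y *v (A1 (\<tau> * x) y *v Q (\<tau> * x) y) + A2x (\<tau> * x) y *v R (\<tau> * x) y)
        = A2 x y *v R x y - A2 0 y *v Q 0 y"
      using integral_unique[OF I] R0 by simp
    have "((\<lambda>y. W x y) has_vector_derivative (A2 0 y *v Q 0 y + x *\<^sub>R
       ?I (\<lambda>\<tau>. A1 (\<tau> * x) y *v (A2 (\<tau> * x) y *v Q (\<tau> * x) y) + A1y (\<tau> * x) y *v Q (\<tau> * x) y)) - A2 x y *v Q x y) (at y)"
      unfolding W_def R_def
      by (intro has_vector_derivative_diff has_vector_derivative_add Qy zS x y
          bounded_linear.has_vector_derivative[OF bounded_linear_scaleR_right] L)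
    then show ?thesis
      unfolding e1 scaleR_diff_right e2
      by (simp add: W_def matrix_vector_mult_diff_distrib algebra_simps)
  qed
  have W: "W x y = 0" if "x \<in> S" "y \<in> S" for x y
  proof -
    \<comment> \<open>A compact square through the given point is needed so that the norm of
      \<open>W\<close> attains a maximum \<open>m\<close>, which is then shown to be at most a
      quarter of itself.\<close>
    define \<rho> where "\<rho> = max \<bar>x\<bar> \<bar>y\<bar>"
    have \<rho>: "0 \<le> \<rho>" "\<rho> < r" "\<bar>x\<bar> \<le> \<rho>" "\<bar>y\<bar> \<le> \<rho>" using that by (auto simp: \<rho>_def S_def)
    define C where "C = {-\<rho>..\<rho>}"
    have CS: "C \<subseteq> S" using \<rho> by (auto simp: C_def S_def)
    have "compact (C \<times> C)" "C \<times> C \<noteq> {}" using \<rho> by (auto simp: C_def compact_Times)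
    moreover have "continuous_on (C \<times> C) (\<lambda>z. norm (W (fst z) (snd z)))"
      using CS by (intro continuous_intros continuous_on_curried[OF cW]) auto
    ultimately obtain z where z: "z \<in> C \<times> C" "\<And>w. w \<in> C \<times> C \<Longrightarrow> norm (W (fst w) (snd w)) \<le> norm (W (fst z) (snd z))"
      using continuous_attains_sup[of "C \<times> C" "\<lambda>z. norm (W (fst z) (snd z))"] by blast
    obtain a b where ab: "z = (a, b)" by (cases z)
    define m where "m = norm (W a b)"
    have aC: "a \<in> C" "b \<in> C" using z ab by auto
    have Wm: "norm (W x y) \<le> m" if "x \<in> C" "y \<in> C" for x y using z(2)[of "(x, y)"] that ab by (simp add: m_def)
    have bd: "norm (A2 a y *v W a y - a *\<^sub>R integral {0..1} (\<lambda>\<tau>. A2x (\<tau> * a) y *v W (\<tau> * a) y)) \<le> 2 * M * m"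
      if y: "y \<in> C" for y
    proof -
      have scC: "\<tau> * a \<in> C" if "\<tau> \<in> {0..1}" for \<tau>
      proof -
        have "\<bar>\<tau> * a\<bar> \<le> 1 * \<bar>a\<bar>" unfolding abs_mult using that by (intro mult_right_mono) auto
        then show ?thesis using aC by (auto simp: C_def abs_le_iff)
      qed
      have "norm (A2 a y *v W a y) \<le> M * m"
        by (rule order_trans[OF bA2]) (use aC y CS Wm M in \<open>auto intro: mult_left_mono\<close>)
      moreover have "norm (integral {0..1} (\<lambda>\<tau>. A2x (\<tau> * a) y *v W (\<tau> * a) y)) \<le> M * m"
      proof (rule norm_integral_unit_le)
        show "continuous_on {0..1} (\<lambda>\<tau>. A2x (\<tau> * a) y *v W (\<tau> * a) y)"
          using scC CS y by (intro continuous_intros cc) auto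
        show "norm (A2x (\<tau> * a) y *v W (\<tau> * a) y) \<le> M * m" if "\<tau> \<in> {0..1}" for \<tau>
          by (rule order_trans[OF bA2x]) (use scC[OF that] y CS Wm M in \<open>auto intro: mult_left_mono\<close>)
      qed
      then have "\<bar>a\<bar> * norm (integral {0..1} (\<lambda>\<tau>. A2x (\<tau> * a) y *v W (\<tau> * a) y)) \<le> 1 * (M * m)"
        using aC \<rho> r by (intro mult_mono) (auto simp: C_def)
      ultimately show ?thesis
        by (intro order_trans[OF norm_triangle_ineq4]) simp
    qed
    \<comment> \<open>Of the constant \<open>2 * M\<close>, one half bounds the A2 term and the
      other the integral of A2x, because the modulus of \<open>a\<close> is at most 1. With
      \<open>r * M \<le> 1 / 8\<close> the total is at most \<open>m / 4\<close>.\<close>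
    have "norm (W a b - W a 0) \<le> 2 * M * m * norm (b - 0)"
    proof (rule differentiable_bound[where S = C and f' = "\<lambda>y t. t *\<^sub>R (A2 a y *v W a y - a *\<^sub>R integral {0..1} (\<lambda>\<tau>. A2x (\<tau> * a) y *v W (\<tau> * a) y))"])
      fix y assume y: "y \<in> C"
      show "((\<lambda>y. W a y) has_derivative (\<lambda>t. t *\<^sub>R (A2 a y *v W a y - a *\<^sub>R integral {0..1} (\<lambda>\<tau>. A2x (\<tau> * a) y *v W (\<tau> * a) y)))) (at y within C)"
        unfolding has_vector_derivative_def[symmetric]
        by (rule has_vector_derivative_at_within[OF Wy]) (use aC y CS in auto)
      show "onorm (\<lambda>t. t *\<^sub>R (A2 a y *v W a y - a *\<^sub>R integral {0..1} (\<lambda>\<tau>. A2x (\<tau> * a) y *v W (\<tau> * a) y))) \<le> 2 * M * m"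
        using bd[OF y] by (intro onorm_bound) (auto simp: m_def M mult.commute intro!: mult_left_mono)
    qed (use aC \<rho> in \<open>auto simp: C_def\<close>)
    also have "\<dots> \<le> 2 * M * m * r"
      using aC \<rho> M by (intro mult_left_mono) (auto simp: C_def m_def)
    also have "\<dots> = 2 * (r * M) * m" by simp
    also have "\<dots> \<le> 2 * (1 / 8) * m"
      using r by (intro mult_right_mono mult_left_mono) (auto simp: m_def)
    finally have "m \<le> 1 / 4 * m" using W0[of a] aC CS by (auto simp: m_def)
    then have "m \<le> 0" by simp
    moreover have "norm (W x y) \<le> m" using \<rho> by (intro Wm) (auto simp: C_def)
    ultimately have "norm (W x y) \<le> 0" by linarith
    then show ?thesis by simp
  qed
  show ?thesis
    by (rule has_vector_derivative_transform_within_open[OF Rx[OF xy], where S = S])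
      (use xy W in \<open>auto simp: W_def S_def\<close>)
qed

text \<open>A linear Frobenius theorem: solve along the first axis, then along every vertical line
  with \<open>x\<close> as parameter; flatness propagates the first equation off the axis. The
  square on which this works depends on the coefficients only, so one \<open>r\<close> serves all
  initial values.\<close>

theorem flat_system_solution:
  fixes A1 A2 :: "real \<Rightarrow> real \<Rightarrow> real^'n^'n"
  assumes D: "open D" "(0, 0) \<in> D"
    and cA1: "continuous_on D (\<lambda>(x, y). A1 x y)" and cA2: "continuous_on D (\<lambda>(x, y). A2 x y)"
    and cA1y: "continuous_on D (\<lambda>(x, y). A1y x y)" and cA2x: "continuous_on D (\<lambda>(x, y). A2x x y)"
    and A1y: "\<And>x y. (x, y) \<in> D \<Longrightarrow> (A1 x has_vector_derivative A1y x y) (at y)"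
    and A2x: "\<And>x y. (x, y) \<in> D \<Longrightarrow> ((\<lambda>x. A2 x y) has_vector_derivative A2x x y) (at x)"
    and flat: "\<And>x y. (x, y) \<in> D \<Longrightarrow> A1y x y + A1 x y ** A2 x y = A2x x y + A2 x y ** A1 x y"
  obtains r where "r > 0" "{-r<..<r} \<times> {-r<..<r} \<subseteq> D"
    "\<And>y0. \<exists>Q. Q (0, 0) = y0 \<and> (\<forall>x y. \<bar>x\<bar> < r \<longrightarrow> \<bar>y\<bar> < r \<longrightarrow>
       (Q has_derivative (\<lambda>h. fst h *\<^sub>R (A1 x y *v Q (x, y)) + snd h *\<^sub>R (A2 x y *v Q (x, y)))) (at (x, y)))"
proof -
  obtain B1 B2 where "open B1" "open B2" "(0, 0) \<in> B1 \<times> B2" "B1 \<times> B2 \<subseteq> D"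
    using open_prod_elim[OF D] by metis
  then obtain s1 s2 :: real where "s1 > 0" "s2 > 0" "cball 0 s1 \<subseteq> B1" "cball 0 s2 \<subseteq> B2"
    using open_contains_cball by (metis mem_Sigma_iff)
  define s where "s = min s1 s2"
  define C where "C = {-s..s}"
  have s: "s > 0" using \<open>s1 > 0\<close> \<open>s2 > 0\<close> by (simp add: s_def)
  have "C \<subseteq> cball 0 s1" "C \<subseteq> cball 0 s2" by (auto simp: C_def s_def)
  then have CD: "C \<times> C \<subseteq> D"
    using \<open>B1 \<times> B2 \<subseteq> D\<close> \<open>cball 0 s1 \<subseteq> B1\<close> \<open>cball 0 s2 \<subseteq> B2\<close> by blast
  have "compact (C \<times> C)" by (simp add: C_def compact_Times)
  have bounded: "\<exists>b. \<forall>x\<in>C. \<forall>y\<in>C. norm (F x y) \<le> b" if "continuous_on D (\<lambda>(x, y). F x y)" for F :: "real \<Rightarrow> real \<Rightarrow> real^'n^'n"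
  proof -
    have "bounded ((\<lambda>(x, y). F x y) ` (C \<times> C))"
      by (intro compact_imp_bounded compact_continuous_image continuous_on_subset[OF that CD] \<open>compact (C \<times> C)\<close>)
    then show ?thesis by (auto simp: bounded_iff)
  qed
  obtain b1 where b1: "\<And>x y. x \<in> C \<Longrightarrow> y \<in> C \<Longrightarrow> norm (A1 x y) \<le> b1" using bounded[OF cA1] by blast
  obtain b2 where b2: "\<And>x y. x \<in> C \<Longrightarrow> y \<in> C \<Longrightarrow> norm (A2 x y) \<le> b2" using bounded[OF cA2] by blast
  obtain b3 where b3: "\<And>x y. x \<in> C \<Longrightarrow> y \<in> C \<Longrightarrow> norm (A2x x y) \<le> b3" using bounded[OF cA2x] by blast
  obtain k where k: "0 \<le> k" "\<And>(A::real^'n^'n) v. norm (A *v v) \<le> norm A * norm v * k"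
    using bounded_bilinear.nonneg_bounded[OF bounded_bilinear_matrix_vector_mult] by metis
  define M where "M = max 0 (max b1 (max b2 b3)) * k"
  have M: "0 \<le> M" using k by (simp add: M_def)
  have mv: "norm (A *v v) \<le> M * norm v" if "norm A \<le> max b1 (max b2 b3)" for A :: "real^'n^'n" and v
  proof -
    have "norm A * norm v * k \<le> max 0 (max b1 (max b2 b3)) * norm v * k"
      using that k by (intro mult_right_mono) auto
    then show ?thesis using k(2)[of A v] by (simp add: M_def mult_ac)
  qed
  have bA1: "norm (A1 x y *v v) \<le> M * norm v" if "x \<in> C" "y \<in> C" for x y v
    using b1[OF that] by (intro mv) simp
  have bA2: "norm (A2 x y *v v) \<le> M * norm v" if "x \<in> C" "y \<in> C" for x y v
    using b2[OF that] by (intro mv) simp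
  have bA2x: "norm (A2x x y *v v) \<le> M * norm v" if "x \<in> C" "y \<in> C" for x y v
    using b3[OF that] by (intro mv) simp
  \<comment> \<open>The bounds 1 and 1/8 are the smallness conditions of
    \<open>flat_system_propagation\<close>; \<open>M + 1\<close> keeps the denominator
    positive.\<close>
  define r where "r = min s (min 1 (1 / (8 * (M + 1))))"
  have r: "0 < r" using s M by (simp add: r_def)
  have "r \<le> 1" "r \<le> s" unfolding r_def by linarith+
  note r = r this
  have "r * M \<le> 1 / (8 * (M + 1)) * (M + 1)" using M r by (intro mult_mono) (auto simp: r_def)
  also have "\<dots> = 1 / 8" using M by (simp add: divide_simps)
  finally have rM: "r * M \<le> 1 / 8" .
  then have rM': "r * M \<le> 1 / 2" by linarith
  define S where "S = {-r<..<r}"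
  have SC: "S \<subseteq> C" using r by (auto simp: S_def C_def)
  have SD: "S \<times> S \<subseteq> D" using SC CD by blast
  define c where "c = clamp_to r"
  have cC: "c t \<in> C" for t using clamp_to(1)[of r t] r by (auto simp: c_def C_def)
  have c_id: "c t = t" if "t \<in> S" for t using that clamp_to(2)[of t r] by (auto simp: c_def S_def)
  have c_cont: "continuous_on T (\<lambda>z. c (f z))" if "continuous_on T f" for T :: "'z::topological_space set" and f
    unfolding c_def by (intro continuous_intros that)
  have c0: "c 0 = 0" using r by (simp add: c_id S_def)
  note CC = continuous_on_curried[OF continuous_on_subset[OF cA1 CD]] continuous_on_curried[OF continuous_on_subset[OF cA2 CD]]
  have ex: "\<exists>Q. Q (0, 0) = y0 \<and> (\<forall>x y. \<bar>x\<bar> < r \<longrightarrow> \<bar>y\<bar> < r \<longrightarrow>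
       (Q has_derivative (\<lambda>h. fst h *\<^sub>R (A1 x y *v Q (x, y)) + snd h *\<^sub>R (A2 x y *v Q (x, y)))) (at (x, y)))" for y0
  proof -
    \<comment> \<open>\<open>parametric_linear_ode\<close> integrates in the second variable, so the
      equation along the axis is presented with that variable in the role of \<open>x\<close> and a
      dummy parameter. Clamping extends the coefficient continuously to the whole plane.\<close>
    have 1: "continuous_on UNIV (\<lambda>(x :: real, y). A1 (c y) 0)"
      unfolding split_beta using cC cC[of 0] c0 by (intro CC c_cont continuous_intros) auto
    have 2: "norm ((\<lambda>(x, y). A1 (c y) 0) z *v v) \<le> M * norm v" for z :: "real \<times> real" and v
      using bA1 cC cC[of 0] c0 by (auto simp: split_beta)
    obtain P :: "real \<times> real \<Rightarrow> real^'n" where P: "continuous_on UNIV P" "bounded (range P)" "\<And>x. P (x, 0) = y0"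
      "\<And>x y. \<bar>y\<bar> < r \<Longrightarrow> ((\<lambda>y. P (x, y)) has_vector_derivative (\<lambda>(x :: real, y). A1 (c y) 0) (x, y) *v P (x, y)) (at y)"
      by (rule parametric_linear_ode[OF 1 2 M r(1) rM', of "\<lambda>_. y0"]) (simp_all add: that)
    have 1: "continuous_on UNIV (\<lambda>(x, y). A2 (c x) (c y))"
      unfolding split_beta using cC by (intro CC c_cont continuous_intros) auto
    have 2: "norm ((\<lambda>(x, y). A2 (c x) (c y)) z *v v) \<le> M * norm v" for z v
      using bA2 cC by (auto simp: split_beta)
    have 3: "continuous_on UNIV (\<lambda>x. P (0, x))"
      by (intro continuous_on_compose2[OF P(1)] continuous_intros) auto
    have 4: "bounded (range (\<lambda>x. P (0, x)))"
      by (rule bounded_subset[OF P(2)]) auto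
    obtain Q where Q: "continuous_on UNIV Q" "\<And>x. Q (x, 0) = P (0, x)"
      "\<And>x y. \<bar>y\<bar> < r \<Longrightarrow> ((\<lambda>y. Q (x, y)) has_vector_derivative (\<lambda>(x, y). A2 (c x) (c y)) (x, y) *v Q (x, y)) (at y)"
      by (rule parametric_linear_ode[OF 1 2 M r(1) rM' 3 4]) (simp_all add: that)
    have Qy: "((\<lambda>y. Q (x, y)) has_vector_derivative A2 x y *v Q (x, y)) (at y)" if "x \<in> S" "y \<in> S" for x y
      using Q(3)[of y x] c_id that by (auto simp: S_def abs_less_iff)
    have Qx: "((\<lambda>x. Q (x, y)) has_vector_derivative A1 x y *v Q (x, y)) (at x)" if xy: "x \<in> S" "y \<in> S" for x y
    proof (rule flat_system_propagation[OF r(1,2) rM M, folded S_def, of A1 A2 A1y A2x "\<lambda>x y. Q (x, y)"])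
      show "continuous_on (S \<times> S) (\<lambda>(x, y). Q (x, y))"
        by (rule continuous_on_subset[of UNIV]) (simp_all add: Q)
      show "((\<lambda>x. Q (x, 0)) has_vector_derivative A1 x 0 *v Q (x, 0)) (at x)" if "x \<in> S" for x
        using P(4)[of x 0] that c_id unfolding Q(2) by (auto simp: S_def abs_less_iff)
    qed (use xy SD SC A1y A2x flat bA2[OF subsetD[OF SC] subsetD[OF SC]] bA2x[OF subsetD[OF SC] subsetD[OF SC]] Qy in \<open>auto intro: continuous_on_subset[OF cA1] continuous_on_subset[OF cA2]
        continuous_on_subset[OF cA1y] continuous_on_subset[OF cA2x]\<close>)
    have "(Q has_derivative (\<lambda>h. fst h *\<^sub>R (A1 x y *v Q (x, y)) + snd h *\<^sub>R (A2 x y *v Q (x, y)))) (at (x, y))"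
      if xy: "x \<in> S" "y \<in> S" for x y
    proof -
      \<comment> \<open>The two partial derivatives combine to a total derivative because the one in
        \<open>y\<close> is continuous.\<close>
      have "((\<lambda>(x, y). Q (x, y)) has_derivative (\<lambda>(tx, ty). tx *\<^sub>R (A1 x y *v Q (x, y)) + blinfun_apply (blinfun_scaleR_left (A2 x y *v Q (x, y))) ty)) (at (x, y) within S \<times> S)"
      proof (rule has_derivative_partialsI)
        show "((\<lambda>x. Q (x, y)) has_derivative (\<lambda>tx. tx *\<^sub>R (A1 x y *v Q (x, y)))) (at x within S)"
          using has_vector_derivative_at_within[OF Qx[OF xy]] by (simp add: has_vector_derivative_def)
        show "((\<lambda>y. Q (x, y)) has_derivative blinfun_apply (blinfun_scaleR_left (A2 x y *v Q (x, y)))) (at y within S)"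
          if "x \<in> S" "y \<in> S" for x y
          using has_vector_derivative_at_within[OF Qy[OF that]] by (simp add: has_vector_derivative_def)
        have "continuous_on (S \<times> S) (\<lambda>(x, y). blinfun_scaleR_left (A2 x y *v Q (x, y)))"
          unfolding split_beta
          by (intro continuous_intros continuous_on_curried[OF continuous_on_subset[OF cA2 SD]] continuous_on_compose2[OF Q(1)]) auto
        then show "continuous (at (x, y) within S \<times> S) (\<lambda>(x, y). blinfun_scaleR_left (A2 x y *v Q (x, y)))"
          using xy by (simp add: continuous_on_eq_continuous_within)
      qed (use xy in \<open>auto simp: S_def\<close>)
      moreover have "open (S \<times> S)" "(x, y) \<in> S \<times> S" using xy by (auto simp: S_def open_Times)
      ultimately show ?thesis
        by (simp add: at_within_open[of "(x, y)" "S \<times> S"] case_prod_beta')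
    qed
    moreover have "Q (0, 0) = y0" by (simp add: Q P)
    ultimately show ?thesis by (intro exI[of _ Q]) (auto simp: S_def abs_less_iff)
  qed
  show thesis
    by (rule that[OF r(1) _ ex]) (use SD in \<open>simp add: S_def\<close>)
qed

section \<open>Local geometry of surfaces of constant curvature\<close>

lemma partial_deriv_cong:
  assumes "open S" "x \<in> S" "\<And>y. y \<in> S \<Longrightarrow> f y = h y"
  shows "partial_deriv i f x = partial_deriv i h x"
proof -
  have "(f has_derivative f') (at x) \<longleftrightarrow> (h has_derivative f') (at x)" for f'
    using has_derivative_transform_within_open[OF _ assms(1,2)] assms(3) by metis
  then show ?thesis by (simp add: partial_deriv_def frechet_derivative_def)
qed

lemma partial_deriv_eqI: "(f has_derivative D) (at x) \<Longrightarrow> partial_deriv i f x = D (axis i 1)"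
  by (simp add: partial_deriv_def frechet_derivative_at[symmetric])

lemma jacobian_at_component:
  fixes f :: "real^'n \<Rightarrow> real^'m"
  assumes "smooth_on S f" "x \<in> S"
  shows "jacobian_at f x $ a $ i = partial_deriv i (\<lambda>x. f x $ a) x"
  unfolding jacobian_at_nth[OF assms]
  using partial_deriv_eqI[OF bounded_linear.has_derivative[OF bounded_linear_vec_nth smooth_onD(1)[OF assms]], of i a]
  by (simp add: partial_deriv_def)

lemma smooth_on_vector_2:
  fixes f h :: "'a::real_normed_vector \<Rightarrow> real"
  assumes "open S" "smooth_on S f" "smooth_on S h"
  shows "smooth_on S (\<lambda>x. vector [f x, h x] :: real^2)"
proof (rule smooth_on_vec[OF assms(1)])
  show "smooth_on S (\<lambda>x. (vector [f x, h x] :: real^2) $ i)" for i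
    using exhaust_2[of i] assms by auto
qed

lemma jacobian_at_vector_2:
  fixes f h :: "real^'n \<Rightarrow> real"
  assumes "open S" "smooth_on S f" "smooth_on S h" "x \<in> S"
  shows "jacobian_at (\<lambda>x. vector [f x, h x] :: real^2) x $ 1 $ i = partial_deriv i f x"
    "jacobian_at (\<lambda>x. vector [f x, h x] :: real^2) x $ 2 $ i = partial_deriv i h x"
  by (simp_all add: jacobian_at_component[OF smooth_on_vector_2[OF assms(1-3)] assms(4)])

lemma vector_2_axis: "(vector [y, z] :: real^2) = y *\<^sub>R axis 1 1 + z *\<^sub>R axis 2 1"
  by (simp add: vec_eq_iff forall_2 axis_def)

lemma partial_deriv_const: "partial_deriv i (\<lambda>y. c) x = 0"
  by (rule partial_deriv_eqI[OF has_derivative_const])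

lemma partial_deriv_add:
  assumes "smooth_on S f" "smooth_on S h" "x \<in> S"
  shows "partial_deriv i (\<lambda>y. f y + h y) x = partial_deriv i f x + partial_deriv i h x"
  using partial_deriv_eqI[OF has_derivative_add[OF smooth_onD(1)[OF assms(1,3)] smooth_onD(1)[OF assms(2,3)]]]
  by (simp add: partial_deriv_def)

lemma partial_deriv_diff:
  assumes "smooth_on S f" "smooth_on S h" "x \<in> S"
  shows "partial_deriv i (\<lambda>y. f y - h y) x = partial_deriv i f x - partial_deriv i h x"
  using partial_deriv_eqI[OF has_derivative_diff[OF smooth_onD(1)[OF assms(1,3)] smooth_onD(1)[OF assms(2,3)]]]
  by (simp add: partial_deriv_def)

lemma partial_deriv_mult:
  fixes f h :: "real^'n \<Rightarrow> real"
  assumes "smooth_on S f" "smooth_on S h" "x \<in> S"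
  shows "partial_deriv i (\<lambda>y. f y * h y) x = partial_deriv i f x * h x + f x * partial_deriv i h x"
  using partial_deriv_eqI[OF has_derivative_mult[OF smooth_onD(1)[OF assms(1,3)] smooth_onD(1)[OF assms(2,3)]]]
  by (simp add: partial_deriv_def)

lemma partial_deriv_divide:
  fixes f h :: "real^'n \<Rightarrow> real"
  assumes "smooth_on S f" "smooth_on S h" "x \<in> S" "h x \<noteq> 0"
  shows "partial_deriv i (\<lambda>y. f y / h y) x = (partial_deriv i f x * h x - f x * partial_deriv i h x) / (h x)\<^sup>2"
  using partial_deriv_eqI[OF has_derivative_divide'[OF smooth_onD(1)[OF assms(1,3)] smooth_onD(1)[OF assms(2,3)] assms(4)]]
  by (simp add: partial_deriv_def power2_eq_square)

section \<open>Christoffel symbols and curvature of a metric in coordinates\<close>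

lemma matrix_inv_eqI:
  fixes A B :: "real^'n^'n"
  assumes "A ** B = mat 1"
  shows "matrix_inv A = B"
proof -
  have "B ** A = mat 1" using assms matrix_left_right_inverse by blast
  then have "invertible A" using assms by (auto simp: invertible_def)
  then have "matrix_inv A ** A = mat 1"
    using someI_ex[of "\<lambda>A'. A ** A' = mat 1 \<and> A' ** A = mat 1"] by (auto simp: matrix_inv_def invertible_def)
  then have "matrix_inv A ** A ** B = B" by simp
  then show ?thesis using assms by (simp flip: matrix_mul_assoc)
qed

lemma matrix_inv_2:
  fixes A :: "real^2^2"
  assumes "det A \<noteq> 0"
  shows "matrix_inv A = (\<chi> i j. (if i = j then A $ (if i = 1 then 2 else 1) $ (if i = 1 then 2 else 1) else - A $ i $ j) / det A)"
  by (rule matrix_inv_eqI)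
    (use assms in \<open>simp add: vec_eq_iff forall_2 matrix_matrix_mult_def sum_2 mat_def divide_simps\<close>;
      simp add: det_2 algebra_simps)

text \<open>A metric in one coordinate domain. Only nondegeneracy is required; the Lorentz signature
  enters later as negativity of the determinant.\<close>

locale metric2 =
  fixes g :: "real^2 \<Rightarrow> real^2^2" and D :: "(real^2) set"
  assumes open_D: "open D" and smooth_g: "smooth_on D g"
    and sym_g: "x \<in> D \<Longrightarrow> transpose (g x) = g x" and det_g: "x \<in> D \<Longrightarrow> det (g x) \<noteq> 0"
begin

abbreviation \<Gamma> :: "2 \<Rightarrow> 2 \<Rightarrow> 2 \<Rightarrow> real^2 \<Rightarrow> real" where
  "\<Gamma> k i j x \<equiv> christoffel g x k i j"

abbreviation dg :: "2 \<Rightarrow> 2 \<Rightarrow> 2 \<Rightarrow> real^2 \<Rightarrow> real" where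
  "dg k i j \<equiv> partial_deriv k (\<lambda>y. g y $ i $ j)"

abbreviation d\<Gamma> :: "2 \<Rightarrow> 2 \<Rightarrow> 2 \<Rightarrow> 2 \<Rightarrow> real^2 \<Rightarrow> real" where
  "d\<Gamma> l k i j \<equiv> partial_deriv l (\<Gamma> k i j)"

lemma g_sym: "x \<in> D \<Longrightarrow> g x $ i $ j = g x $ j $ i"
  using arg_cong[OF sym_g, of x "\<lambda>A. A $ j $ i"] by (simp add: transpose_def)

lemma smooth_g_nth: "smooth_on D (\<lambda>x. g x $ i $ j)"
  by (intro smooth_on_vec_nth open_D smooth_g)

lemma dg_sym: "x \<in> D \<Longrightarrow> dg k i j x = dg k j i x"
  by (rule partial_deriv_cong[OF open_D]) (auto simp: g_sym)

lemma det_g_eq: "x \<in> D \<Longrightarrow> det (g x) = g x $ 1 $ 1 * g x $ 2 $ 2 - g x $ 1 $ 2 * g x $ 1 $ 2"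
  by (simp add: det_2 g_sym[of x 2 1])

lemma smooth_det: "smooth_on D (\<lambda>x. det (g x))"
  unfolding det_2 by (intro smooth_on_diff smooth_on_mult smooth_g_nth open_D)

lemma smooth_dg: "smooth_on D (dg k i j)"
  by (intro smooth_on_partial_deriv smooth_g_nth)

lemma smooth_christoffel: "smooth_on D (\<Gamma> k i j)"
proof -
  have inv: "smooth_on D (\<lambda>x. matrix_inv (g x) $ k $ l)" for k l
  proof (rule smooth_on_cong[OF open_D])
    show "smooth_on D (\<lambda>x. (if k = l then g x $ (if k = 1 then 2 else 1) $ (if k = 1 then 2 else 1) else - g x $ k $ l) / det (g x))"
      by (cases "k = l") (auto intro!: smooth_on_divide smooth_on_minus smooth_g_nth smooth_det open_D simp: det_g)
  qed (simp add: matrix_inv_2 det_g)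
  show ?thesis
    unfolding christoffel_def
    by (intro smooth_on_mult smooth_on_const smooth_on_sum smooth_on_add smooth_on_diff smooth_dg inv open_D)
qed

lemma christoffel_sym: "x \<in> D \<Longrightarrow> \<Gamma> k i j x = \<Gamma> k j i x"
  unfolding christoffel_def by (simp add: dg_sym[of x _ i j] add.commute)

text \<open>Lowering the index removes the inverse matrix, so that the identities to come are
  polynomial in the metric and its derivatives.\<close>

lemma christoffel_lower:
  assumes "x \<in> D"
  shows "(\<Sum>m\<in>UNIV. g x $ l $ m * \<Gamma> m i j x) = (dg i j l x + dg j i l x - dg l i j x) / 2"
proof -
  have "g x ** matrix_inv (g x) = mat 1"
    using det_g[OF assms] by (metis invertible_det_nz invertible_def matrix_inv_eqI)
  then have "(\<Sum>m\<in>UNIV. g x $ l $ m * matrix_inv (g x) $ m $ n) = (if l = n then 1 else 0)" for n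
    by (simp add: vec_eq_iff matrix_matrix_mult_def mat_def)
  note inv = this[of 1] this[of 2]
  have "(\<Sum>m\<in>UNIV. g x $ l $ m * \<Gamma> m i j x)
    = ((\<Sum>m\<in>UNIV. g x $ l $ m * matrix_inv (g x) $ m $ 1) * (dg i j 1 x + dg j i 1 x - dg 1 i j x)
      + (\<Sum>m\<in>UNIV. g x $ l $ m * matrix_inv (g x) $ m $ 2) * (dg i j 2 x + dg j i 2 x - dg 2 i j x)) / 2"
    unfolding christoffel_def sum_2 by (simp add: field_simps)
  also have "\<dots> = ((if l = 1 then 1 else 0) * (dg i j 1 x + dg j i 1 x - dg 1 i j x)
      + (if l = 2 then 1 else 0) * (dg i j 2 x + dg j i 2 x - dg 2 i j x)) / 2"
    unfolding inv ..
  finally show ?thesis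
    using exhaust_2[of l] by auto
qed

text \<open>The right-hand side adds two lowered Christoffel symbols, in which the derivatives in
  the other directions cancel in pairs. This is the vanishing of the covariant derivative of the
  metric.\<close>

lemma metric_compat:
  assumes "x \<in> D"
  shows "dg k i j x = (\<Sum>m\<in>UNIV. \<Gamma> m k i x * g x $ m $ j + \<Gamma> m k j x * g x $ m $ i)"
  using christoffel_lower[OF assms, of j k i] christoffel_lower[OF assms, of i k j]
    dg_sym[OF assms, of k i j] dg_sym[OF assms, of i j k] dg_sym[OF assms, of j i k]
    g_sym[OF assms, of 2 1] exhaust_2[of i] exhaust_2[of j]
  by (auto simp: sum_2 algebra_simps)

text \<open>The two mixed second derivatives of $g_{lj}$ agree, which is the skew symmetry of the curvature in
  its last two indices.\<close>

lemma riemann_skew: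
  assumes x: "x \<in> D"
  shows "(\<Sum>m\<in>UNIV. g x $ l $ m * riemann_comp g x m 1 2 j + g x $ j $ m * riemann_comp g x m 1 2 l) = 0"
proof -
  have compat2: "partial_deriv a (dg k i j) x = (\<Sum>m\<in>UNIV. d\<Gamma> a m k i x * g x $ m $ j + \<Gamma> m k i x * dg a m j x
      + (d\<Gamma> a m k j x * g x $ m $ i + \<Gamma> m k j x * dg a m i x))" for a k i j
  proof -
    have "partial_deriv a (dg k i j) x = partial_deriv a (\<lambda>y. (\<Sum>m\<in>UNIV. \<Gamma> m k i y * g y $ m $ j + \<Gamma> m k j y * g y $ m $ i)) x"
      by (rule partial_deriv_cong[OF open_D x]) (rule metric_compat)
    then show ?thesis
      unfolding sum_2
      by (simp add: partial_deriv_add[OF _ _ x] partial_deriv_mult[OF _ _ x] smooth_on_add smooth_on_mult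
          smooth_christoffel smooth_g_nth open_D)
  qed
  have "partial_deriv 1 (dg 2 l j) x = partial_deriv 2 (dg 1 l j) x"
    by (rule partial_deriv_commute[OF open_D smooth_g_nth x])
  then show ?thesis
    unfolding compat2 riemann_comp_def metric_compat[OF x] sum_2
    by (simp add: g_sym[OF x, of l] g_sym[OF x, of j] g_sym[OF x, of 2 1] algebra_simps)
qed

definition has_curvature :: "real \<Rightarrow> bool" where
  "has_curvature K \<longleftrightarrow> (\<forall>x\<in>D. sectional_curvature g x (axis 1 1) (axis 2 1) = K)"

text \<open>After lowering the first index, skew symmetry in the last pair leaves one component, and
  the sectional curvature is that component divided by the determinant. Raising the index again
  gives R(e1, e2) ej = K (g2j e1 - g1j e2).\<close>

lemma riemann_constant_curvature:
  assumes K: "has_curvature K" and x: "x \<in> D"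
  shows "riemann_comp g x m 1 2 j = K * ((if m = 1 then g x $ 2 $ j else 0) - (if m = 2 then g x $ 1 $ j else 0))"
proof -
  have s: "g x $ 2 $ 1 = g x $ 1 $ 2" by (rule g_sym[OF x])
  have d: "g x $ 1 $ 1 * g x $ 2 $ 2 - g x $ 1 $ 2 * g x $ 1 $ 2 \<noteq> 0"
    using det_g[OF x] det_g_eq[OF x] by simp
  have "sectional_curvature g x (axis 1 1) (axis 2 1) = K"
    using K x by (simp add: has_curvature_def)
  then have "g x $ 1 $ 1 * riemann_comp g x 1 1 2 2 + g x $ 1 $ 2 * riemann_comp g x 2 1 2 2
      = K * (g x $ 1 $ 1 * g x $ 2 $ 2 - g x $ 1 $ 2 * g x $ 1 $ 2)"
    using d unfolding sectional_curvature_def form_def riemann_def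
    by (simp add: inner_vec_def sum_2 matrix_vector_mult_def axis_def s power2_eq_square divide_eq_eq algebra_simps)
  note R = this riemann_skew[OF x, of 1 1, unfolded sum_2 s] riemann_skew[OF x, of 1 2, unfolded sum_2 s]
    riemann_skew[OF x, of 2 2, unfolded sum_2 s]
  \<comment> \<open>A vector is determined by its lowered components; this is Cramer's rule for the
    metric matrix.\<close>
  have unique: "y = y' \<and> z = z'" if "g x $ 1 $ 1 * y + g x $ 1 $ 2 * z = g x $ 1 $ 1 * y' + g x $ 1 $ 2 * z'"
    "g x $ 1 $ 2 * y + g x $ 2 $ 2 * z = g x $ 1 $ 2 * y' + g x $ 2 $ 2 * z'" for y z y' z' :: real
  proof -
    have "(g x $ 1 $ 1 * g x $ 2 $ 2 - g x $ 1 $ 2 * g x $ 1 $ 2) * (y - y') = 0"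
      "(g x $ 1 $ 1 * g x $ 2 $ 2 - g x $ 1 $ 2 * g x $ 1 $ 2) * (z - z') = 0"
      using that by algebra+
    then show ?thesis using d by simp
  qed
  have "riemann_comp g x 1 1 2 2 = K * g x $ 2 $ 2 \<and> riemann_comp g x 2 1 2 2 = - K * g x $ 1 $ 2"
    by (rule unique) (use R in algebra)+
  moreover have "riemann_comp g x 1 1 2 1 = K * g x $ 1 $ 2 \<and> riemann_comp g x 2 1 2 1 = - K * g x $ 1 $ 1"
    by (rule unique) (use R in algebra)+
  ultimately show ?thesis
    using exhaust_2[of m] exhaust_2[of j] s by auto
qed

text \<open>The functions with $\operatorname{Hess} h = - K h g$. On the model surfaces these are the
  restrictions of the affine (\<open>K = 0\<close>) or linear (\<open>K = \<plusminus>1\<close>) functions of the ambient space, so that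
  three independent solutions provide an isometric immersion.\<close>

definition obata :: "real \<Rightarrow> (real^2) set \<Rightarrow> (real^2 \<Rightarrow> real) \<Rightarrow> bool" where
  "obata K U h \<longleftrightarrow> open U \<and> U \<subseteq> D \<and> smooth_on U h \<and> (\<forall>x\<in>U. \<forall>i j.
     partial_deriv i (partial_deriv j h) x =
       (\<Sum>k\<in>UNIV. \<Gamma> k i j x * partial_deriv k h x) - K * g x $ i $ j * h x)"

section \<open>The prolonged linear system and its integrability\<close>

text \<open>Prolongation to first order: for the column q = (h, d1 h, d2 h) the second order
  equation becomes di q = \<open>obata_matrix K i\<close> q.\<close>

definition obata_matrix :: "real \<Rightarrow> 2 \<Rightarrow> real^2 \<Rightarrow> real^3^3" where
  "obata_matrix K i x = vector [vector [0, if i = 1 then 1 else 0, if i = 2 then 1 else 0],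
     vector [- K * g x $ i $ 1, \<Gamma> 1 i 1 x, \<Gamma> 2 i 1 x], vector [- K * g x $ i $ 2, \<Gamma> 1 i 2 x, \<Gamma> 2 i 2 x]]"

lemma smooth_obata_matrix: "smooth_on D (obata_matrix K i)"
proof -
  have "smooth_on D (\<lambda>x. obata_matrix K i x $ a $ b)" for a b
    using exhaust_3[of a] exhaust_3[of b]
    by (auto simp: obata_matrix_def
        intro!: smooth_on_const smooth_on_minus smooth_on_mult smooth_g_nth smooth_christoffel open_D)
  then show ?thesis by (intro smooth_on_vec open_D)
qed

lemma partial_deriv_obata_matrix:
  assumes "x \<in> D"
  shows "partial_deriv k (obata_matrix K i) x = vector [vector [0, 0, 0],
     vector [- K * dg k i 1 x, d\<Gamma> k 1 i 1 x, d\<Gamma> k 2 i 1 x], vector [- K * dg k i 2 x, d\<Gamma> k 1 i 2 x, d\<Gamma> k 2 i 2 x]]"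
proof -
  have m: "partial_deriv k (\<lambda>x. - (K * g x $ i $ j)) x = - K * dg k i j x" for j
    using partial_deriv_mult[OF smooth_on_const[of D "- K"] smooth_g_nth assms, of k i j]
    by (simp add: partial_deriv_const)
  have "partial_deriv k (obata_matrix K i) x $ a $ b = partial_deriv k (\<lambda>x. obata_matrix K i x $ a $ b) x" for a b
    using partial_deriv_eqI[OF bounded_linear.has_derivative[OF bounded_linear_compose[OF bounded_linear_vec_nth[of b] bounded_linear_vec_nth[of a]]
      smooth_onD(1)[OF smooth_obata_matrix[of K i] assms]], of k]
    by (simp add: partial_deriv_def)
  then show ?thesis
    by (simp add: vec_eq_iff forall_3) (simp add: obata_matrix_def partial_deriv_const m)
qed

text \<open>The first row holds because the metric and the Christoffel symbols are symmetric in
  their lower indices. In the first column the factor K is common and metric compatibility suffices.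
  The remaining block is the curvature of the connection, which cancels against the terms with K
  exactly by \<open>riemann_constant_curvature\<close>.\<close>

lemma obata_matrix_flat:
  assumes K: "has_curvature K" and x: "x \<in> D"
  shows "partial_deriv 2 (obata_matrix K 1) x + obata_matrix K 1 x ** obata_matrix K 2 x
    = partial_deriv 1 (obata_matrix K 2) x + obata_matrix K 2 x ** obata_matrix K 1 x"
proof -
  have s: "g x $ 2 $ 1 = g x $ 1 $ 2" by (rule g_sym[OF x])
  have sg: "\<Gamma> k 2 1 x = \<Gamma> k 1 2 x" for k by (rule christoffel_sym[OF x])
  have R: "d\<Gamma> 1 m 2 j x - d\<Gamma> 2 m 1 j x + (\<Sum>n\<in>UNIV. \<Gamma> m 1 n x * \<Gamma> n 2 j x - \<Gamma> m 2 n x * \<Gamma> n 1 j x)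
     = K * ((if m = 1 then g x $ 2 $ j else 0) - (if m = 2 then g x $ 1 $ j else 0))" for m j
    using riemann_constant_curvature[OF K x, of m j] by (simp add: riemann_comp_def)
  show ?thesis
    unfolding partial_deriv_obata_matrix[OF x] metric_compat[OF x]
    using R[of 1 1] R[of 1 2] R[of 2 1] R[of 2 2]
    by (simp add: vec_eq_iff forall_3 matrix_matrix_mult_def obata_matrix_def sum_3 sum_2 s sg algebra_simps)
qed

text \<open>A differentiable solution of the first order system is smooth by bootstrapping, since
  its derivatives are smooth combinations of the solution itself.\<close>

lemma obata_smoothI:
  assumes U: "open U" "U \<subseteq> D"
    and h: "\<And>x. x \<in> U \<Longrightarrow> (h has_derivative (\<lambda>v. \<Sum>i\<in>UNIV. v $ i * p i x)) (at x)"
    and p: "\<And>x j. x \<in> U \<Longrightarrow> (p j has_derivative (\<lambda>v. \<Sum>i\<in>UNIV. v $ i * ((\<Sum>k\<in>UNIV. \<Gamma> k i j x * p k x) - K * g x $ i $ j * h x))) (at x)"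
  shows "obata K U h" "\<And>x j. x \<in> U \<Longrightarrow> partial_deriv j h x = p j x"
proof -
  have ax: "(\<Sum>i\<in>UNIV. axis j 1 $ i * f i) = f j" for f :: "2 \<Rightarrow> real" and j
    using exhaust_2[of j] by (auto simp: sum_2 axis_def)
  note sm = smooth_on_subset[OF smooth_christoffel U(2), unfolded smooth_on_def, rule_format]
    smooth_on_subset[OF smooth_g_nth U(2), unfolded smooth_on_def, rule_format]
  have "Ck_on k U h \<and> (\<forall>j. Ck_on k U (p j))" for k
  proof (induction k)
    case 0
    show ?case
      using h p by (auto intro!: continuous_at_imp_continuous_on dest: has_derivative_continuous)
  next
    case (Suc k)
    have IH: "Ck_on k U h" "Ck_on k U (p j)" for j using Suc by auto
    note I = Ck_on_add Ck_on_bounded_bilinear[OF bounded_bilinear_mult] Ck_on_const U(1) IH sm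
    have 1: "Ck_on k U (\<lambda>x. \<Sum>i\<in>UNIV. v $ i * p i x)" for v :: "real^2"
      unfolding sum_2 by (intro I)
    have 2: "Ck_on k U (\<lambda>x. \<Sum>i\<in>UNIV. v $ i * ((\<Sum>k\<in>UNIV. \<Gamma> k i j x * p k x) - K * g x $ i $ j * h x))" for v j
      unfolding sum_2 diff_conv_add_uminus mult_minus_left[symmetric] by (intro I)
    show ?case
      using Ck_on_SucI[OF U(1) h 1] Ck_on_SucI[OF U(1) p 2] by blast
  qed
  then have "smooth_on U h" by (simp add: smooth_on_def)
  show pd: "partial_deriv j h x = p j x" if "x \<in> U" for x j
    using partial_deriv_eqI[OF h[OF that], of j] ax by simp
  have "partial_deriv i (partial_deriv j h) x = (\<Sum>k\<in>UNIV. \<Gamma> k i j x * partial_deriv k h x) - K * g x $ i $ j * h x"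
    if "x \<in> U" for x i j
    using partial_deriv_cong[OF U(1) that pd] partial_deriv_eqI[OF p[OF that], of i j] ax that pd by simp
  then show "obata K U h"
    using \<open>smooth_on U h\<close> U by (simp add: obata_def)
qed

text \<open>Value and differential at \<open>x0\<close> are free, which gives a three-dimensional
  solution space. The domain is fixed before the initial data, so that several solutions share it,
  and it is convex, so that functions with vanishing derivative are constant on it.\<close>

theorem obata_exists:
  assumes K: "has_curvature K" and x0: "x0 \<in> D"
  obtains U where "convex U" "open U" "x0 \<in> U" "U \<subseteq> D"
    "\<And>a b. \<exists>h. obata K U h \<and> h x0 = a \<and> (\<forall>j. partial_deriv j h x0 = b j)"
proof -
  define pt :: "real \<Rightarrow> real \<Rightarrow> real^2" where "pt x y = x0 + vector [x, y]" for x y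
  have pt_eq: "pt x y = x0 + x *\<^sub>R axis 1 1 + y *\<^sub>R axis 2 1" for x y
    by (simp add: pt_def vec_eq_iff forall_2 axis_def)
  have pt0: "pt 0 0 = x0" by (simp add: pt_eq)
  have cpt: "continuous_on UNIV (\<lambda>(x, y). pt x y)"
    unfolding pt_eq split_beta by (intro continuous_intros)
  define D' where "D' = {z. pt (fst z) (snd z) \<in> D}"
  have "open D'"
    using open_vimage[OF open_D cpt] by (simp add: D'_def vimage_def split_beta)
  moreover have "(0, 0) \<in> D'" using x0 pt0 by (simp add: D'_def)
  ultimately obtain r where r: "r > 0" "{-r<..<r} \<times> {-r<..<r} \<subseteq> D'"
    and sol: "\<And>y0. \<exists>Q. Q (0, 0) = y0 \<and> (\<forall>x y. \<bar>x\<bar> < r \<longrightarrow> \<bar>y\<bar> < r \<longrightarrow>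
       (Q has_derivative (\<lambda>h. fst h *\<^sub>R (obata_matrix K 1 (pt x y) *v Q (x, y)) + snd h *\<^sub>R (obata_matrix K 2 (pt x y) *v Q (x, y)))) (at (x, y)))"
  proof (rule flat_system_solution[where ?A1.0 = "\<lambda>x y. obata_matrix K 1 (pt x y)" and ?A2.0 = "\<lambda>x y. obata_matrix K 2 (pt x y)"
        and A1y = "\<lambda>x y. partial_deriv 2 (obata_matrix K 1) (pt x y)" and A2x = "\<lambda>x y. partial_deriv 1 (obata_matrix K 2) (pt x y)"])
    have cont: "continuous_on D' (\<lambda>(x, y). f (pt x y))" if "continuous_on D f" for f :: "real^2 \<Rightarrow> real^3^3"
      unfolding split_beta
      by (rule continuous_on_compose2[OF that])
        (use continuous_on_subset[OF cpt] in \<open>auto simp: split_beta D'_def\<close>)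
    show "continuous_on D' (\<lambda>(x, y). obata_matrix K 1 (pt x y))" "continuous_on D' (\<lambda>(x, y). obata_matrix K 2 (pt x y))"
      "continuous_on D' (\<lambda>(x, y). partial_deriv 2 (obata_matrix K 1) (pt x y))"
      "continuous_on D' (\<lambda>(x, y). partial_deriv 1 (obata_matrix K 2) (pt x y))"
      by (intro cont smooth_onD(3)[OF smooth_obata_matrix] smooth_onD(3)[OF smooth_on_partial_deriv[OF smooth_obata_matrix]])+
    show "((\<lambda>y. obata_matrix K 1 (pt x y)) has_vector_derivative partial_deriv 2 (obata_matrix K 1) (pt x y)) (at y)"
      if "(x, y) \<in> D'" for x y
    proof -
      have "((\<lambda>y. pt x y) has_derivative (\<lambda>h. h *\<^sub>R axis 2 1)) (at y)"
        unfolding pt_eq by (auto intro!: derivative_eq_intros)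
      from has_derivative_compose[OF this smooth_onD(1)[OF smooth_obata_matrix]] that
      show ?thesis
        using linear_cmul[OF frechet_derivative_linear[OF smooth_obata_matrix]]
        by (simp add: D'_def has_vector_derivative_def partial_deriv_def)
    qed
    show "((\<lambda>x. obata_matrix K 2 (pt x y)) has_vector_derivative partial_deriv 1 (obata_matrix K 2) (pt x y)) (at x)"
      if "(x, y) \<in> D'" for x y
    proof -
      have "((\<lambda>x. pt x y) has_derivative (\<lambda>h. h *\<^sub>R axis 1 1)) (at x)"
        unfolding pt_eq by (auto intro!: derivative_eq_intros)
      from has_derivative_compose[OF this smooth_onD(1)[OF smooth_obata_matrix]] that
      show ?thesis
        using linear_cmul[OF frechet_derivative_linear[OF smooth_obata_matrix]]
        by (simp add: D'_def has_vector_derivative_def partial_deriv_def)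
    qed
    show "partial_deriv 2 (obata_matrix K 1) (pt x y) + obata_matrix K 1 (pt x y) ** obata_matrix K 2 (pt x y) =
        partial_deriv 1 (obata_matrix K 2) (pt x y) + obata_matrix K 2 (pt x y) ** obata_matrix K 1 (pt x y)"
      if "(x, y) \<in> D'" for x y
      using that obata_matrix_flat[OF K] by (simp add: D'_def)
  qed (rule that; assumption)
  define U where "U = {z :: real^2. \<forall>i. \<bar>z $ i - x0 $ i\<bar> < r}"
  have U_eq: "U = box (\<chi> i. x0 $ i - r) (\<chi> i. x0 $ i + r)"
    by (auto simp: U_def mem_box_cart abs_diff_less_iff)
  have U: "open U" "convex U" "x0 \<in> U"
    using r unfolding U_eq by (auto simp: mem_box_cart)
  have UD: "U \<subseteq> D"
  proof
    fix z assume "z \<in> U"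
    then have "\<bar>z $ 1 - x0 $ 1\<bar> < r" "\<bar>z $ 2 - x0 $ 2\<bar> < r" by (auto simp: U_def)
    then have "(z $ 1 - x0 $ 1, z $ 2 - x0 $ 2) \<in> D'" by (intro subsetD[OF r(2)]) auto
    moreover have "pt (z $ 1 - x0 $ 1) (z $ 2 - x0 $ 2) = z"
      by (simp add: pt_def vec_eq_iff forall_2)
    ultimately show "z \<in> D" by (simp add: D'_def)
  qed
  have "\<exists>h. obata K U h \<and> h x0 = a \<and> (\<forall>j. partial_deriv j h x0 = b j)" for a and b :: "2 \<Rightarrow> real"
  proof -
    obtain Q where Q0: "Q (0, 0) = vector [a, b 1, b 2]" and Q: "\<And>x y. \<bar>x\<bar> < r \<Longrightarrow> \<bar>y\<bar> < r \<Longrightarrow>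
       (Q has_derivative (\<lambda>h. fst h *\<^sub>R (obata_matrix K 1 (pt x y) *v Q (x, y)) + snd h *\<^sub>R (obata_matrix K 2 (pt x y) *v Q (x, y)))) (at (x, y))"
      using sol[of "vector [a, b 1, b 2]"] by blast
    define q where "q z = Q (z $ 1 - x0 $ 1, z $ 2 - x0 $ 2)" for z :: "real^2"
    have q: "(q has_derivative (\<lambda>v. v $ 1 *\<^sub>R (obata_matrix K 1 z *v q z) + v $ 2 *\<^sub>R (obata_matrix K 2 z *v q z))) (at z)"
      if "z \<in> U" for z
    proof -
      have "pt (z $ 1 - x0 $ 1) (z $ 2 - x0 $ 2) = z"
        by (simp add: pt_def vec_eq_iff forall_2)
      moreover have d: "((\<lambda>z. (z $ 1 - x0 $ 1, z $ 2 - x0 $ 2)) has_derivative (\<lambda>v. (v $ 1, v $ 2))) (at z)"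
        by (auto intro!: derivative_eq_intros bounded_linear_imp_has_derivative bounded_linear_vec_nth)
      moreover
      have "\<bar>z $ 1 - x0 $ 1\<bar> < r" "\<bar>z $ 2 - x0 $ 2\<bar> < r" using that by (auto simp: U_def)
      moreover note has_derivative_compose[OF d Q[OF this]]
      ultimately show ?thesis by (simp add: q_def[abs_def])
    qed
    \<comment> \<open>The first entry of the solved column is \<open>h\<close>; the entries 2 and 3
      are its partial derivatives.\<close>
    define p where "p j z = q z $ (if j = 1 then 2 else 3)" for j :: 2 and z
    have nth: "((\<lambda>z. q z $ k) has_derivative (\<lambda>v. v $ 1 * (obata_matrix K 1 z *v q z) $ k + v $ 2 * (obata_matrix K 2 z *v q z) $ k)) (at z)"
      if "z \<in> U" for z k
      using bounded_linear.has_derivative[OF bounded_linear_vec_nth q[OF that], of k] by simp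
    have h: "((\<lambda>z. q z $ 1) has_derivative (\<lambda>v. \<Sum>i\<in>UNIV. v $ i * p i z)) (at z)" if "z \<in> U" for z
      using nth[OF that, of 1] by (simp add: sum_2 sum_3 matrix_vector_mult_def obata_matrix_def p_def)
    have p: "(p j has_derivative (\<lambda>v. \<Sum>i\<in>UNIV. v $ i * ((\<Sum>k\<in>UNIV. \<Gamma> k i j z * p k z) - K * g z $ i $ j * q z $ 1))) (at z)"
      if "z \<in> U" for z j
      using nth[OF that, of "if j = 1 then 2 else 3"] exhaust_2[of j] unfolding p_def[abs_def]
      by (auto simp: sum_2 sum_3 matrix_vector_mult_def obata_matrix_def algebra_simps)
    have "q x0 $ 1 = a" "\<forall>j. p j x0 = b j"
      using Q0 by (auto simp: q_def p_def forall_2)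
    then show ?thesis
      using obata_smoothI[OF U(1) UD h p] U(3) by (intro exI[of _ "\<lambda>z. q z $ 1"]) auto
  qed
  with U UD that show thesis by blast
qed

lemma obata_partial_deriv:
  assumes "obata K U h"
  shows "smooth_on U h" "smooth_on U (partial_deriv j h)"
    "x \<in> U \<Longrightarrow> partial_deriv i (partial_deriv j h) x =
       (\<Sum>k\<in>UNIV. \<Gamma> k i j x * partial_deriv k h x) - K * g x $ i $ j * h x"
  using assms smooth_on_partial_deriv by (auto simp: obata_def)

section \<open>The conserved quadratic form\<close>

text \<open>The inverse metric evaluated on two covectors, written out by Cramer's rule.\<close>

definition cometric :: "real^2 \<Rightarrow> (2 \<Rightarrow> real) \<Rightarrow> (2 \<Rightarrow> real) \<Rightarrow> real" where
  "cometric x p q = (g x $ 2 $ 2 * (p 1 * q 1) - g x $ 1 $ 2 * (p 1 * q 2 + p 2 * q 1) + g x $ 1 $ 1 * (p 2 * q 2)) / det (g x)"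

text \<open>The Hessian equation says that the covariant derivative of grad h along e is - K h e.
  Hence the derivative of g(grad h, grad k) along el is - K (h dl k + k dl h), which cancels the
  derivative of K h k.\<close>

lemma obata_form_constant:
  assumes h: "obata K U h" and k: "obata K U k" and U: "convex U" "x \<in> U" "y \<in> U"
  shows "K * (h x * k x) + cometric x (\<lambda>i. partial_deriv i h x) (\<lambda>i. partial_deriv i k x)
    = K * (h y * k y) + cometric y (\<lambda>i. partial_deriv i h y) (\<lambda>i. partial_deriv i k y)"
proof -
  define B where "B x = K * (h x * k x) + cometric x (\<lambda>i. partial_deriv i h x) (\<lambda>i. partial_deriv i k x)" for x
  have UD: "U \<subseteq> D" "open U" using h by (auto simp: obata_def)
  note sm = smooth_on_add smooth_on_diff smooth_on_mult smooth_on_const obata_partial_deriv(1,2)[OF h]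
    obata_partial_deriv(1,2)[OF k] smooth_on_subset[OF smooth_g_nth UD(1)] smooth_on_subset[OF smooth_det UD(1)]
  have sB: "smooth_on U B"
    unfolding B_def cometric_def using UD det_g by (intro sm smooth_on_divide) auto
  have "partial_deriv l B x = 0" if x: "x \<in> U" for l x
  proof -
    have xD: "x \<in> D" using x UD by auto
    note pd = partial_deriv_add[OF _ _ x] partial_deriv_diff[OF _ _ x] partial_deriv_mult[OF _ _ x] partial_deriv_const
      partial_deriv_divide[OF _ _ x, where h = "\<lambda>x. det (g x)", OF _ _ det_g[OF xD]]
    have s: "g x $ 2 $ 1 = g x $ 1 $ 2" by (rule g_sym[OF xD])
    \<comment> \<open>Jacobi's formula: by metric compatibility the logarithmic derivative of the
      determinant is twice the trace of the Christoffel symbols.\<close>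
    have dd: "partial_deriv l (\<lambda>x. det (g x)) x = 2 * (\<Gamma> 1 l 1 x + \<Gamma> 2 l 2 x) * det (g x)"
      unfolding det_2
      by (simp add: pd sm UD(2) metric_compat[OF xD] sum_2 s algebra_simps)
    have "partial_deriv l B x = K * (partial_deriv l h x * k x + h x * partial_deriv l k x) +
       ((g x $ 2 $ 2 * (partial_deriv l (partial_deriv 1 h) x * partial_deriv 1 k x + partial_deriv 1 h x * partial_deriv l (partial_deriv 1 k) x)
        + dg l 2 2 x * (partial_deriv 1 h x * partial_deriv 1 k x)
        - (g x $ 1 $ 2 * (partial_deriv l (partial_deriv 1 h) x * partial_deriv 2 k x + partial_deriv 1 h x * partial_deriv l (partial_deriv 2 k) x
             + (partial_deriv l (partial_deriv 2 h) x * partial_deriv 1 k x + partial_deriv 2 h x * partial_deriv l (partial_deriv 1 k) x))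
           + dg l 1 2 x * (partial_deriv 1 h x * partial_deriv 2 k x + partial_deriv 2 h x * partial_deriv 1 k x))
        + (g x $ 1 $ 1 * (partial_deriv l (partial_deriv 2 h) x * partial_deriv 2 k x + partial_deriv 2 h x * partial_deriv l (partial_deriv 2 k) x)
        + dg l 1 1 x * (partial_deriv 2 h x * partial_deriv 2 k x))) * det (g x)
       - (g x $ 2 $ 2 * (partial_deriv 1 h x * partial_deriv 1 k x) - g x $ 1 $ 2 * (partial_deriv 1 h x * partial_deriv 2 k x + partial_deriv 2 h x * partial_deriv 1 k x)
         + g x $ 1 $ 1 * (partial_deriv 2 h x * partial_deriv 2 k x)) * (2 * (\<Gamma> 1 l 1 x + \<Gamma> 2 l 2 x) * det (g x))) / (det (g x))\<^sup>2"
      unfolding B_def cometric_def using UD(1,2) det_g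
      by (simp add: pd sm smooth_on_divide dd subset_iff algebra_simps)
    also have "\<dots> = 0"
    proof -
      have e: "a + b * d / d\<^sup>2 = 0" if "d \<noteq> 0" "a * d + b = 0" for a b d :: real
        using that by (simp add: power2_eq_square divide_simps)
      show ?thesis
        unfolding left_diff_distrib[symmetric] mult.assoc[symmetric]
        apply (rule e[OF det_g[OF xD]])
        unfolding obata_partial_deriv(3)[OF h x] obata_partial_deriv(3)[OF k x] metric_compat[OF xD] sum_2 det_g_eq[OF xD]
        using exhaust_2[of l] by (elim disjE) (simp_all add: s algebra_simps)
    qed
    finally show ?thesis .
  qed
  then have "(B has_derivative (\<lambda>v. 0)) (at x within U)" if "x \<in> U" for x
    using smooth_on_has_derivative[OF sB that] that has_derivative_at_withinI by fastforce
  then have "B x = B y"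
    using has_derivative_zero_unique[OF U(1) _ U(2,3)] by metis
  then show ?thesis by (simp add: B_def)
qed

end

section \<open>Charts and isometries onto the model surfaces\<close>

lemma is_chartD:
  assumes "is_chart X (U, \<phi>)"
  shows "openin X U" "open (\<phi> ` U)" "inj_on \<phi> U"
    "\<And>V. openin X V \<Longrightarrow> V \<subseteq> U \<Longrightarrow> open (\<phi> ` V)"
    "\<And>S. open S \<Longrightarrow> openin X {p \<in> U. \<phi> p \<in> S}"
    "continuous_map (subtopology X U) euclidean \<phi>"
    "continuous_map (top_of_set (\<phi> ` U)) X (inv_into U \<phi>)"
proof -
  have h: "homeomorphic_map (subtopology X U) (top_of_set (\<phi> ` U)) \<phi>"
    and U: "openin X U" and oU: "open (\<phi> ` U)"
    using assms by (auto simp: is_chart_def)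
  have top: "topspace (subtopology X U) = U"
    using openin_subset[OF U] by auto
  note ev = h[unfolded homeomorphic_eq_everything_map top]
  show "openin X U" "open (\<phi> ` U)" by fact+
  show inj: "inj_on \<phi> U" using ev by simp
  show "open (\<phi> ` V)" if "openin X V" "V \<subseteq> U" for V
  proof -
    have "openin (subtopology X U) V" using that U by (simp add: openin_open_subtopology)
    then have "openin (top_of_set (\<phi> ` U)) (\<phi> ` V)" using ev by (simp add: open_map_def)
    then show ?thesis using oU openin_open_eq by blast
  qed
  show cont: "continuous_map (subtopology X U) euclidean \<phi>"
    using ev continuous_map_in_subtopology by blast
  show "openin X {p \<in> U. \<phi> p \<in> S}" if "open S" for S
  proof -
    have "{p \<in> topspace (subtopology X U). \<phi> p \<in> S} = {p \<in> U. \<phi> p \<in> S}" unfolding top ..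
    with openin_continuous_map_preimage[OF cont, of S] that
    have "openin (subtopology X U) {p \<in> U. \<phi> p \<in> S}" by simp
    then show ?thesis using U by (simp add: openin_open_subtopology)
  qed
  obtain \<psi> where \<psi>: "homeomorphic_maps (subtopology X U) (top_of_set (\<phi> ` U)) \<phi> \<psi>"
    using h homeomorphic_map_maps by blast
  then have c\<psi>: "continuous_map (top_of_set (\<phi> ` U)) X \<psi>" and inv: "\<And>p. p \<in> U \<Longrightarrow> \<psi> (\<phi> p) = p"
    using top by (auto simp: homeomorphic_maps_def continuous_map_in_subtopology)
  show "continuous_map (top_of_set (\<phi> ` U)) X (inv_into U \<phi>)"
    by (rule continuous_map_eq[OF c\<psi>]) (auto simp: inv inj inv_into_f_f)
qed

lemma smooth_manifoldD:
  assumes "smooth_manifold M"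
  shows "Hausdorff_space (mtop M)" "(U, \<phi>) \<in> atlas M \<Longrightarrow> is_chart (mtop M) (U, \<phi>)"
    "p \<in> topspace (mtop M) \<Longrightarrow> \<exists>U \<phi>. (U, \<phi>) \<in> atlas M \<and> p \<in> U"
    "(U, \<phi>) \<in> atlas M \<Longrightarrow> (V, \<psi>) \<in> atlas M \<Longrightarrow> smooth_on (\<phi> ` (U \<inter> V)) (\<psi> \<circ> inv_into U \<phi>)"
proof -
  show "p \<in> topspace (mtop M) \<Longrightarrow> \<exists>U \<phi>. (U, \<phi>) \<in> atlas M \<and> p \<in> U"
  proof -
    assume p: "p \<in> topspace (mtop M)"
    have "(\<Union>c\<in>atlas M. fst c) = topspace (mtop M)" using assms by (simp add: smooth_manifold_def)
    with p obtain c where "c \<in> atlas M" "p \<in> fst c" by blast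
    then show ?thesis by (intro exI[of _ "fst c"] exI[of _ "snd c"]) simp
  qed
  show "Hausdorff_space (mtop M)" using assms by (simp add: smooth_manifold_def)
  show "(U, \<phi>) \<in> atlas M \<Longrightarrow> is_chart (mtop M) (U, \<phi>)" using assms by (simp add: smooth_manifold_def)
  assume c: "(U, \<phi>) \<in> atlas M" and d: "(V, \<psi>) \<in> atlas M"
  have "\<forall>(U, \<phi>)\<in>atlas M. \<forall>(V, \<psi>)\<in>atlas M. smooth_on (\<phi> ` (U \<inter> V)) (\<psi> \<circ> inv_into U \<phi>)"
    using assms by (simp add: smooth_manifold_def)
  from bspec[OF this c] have "\<forall>(V, \<psi>)\<in>atlas M. smooth_on (\<phi> ` (U \<inter> V)) (\<psi> \<circ> inv_into U \<phi>)" by simp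
  from bspec[OF this d] show "smooth_on (\<phi> ` (U \<inter> V)) (\<psi> \<circ> inv_into U \<phi>)" by simp
qed

lemma pseudo_riemannianD:
  assumes "pseudo_riemannian M s"
  shows "smooth_manifold M"
    "(U, \<phi>) \<in> atlas M \<Longrightarrow> smooth_on (\<phi> ` U) (metric M (U, \<phi>))"
    "(U, \<phi>) \<in> atlas M \<Longrightarrow> x \<in> \<phi> ` U \<Longrightarrow> transpose (metric M (U, \<phi>) x) = metric M (U, \<phi>) x"
    "(U, \<phi>) \<in> atlas M \<Longrightarrow> x \<in> \<phi> ` U \<Longrightarrow> nondegenerate (metric M (U, \<phi>) x)"
    "(U, \<phi>) \<in> atlas M \<Longrightarrow> x \<in> \<phi> ` U \<Longrightarrow> form_index (metric M (U, \<phi>) x) = s"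
    "(U, \<phi>) \<in> atlas M \<Longrightarrow> (V, \<psi>) \<in> atlas M \<Longrightarrow> p \<in> U \<inter> V \<Longrightarrow> metric M (U, \<phi>) (\<phi> p) =
      transpose (jacobian_at (\<psi> \<circ> inv_into U \<phi>) (\<phi> p)) ** metric M (V, \<psi>) (\<psi> p) ** jacobian_at (\<psi> \<circ> inv_into U \<phi>) (\<phi> p)"
  using assms unfolding pseudo_riemannian_def Let_def by fast+

subsection \<open>Signature\<close>

lemma form_2:
  fixes A :: "real^2^2"
  shows "form A v w = A $ 1 $ 1 * v $ 1 * w $ 1 + A $ 1 $ 2 * v $ 1 * w $ 2 + A $ 2 $ 1 * v $ 2 * w $ 1 + A $ 2 $ 2 * v $ 2 * w $ 2"
  by (simp add: form_def inner_vec_def matrix_vector_mult_def sum_2 algebra_simps)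

text \<open>Index 1 provides a vector of negative square. A positive determinant would then make the
  form negative definite, hence of index 2, and a zero determinant contradicts
  nondegeneracy.\<close>

lemma det_neg_if_index_1:
  fixes A :: "real^2^2"
  assumes sym: "transpose A = A" and nd: "nondegenerate A" and ind: "form_index A = 1"
  shows "det A < 0"
proof -
  define a b c where "a = A $ 1 $ 1" and "b = A $ 1 $ 2" and "c = A $ 2 $ 2"
  have s: "A $ 2 $ 1 = b"
    using arg_cong[OF sym, of "\<lambda>A. A $ 2 $ 1"] by (simp add: transpose_def b_def)
  have f: "form A v w = a * v $ 1 * w $ 1 + b * v $ 1 * w $ 2 + b * v $ 2 * w $ 1 + c * v $ 2 * w $ 2" for v w
    by (simp add: form_2 s a_def b_def c_def)
  have d: "det A = a * c - b * b" by (simp add: det_2 s a_def b_def c_def)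
  let ?\<D> = "{dim W | W. subspace W \<and> (\<forall>w\<in>W. w \<noteq> 0 \<longrightarrow> form A w w < 0)}"
  have "?\<D> \<subseteq> {..2}"
    using dim_subset_UNIV[where ?'a = "real^2"] by auto
  then have fin: "finite ?\<D>" using finite_subset by blast
  have ne: "0 \<in> ?\<D>" by (rule CollectI, rule exI[of _ "{0}"]) (auto simp: subspace_0)
  have "form_index A \<in> ?\<D>"
    unfolding form_index_def using fin ne by (intro Max_in) auto
  then obtain W where W: "dim W = 1" "\<And>w. w \<in> W \<Longrightarrow> w \<noteq> 0 \<Longrightarrow> form A w w < 0"
    using ind by auto
  then have "\<not> W \<subseteq> {0}" by (metis dim_eq_0 zero_neq_one)
  then obtain w where w: "form A w w < 0" using W(2) by blast
  have nz: "det A \<noteq> 0"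
  proof
    assume "det A = 0"
    then have z: "a * c = b * b" using d by simp
    \<comment> \<open>A singular symmetric matrix kills the vector (-b, a) orthogonal to its first
      row, or the first basis vector if that row is zero.\<close>
    have "\<exists>v. v \<noteq> 0 \<and> (\<forall>w. form A v w = 0)"
    proof (cases "a = 0 \<and> b = 0")
      case True
      then show ?thesis by (intro exI[of _ "axis 1 1"]) (auto simp: f axis_def vec_eq_iff forall_2)
    next
      case False
      have "form A (vector [- b, a]) w = 0" for w
        using z by (simp add: f algebra_simps)
      then show ?thesis using False by (intro exI[of _ "vector [- b, a]"]) (auto simp: vec_eq_iff forall_2)
    qed
    then show False using nd by (auto simp: nondegenerate_def)
  qed
  moreover have "\<not> det A > 0"
  proof
    assume pos: "det A > 0"
    \<comment> \<open>Completing the square: for a positive determinant the sign of the form is that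
      of \<open>a\<close>.\<close>
    have sq: "a * form A v v = (a * v $ 1 + b * v $ 2)\<^sup>2 + det A * (v $ 2)\<^sup>2" for v
      unfolding d f by (simp add: power2_eq_square algebra_simps)
    have "0 \<le> a * form A w w" using pos unfolding sq by auto
    moreover have "a \<noteq> 0" using pos d by (auto simp: not_less)
    ultimately have a: "a < 0" using w by (auto simp: zero_le_mult_iff)
    have "form A v v < 0" if "v \<noteq> 0" for v
    proof -
      have "0 < a * form A v v"
      proof (cases "v $ 2 = 0")
        case True
        then show ?thesis using that a unfolding sq by (auto simp: vec_eq_iff forall_2)
      next
        case False
        then show ?thesis using pos unfolding sq by (intro add_nonneg_pos) auto
      qed
      then show ?thesis using a by (simp add: zero_less_mult_iff)
    qed
    then have "2 \<in> ?\<D>" by (intro CollectI exI[of _ UNIV]) (auto simp: dim_UNIV)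
    then have "2 \<le> form_index A" unfolding form_index_def using fin by (intro Max_ge)
    then show False using ind by simp
  qed
  ultimately show ?thesis by linarith
qed

text \<open>Normalise a vector of positive square and take as partner the rotated covector dual to
  it. The partner is orthogonal automatically, and its square is the determinant up to a positive
  factor, hence negative.\<close>

lemma orthonormal_basis_exists:
  fixes a b c :: real
  assumes d: "a * c - b * b < 0"
  obtains p1 p2 q1 q2 where "a * p1 * p1 + b * (p1 * p2 + p2 * p1) + c * p2 * p2 = 1"
    "a * p1 * q1 + b * (p1 * q2 + p2 * q1) + c * p2 * q2 = 0"
    "a * q1 * q1 + b * (q1 * q2 + q2 * q1) + c * q2 * q2 = - 1"
proof -
  define Q where "Q x y = a * x * x + b * (x * y + y * x) + c * y * y" for x y
  \<comment> \<open>For negative \<open>a\<close> the vector (-b, a) has square \<open>a\<close>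
    times the negative determinant. For \<open>a = 0\<close> the form is affine in \<open>x\<close>
    along \<open>y = 1\<close>, and the abscissa is chosen to make the value 1.\<close>
  have "\<exists>x y. Q x y > 0"
  proof (cases a "0 :: real" rule: linorder_cases)
    case less
    have "Q (- b) a = a * (a * c - b * b)" by (simp add: Q_def algebra_simps)
    then show ?thesis using less d by (metis mult_neg_neg)
  next
    case equal
    then have "b \<noteq> 0" using d by auto
    then have "Q ((1 - c) / (2 * b)) 1 = 1" using equal by (simp add: Q_def field_simps)
    then show ?thesis by (metis zero_less_one)
  next
    case greater
    then have "Q 1 0 > 0" by (simp add: Q_def)
    then show ?thesis by blast
  qed
  then obtain x y where xy: "Q x y > 0" by blast
  define p1 p2 where "p1 = x / sqrt (Q x y)" and "p2 = y / sqrt (Q x y)"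
  define m where "m = sqrt (b * b - a * c)"
  have m: "m > 0" "m * m = b * b - a * c" using d by (auto simp: m_def)
  have "sqrt (Q x y) * sqrt (Q x y) = Q x y" using xy by simp
  then have p: "Q p1 p2 = 1"
    using xy unfolding p1_def p2_def Q_def[of "x / _"] by (simp add: divide_simps) (simp add: Q_def algebra_simps)
  define q1 q2 where "q1 = - (b * p1 + c * p2) / m" and "q2 = (a * p1 + b * p2) / m"
  have "a * p1 * q1 + b * (p1 * q2 + p2 * q1) + c * p2 * q2 = 0"
    using m by (simp add: q1_def q2_def field_simps)
  moreover have "Q q1 q2 = Q p1 p2 * (a * c - b * b) / (m * m)"
    using m(1) by (simp add: q1_def q2_def Q_def field_simps)
  then have "Q q1 q2 = (a * c - b * b) / (b * b - a * c)" unfolding p m(2) by simp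
  then have "Q q1 q2 = - 1" using d by (simp add: divide_eq_eq)
  ultimately show thesis using that[of p1 p2 q1 q2] p by (simp add: Q_def)
qed

subsection \<open>The immersion by solutions of the Obata equation\<close>

text \<open>If the rows of a square matrix are orthonormal for \<open>G\<close> with signs
  \<open>N\<close>, then inverting this relation expresses the inverse of \<open>G\<close> through
  the rows. Applied with the inverse metric as \<open>G\<close>, it recovers the metric from the
  differentials of the solutions.\<close>

lemma diagonal_form_dual:
  fixes P G :: "real^'n^'n"
  assumes PGP: "P ** G ** transpose P = N" and N: "N ** N' = mat 1" and G: "G' ** G = mat 1"
  shows "transpose P ** N' ** P = G'"
proof -
  have "(P ** G) ** (transpose P ** N') = mat 1"
    using PGP N by (simp add: matrix_mul_assoc)
  then have "(transpose P ** N') ** (P ** G) = mat 1"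
    using matrix_left_right_inverse by blast
  then have "(transpose P ** N' ** P) ** G = mat 1" by (simp add: matrix_mul_assoc)
  moreover have "G ** G' = mat 1" using G matrix_left_right_inverse by blast
  ultimately have "transpose P ** N' ** P ** (G ** G') = mat 1 ** G'"
    by (metis matrix_mul_assoc)
  then show ?thesis using \<open>G ** G' = mat 1\<close> by simp
qed

context metric2
begin

text \<open>The solutions start at \<open>x0\<close> with data (1, 0), (0, p) and (0, q), where p
  and q are orthonormal for the inverse metric. Conservation keeps their Gram matrix equal to
  diag(K, 1, -1) on the whole neighbourhood; dualising gives the metric and, for nonzero K, the
  equation of the quadric. The last two solutions serve as coordinates.\<close>

lemma obata_immersion_exists:
  assumes K: "has_curvature K" and K01: "K \<in> {- 1, 0, 1}" and x0: "x0 \<in> D" and neg: "det (g x0) < 0"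
  obtains U h0 h1 h2 where "x0 \<in> U" "smooth_on U h0" "obata K U h1" "obata K U h2"
    "inj_on (\<lambda>x. vector [h1 x, h2 x] :: real^2) U"
    "\<And>x. x \<in> U \<Longrightarrow> partial_deriv 1 h1 x * partial_deriv 2 h2 x - partial_deriv 2 h1 x * partial_deriv 1 h2 x \<noteq> 0"
    "\<And>x i j. x \<in> U \<Longrightarrow> g x $ i $ j = K * (partial_deriv i h0 x * partial_deriv j h0 x) + partial_deriv i h1 x * partial_deriv j h1 x - partial_deriv i h2 x * partial_deriv j h2 x"
    "\<And>x. x \<in> U \<Longrightarrow> h0 x > 0"
    "\<And>x. x \<in> U \<Longrightarrow> K \<noteq> 0 \<Longrightarrow> (h0 x)\<^sup>2 = 1 - K * ((h1 x)\<^sup>2 - (h2 x)\<^sup>2)"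
proof -
  obtain V where V: "convex V" "open V" "x0 \<in> V" "V \<subseteq> D"
    and ex: "\<And>a b. \<exists>h. obata K V h \<and> h x0 = a \<and> (\<forall>j. partial_deriv j h x0 = b j)"
    using obata_exists[OF K x0] by blast
  have d0: "det (g x0) = g x0 $ 1 $ 1 * g x0 $ 2 $ 2 - g x0 $ 1 $ 2 * g x0 $ 1 $ 2"
    by (rule det_g_eq[OF x0])
  \<comment> \<open>The components of the inverse metric at \<open>x0\<close>; their determinant is
    the reciprocal of the negative determinant of the metric.\<close>
  define A B C where "A = g x0 $ 2 $ 2 / det (g x0)" and "B = - g x0 $ 1 $ 2 / det (g x0)" and "C = g x0 $ 1 $ 1 / det (g x0)"
  have "A * C - B * B = (g x0 $ 1 $ 1 * g x0 $ 2 $ 2 - g x0 $ 1 $ 2 * g x0 $ 1 $ 2) / (det (g x0) * det (g x0))"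
    by (simp add: A_def B_def C_def diff_divide_distrib)
  then have "A * C - B * B = 1 / det (g x0)" unfolding d0[symmetric] using neg by simp
  then have "A * C - B * B < 0" using neg by simp
  then obtain p1 p2 q1 q2 where p: "A * p1 * p1 + B * (p1 * p2 + p2 * p1) + C * p2 * p2 = 1"
    and pq: "A * p1 * q1 + B * (p1 * q2 + p2 * q1) + C * p2 * q2 = 0"
    and q: "A * q1 * q1 + B * (q1 * q2 + q2 * q1) + C * q2 * q2 = - 1"
    using orthonormal_basis_exists by blast
  have com0: "cometric x0 u w = A * u 1 * w 1 + B * (u 1 * w 2 + u 2 * w 1) + C * u 2 * w 2" for u w
    unfolding cometric_def A_def B_def C_def by (simp add: diff_divide_distrib add_divide_distrib mult.assoc)
  obtain h0 where h0: "obata K V h0" "h0 x0 = 1" "\<And>j. partial_deriv j h0 x0 = 0"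
    using ex[of 1 "\<lambda>_. 0"] by blast
  obtain h1 where h1: "obata K V h1" "h1 x0 = 0" "\<And>j. partial_deriv j h1 x0 = (if j = 1 then p1 else p2)"
    using ex[of 0 "\<lambda>j. if j = 1 then p1 else p2"] by blast
  obtain h2 where h2: "obata K V h2" "h2 x0 = 0" "\<And>j. partial_deriv j h2 x0 = (if j = 1 then q1 else q2)"
    using ex[of 0 "\<lambda>j. if j = 1 then q1 else q2"] by blast
  note sm = obata_partial_deriv(1)[OF h0(1)] obata_partial_deriv(1)[OF h1(1)] obata_partial_deriv(1)[OF h2(1)]
  have form: "K * (h x * k x) + cometric x (\<lambda>i. partial_deriv i h x) (\<lambda>i. partial_deriv i k x)
      = K * (h x0 * k x0) + cometric x0 (\<lambda>i. partial_deriv i h x0) (\<lambda>i. partial_deriv i k x0)"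
    if "obata K V h" "obata K V k" "x \<in> V" for h k x
    by (rule obata_form_constant[OF that(1,2) V(1) that(3) V(3)])
  define W where "W x = partial_deriv 1 h1 x * partial_deriv 2 h2 x - partial_deriv 2 h1 x * partial_deriv 1 h2 x" for x
  have "smooth_on V W"
    unfolding W_def by (intro smooth_on_diff smooth_on_mult smooth_on_partial_deriv sm V)
  then have contW: "continuous_on V W" by (rule smooth_onD)
  \<comment> \<open>The Gram determinant of the orthonormal pair; it forces the differentials of
    \<open>h1\<close> and \<open>h2\<close> to be independent at \<open>x0\<close>.\<close>
  have "(A * C - B * B) * (p1 * q2 - p2 * q1)\<^sup>2 = - 1"
    using p pq q by algebra
  then have W0: "W x0 \<noteq> 0" by (auto simp: W_def h1 h2)
  \<comment> \<open>Positivity of \<open>h0\<close>, which is 1 at \<open>x0\<close>, selects the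
    sheet of the quadric that is a graph over (h1, h2).\<close>
  define V' where "V' = {x \<in> V. W x \<noteq> 0 \<and> h0 x > 0}"
  have "open (V \<inter> W -` (- {0}))" "open (V \<inter> h0 -` {0<..})"
    by (intro continuous_open_preimage[OF contW V(2)] continuous_open_preimage[OF smooth_onD(3)[OF sm(1)] V(2)]; simp add: open_Compl)+
  moreover have "V' = (V \<inter> W -` (- {0})) \<inter> (V \<inter> h0 -` {0<..})" by (auto simp: V'_def)
  ultimately have V': "open V'" "x0 \<in> V'" "V' \<subseteq> V"
    using W0 V h0 by (auto simp: V'_def)
  define H where "H x = (vector [h1 x, h2 x] :: real^2)" for x
  have smH: "smooth_on V H"
    unfolding H_def[abs_def] by (rule smooth_on_vector_2) (rule V(2) sm)+
  have jH: "jacobian_at H x $ 1 $ i = partial_deriv i h1 x" "jacobian_at H x $ 2 $ i = partial_deriv i h2 x" if "x \<in> V" for x i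
    unfolding H_def[abs_def] by (rule jacobian_at_vector_2; rule V(2) sm that)+
  have dH: "det (jacobian_at H x) = W x" if "x \<in> V" for x
    unfolding det_2 jH[OF that] W_def ..
  define f' where "f' x = Blinfun (frechet_derivative H (at x))" for x
  have f': "blinfun_apply (f' x) = frechet_derivative H (at x)" if "x \<in> V" for x
    using has_derivative_bounded_linear[OF smooth_onD(1)[OF smH that]] by (simp add: f'_def bounded_linear_Blinfun_apply)
  have "continuous_on V f'"
    by (rule continuous_on_blinfun_componentwise)
      (use smooth_onD(3)[OF smooth_onD(2)[OF smH]] f' in \<open>simp cong: continuous_on_cong\<close>)
  then have contf': "continuous_on V' f'" using V' continuous_on_subset by blast
  have "invertible (jacobian_at H x0)" using W0 dH[OF V(3)] by (simp add: invertible_det_nz)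
  then obtain J' where J': "J' ** jacobian_at H x0 = mat 1" by (auto simp: invertible_def)
  have "Blinfun ((*v) J') o\<^sub>L f' x0 = id_blinfun"
  proof (rule blinfun_eqI)
    fix v
    have "J' *v (jacobian_at H x0 *v v) = v" by (simp add: matrix_vector_mul_assoc J')
    then show "blinfun_apply (Blinfun ((*v) J') o\<^sub>L f' x0) v = blinfun_apply id_blinfun v"
      by (simp add: bounded_linear_Blinfun_apply f'[OF V(3)] jacobian_at_works[OF smH V(3)] matrix_vector_mul_bounded_linear)
  qed
  note left_inverse = this
  have der: "(H has_derivative blinfun_apply (f' x)) (at x)" if "x \<in> V'" for x
    using smooth_onD(1)[OF smH, of x] f' V'(3) that by auto
  obtain U S gg g' where U: "open U" "U \<subseteq> V'" "x0 \<in> U" and hom: "homeomorphism U S H gg"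
    by (rule inverse_function_theorem[OF V'(1) der contf' V'(2) left_inverse])
  have inj: "inj_on H U" by (rule inj_on_inverseI[of _ gg]) (rule homeomorphism_apply1[OF hom])
  have UV: "x \<in> V" "x \<in> D" "W x \<noteq> 0" "h0 x > 0" if "x \<in> U" for x
    using that U V' V by (auto simp: V'_def)
  have "g x $ i $ j = K * (partial_deriv i h0 x * partial_deriv j h0 x) + partial_deriv i h1 x * partial_deriv j h1 x - partial_deriv i h2 x * partial_deriv j h2 x
      \<and> (K \<noteq> 0 \<longrightarrow> (h0 x)\<^sup>2 = 1 - K * ((h1 x)\<^sup>2 - (h2 x)\<^sup>2))"
    if "x \<in> U" for x i j
  proof -
    note xU = UV[OF that]
    have s: "g x $ 2 $ 1 = g x $ 1 $ 2" by (rule g_sym[OF xU(2)])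
    define a b c where "a = g x $ 2 $ 2 / det (g x)" and "b = - g x $ 1 $ 2 / det (g x)" and "c = g x $ 1 $ 1 / det (g x)"
    have com: "cometric x u w = a * u 1 * w 1 + b * (u 1 * w 2 + u 2 * w 1) + c * u 2 * w 2" for u w
      unfolding cometric_def a_def b_def c_def by (simp add: diff_divide_distrib add_divide_distrib mult.assoc)
    have inv: "g x $ 1 $ 1 * a + g x $ 1 $ 2 * b = 1" "g x $ 1 $ 1 * b + g x $ 1 $ 2 * c = 0"
      "g x $ 1 $ 2 * a + g x $ 2 $ 2 * b = 0" "g x $ 1 $ 2 * b + g x $ 2 $ 2 * c = 1"
      using det_g[OF xU(2)] det_g_eq[OF xU(2)] by (simp_all add: a_def b_def c_def divide_simps)
    note f = form[OF h0(1) h0(1) xU(1)] form[OF h0(1) h1(1) xU(1)] form[OF h0(1) h2(1) xU(1)]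
      form[OF h1(1) h1(1) xU(1)] form[OF h1(1) h2(1) xU(1)] form[OF h2(1) h2(1) xU(1)]
    note f = f[unfolded com com0 h0(2,3) h1(2,3) h2(2,3), simplified, unfolded p pq q]
    show ?thesis
    \<comment> \<open>For K = 0 the corner entry K makes the 3 by 3 matrices singular, but the
      derivatives of \<open>h1\<close> and \<open>h2\<close> alone already satisfy the relation. For
      nonzero K the diagonal matrix is its own inverse because K squares to 1.\<close>
    proof (cases "K = 0")
      case True
      define P :: "real^2^2" where "P = vector [vector [partial_deriv 1 h1 x, partial_deriv 2 h1 x], vector [partial_deriv 1 h2 x, partial_deriv 2 h2 x]]"
      define G :: "real^2^2" where "G = vector [vector [a, b], vector [b, c]]"
      define N :: "real^2^2" where "N = vector [vector [1, 0], vector [0, - 1]]"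
      have "transpose P ** N ** P = g x"
      proof (rule diagonal_form_dual)
        show "P ** G ** transpose P = N"
          using f p pq q True
          by (simp add: vec_eq_iff forall_2 matrix_matrix_mult_def sum_2 transpose_def P_def G_def N_def algebra_simps)
        show "N ** N = mat 1"
          by (simp add: vec_eq_iff forall_2 matrix_matrix_mult_def sum_2 N_def mat_def)
        show "g x ** G = mat 1"
          using inv s by (simp add: vec_eq_iff forall_2 matrix_matrix_mult_def sum_2 G_def mat_def)
      qed
      then have "g x $ i $ j = (transpose P ** N ** P) $ i $ j" by simp
      also have "\<dots> = partial_deriv i h1 x * partial_deriv j h1 x - partial_deriv i h2 x * partial_deriv j h2 x"
        using exhaust_2[of i] exhaust_2[of j]
        by (auto simp: matrix_matrix_mult_def sum_2 transpose_def P_def N_def algebra_simps)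
      finally show ?thesis using True by simp
    next
      case False
      then have KK: "K * K = 1" using K01 by auto
      define P :: "real^3^3" where "P = vector [vector [h0 x, partial_deriv 1 h0 x, partial_deriv 2 h0 x],
        vector [h1 x, partial_deriv 1 h1 x, partial_deriv 2 h1 x], vector [h2 x, partial_deriv 1 h2 x, partial_deriv 2 h2 x]]"
      define G :: "real^3^3" where "G = vector [vector [K, 0, 0], vector [0, a, b], vector [0, b, c]]"
      define G' :: "real^3^3" where "G' = vector [vector [K, 0, 0], vector [0, g x $ 1 $ 1, g x $ 1 $ 2], vector [0, g x $ 1 $ 2, g x $ 2 $ 2]]"
      define N :: "real^3^3" where "N = vector [vector [K, 0, 0], vector [0, 1, 0], vector [0, 0, - 1]]"
      have PNP: "transpose P ** N ** P = G'"
      proof (rule diagonal_form_dual)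
        show "P ** G ** transpose P = N"
          using f p pq q
          by (simp add: vec_eq_iff forall_3 matrix_matrix_mult_def sum_3 transpose_def P_def G_def N_def algebra_simps)
        show "N ** N = mat 1"
          using KK by (simp add: vec_eq_iff forall_3 matrix_matrix_mult_def sum_3 N_def mat_def)
        show "G' ** G = mat 1"
          using inv s KK by (simp add: vec_eq_iff forall_3 matrix_matrix_mult_def sum_3 G_def G'_def mat_def)
      qed
      \<comment> \<open>Slot 1 of the 3 by 3 matrices carries function values, so coordinate index
        \<open>i\<close> sits in slot \<open>i + 1\<close>.\<close>
      define e :: "2 \<Rightarrow> 3" where "e i = (if i = 1 then 2 else 3)" for i
      have "g x $ i $ j = G' $ e i $ e j"
        using exhaust_2[of i] exhaust_2[of j] s by (auto simp: G'_def e_def)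
      also have "\<dots> = K * (partial_deriv i h0 x * partial_deriv j h0 x) + partial_deriv i h1 x * partial_deriv j h1 x - partial_deriv i h2 x * partial_deriv j h2 x"
        unfolding PNP[symmetric] using exhaust_2[of i] exhaust_2[of j]
        by (auto simp: matrix_matrix_mult_def sum_3 transpose_def P_def N_def e_def algebra_simps)
      finally have 1: "g x $ i $ j = \<dots>" .
      have "(transpose P ** N ** P) $ 1 $ 1 = K" by (simp add: PNP G'_def)
      then have "K * (h0 x)\<^sup>2 + (h1 x)\<^sup>2 - (h2 x)\<^sup>2 = K"
        by (simp add: matrix_matrix_mult_def sum_3 transpose_def P_def N_def power2_eq_square algebra_simps)
      then have "(h0 x)\<^sup>2 = 1 - K * ((h1 x)\<^sup>2 - (h2 x)\<^sup>2)" using K01 False by (auto simp: algebra_simps)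
      with 1 show ?thesis by simp
    qed
  qed
  note main = this
  show thesis
  proof (rule that[of U h0 h1 h2])
    have UV': "U \<subseteq> V" "U \<subseteq> D" using UV by blast+
    then show "smooth_on U h0" using sm smooth_on_subset by blast
    show "obata K U h1" "obata K U h2"
      using h1(1) h2(1) U(1) UV' smooth_on_subset unfolding obata_def by blast+
    show "inj_on (\<lambda>x. vector [h1 x, h2 x] :: real^2) U" using inj by (simp add: H_def[abs_def])
  qed (use U UV main in \<open>auto simp: W_def\<close>)
qed

end

subsection \<open>From immersions to local isometries\<close>

lemma bounded_bilinear_pseudo_inner: "bounded_bilinear (pseudo_inner s :: real^'n::{finite,ring_1} \<Rightarrow> real^'n::{finite,ring_1} \<Rightarrow> real)"
  unfolding bilinear_conv_bounded_bilinear[symmetric] bilinear_def linear_iff pseudo_inner_def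
  by (auto simp: sum.distrib sum_distrib_left algebra_simps)

text \<open>Both sides of an isometry are later written as Gram matrices of the partial derivatives
  of maps into the ambient space; this is their transformation law under a change of
  parameters.\<close>

lemma pseudo_inner_pullback:
  fixes F :: "real^'k \<Rightarrow> real^'n::{finite,ring_1}" and \<tau> :: "real^'l \<Rightarrow> real^'k"
  assumes F: "(F has_derivative F') (at (\<tau> x))" and \<tau>: "(\<tau> has_derivative \<tau>') (at x)"
  shows "(\<chi> i j. pseudo_inner s (partial_deriv i (F \<circ> \<tau>) x) (partial_deriv j (F \<circ> \<tau>) x))
    = transpose (jacobian_at \<tau> x) ** (\<chi> a b. pseudo_inner s (partial_deriv a F (\<tau> x)) (partial_deriv b F (\<tau> x))) ** jacobian_at \<tau> x"
proof -
  have J: "jacobian_at \<tau> x $ a $ i = \<tau>' (axis i 1) $ a" for a i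
    by (simp add: jacobian_at_def matrix_def frechet_derivative_at[OF \<tau>, symmetric])
  have "((F \<circ> \<tau>) has_derivative (F' \<circ> \<tau>')) (at x)"
    by (rule diff_chain_at[OF \<tau> F])
  then have p: "partial_deriv i (F \<circ> \<tau>) x = (\<Sum>a\<in>UNIV. jacobian_at \<tau> x $ a $ i *\<^sub>R partial_deriv a F (\<tau> x))" for i
    using partial_deriv_eqI has_derivative_partial_deriv[OF F, of "\<tau>' (axis i 1)"] by (force simp: J)
  interpret bounded_bilinear "pseudo_inner s :: real^'n::{finite,ring_1} \<Rightarrow> real^'n::{finite,ring_1} \<Rightarrow> real"
    by (rule bounded_bilinear_pseudo_inner)
  show ?thesis
    by (simp add: vec_eq_iff p matrix_matrix_mult_def transpose_def sum_left sum_right scaleR_left scaleR_right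
        sum_distrib_left sum_distrib_right mult_ac)
qed

text \<open>A patch of the model that is a graph: \<open>\<sigma>\<close> parametrizes it and a
  projection \<open>\<pi>\<close> reads the parameters off. Since \<open>\<pi>\<close> is linear on
  the ambient space, it composes smoothly with every regular parametrization of the model.\<close>

locale model_chart =
  fixes S :: "(real^'m::{finite,ring_1}) set" and \<Omega> :: "(real^2) set"
    and \<sigma> :: "real^2 \<Rightarrow> real^'m::{finite,ring_1}" and \<pi> :: "real^'m::{finite,ring_1} \<Rightarrow> real^2"
  assumes open_\<Omega>: "open \<Omega>" and smooth_\<sigma>: "smooth_on \<Omega> \<sigma>" and linear_\<pi>: "bounded_linear \<pi>"
    and \<pi>_\<sigma>: "z \<in> \<Omega> \<Longrightarrow> \<pi> (\<sigma> z) = z" and openin_\<sigma>: "openin (top_of_set S) (\<sigma> ` \<Omega>)"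
begin

lemma openin_\<sigma>_image:
  assumes "open Z" "Z \<subseteq> \<Omega>"
  shows "openin (top_of_set S) (\<sigma> ` Z)"
proof -
  have "\<sigma> ` Z = \<sigma> ` \<Omega> \<inter> \<pi> -` Z" using assms(2) \<pi>_\<sigma> by force
  moreover have "openin (top_of_set (\<sigma> ` \<Omega>)) (\<sigma> ` \<Omega> \<inter> \<pi> -` Z)"
    using continuous_openin_preimage_gen linear_\<pi> assms(1) linear_continuous_on by blast
  ultimately show ?thesis using openin_\<sigma> openin_trans by metis
qed

text \<open>A chart of the model read in the coordinates \<open>\<pi>\<close> is the inverse of \<open>\<pi> \<circ> \<xi>\<close>, where \<open>\<xi>\<close> is its
  regular parametrization.\<close>

lemma smooth_chart_\<sigma>:
  assumes c: "(E, \<psi>) \<in> atlas (induced_geometry s S :: (real^'m::{finite,ring_1}, 2) geometry)"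
  shows "open {z \<in> \<Omega>. \<sigma> z \<in> E}" "smooth_on {z \<in> \<Omega>. \<sigma> z \<in> E} (\<lambda>z. \<psi> (\<sigma> z))"
proof -
  have chart: "is_chart (top_of_set S) (E, \<psi>)" and sm\<xi>: "smooth_on (\<psi> ` E) (inv_into E \<psi>)"
    and inj\<xi>: "\<And>x. x \<in> \<psi> ` E \<Longrightarrow> inj (frechet_derivative (inv_into E \<psi>) (at x))"
    using c by (auto simp: induced_geometry_def)
  note E = is_chartD[OF chart]
  define E' where "E' = \<psi> ` (E \<inter> \<sigma> ` \<Omega>)"
  define \<theta> where "\<theta> w = \<pi> (inv_into E \<psi> w)" for w
  have oE': "open E'" unfolding E'_def by (rule E(4)) (auto intro: openin_Int E(1) openin_\<sigma>)
  have E'sub: "E' \<subseteq> \<psi> ` E" by (auto simp: E'_def)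
  have sm\<theta>: "smooth_on E' \<theta>"
    unfolding \<theta>_def by (rule smooth_on_bounded_linear[OF linear_\<pi> oE' smooth_on_subset[OF sm\<xi> E'sub]])
  have \<xi>: "inv_into E \<psi> w \<in> E \<inter> \<sigma> ` \<Omega>" "\<psi> (inv_into E \<psi> w) = w" "\<sigma> (\<theta> w) = inv_into E \<psi> w" "\<theta> w \<in> \<Omega>" if "w \<in> E'" for w
    using that E(3) \<pi>_\<sigma> by (auto simp: E'_def \<theta>_def inv_into_f_f)
  have inj\<theta>: "inj_on \<theta> E'"
    using \<xi>(2,3) by (metis inj_onI)
  \<comment> \<open>The immersion \<open>inv_into E \<psi>\<close> factors near \<open>w\<close> as
    \<open>\<sigma>\<close> after \<open>\<theta>\<close>, so the differential of
    \<open>\<theta>\<close> is injective.\<close>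
  have det\<theta>: "det (jacobian_at \<theta> w) \<noteq> 0" if w: "w \<in> E'" for w
  proof -
    have lin: "linear (frechet_derivative \<theta> (at w))" by (rule frechet_derivative_linear[OF sm\<theta> w])
    have "((\<lambda>w. \<sigma> (\<theta> w)) has_derivative (\<lambda>v. frechet_derivative \<sigma> (at (\<theta> w)) (frechet_derivative \<theta> (at w) v))) (at w)"
      by (rule has_derivative_compose[OF smooth_onD(1)[OF sm\<theta> w] smooth_onD(1)[OF smooth_\<sigma> \<xi>(4)[OF w]]])
    then have "(inv_into E \<psi> has_derivative (\<lambda>v. frechet_derivative \<sigma> (at (\<theta> w)) (frechet_derivative \<theta> (at w) v))) (at w)"
      by (rule has_derivative_transform_within_open[OF _ oE' w]) (rule \<xi>(3))
    then have "frechet_derivative (inv_into E \<psi>) (at w) = (\<lambda>v. frechet_derivative \<sigma> (at (\<theta> w)) (frechet_derivative \<theta> (at w) v))"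
      by (simp add: frechet_derivative_at[symmetric])
    then have "inj (\<lambda>v. frechet_derivative \<sigma> (at (\<theta> w)) (frechet_derivative \<theta> (at w) v))"
      using inj\<xi>[of w] w E'sub by auto
    then have "inj (frechet_derivative \<theta> (at w))"
      by (metis (no_types, lifting) injD injI)
    then show ?thesis unfolding jacobian_at_def using det_nz_iff_inj[OF lin] by simp
  qed
  note inv = smooth_inverse_function[OF oE' sm\<theta> inj\<theta> det\<theta>]
  have img: "\<theta> ` E' = {z \<in> \<Omega>. \<sigma> z \<in> E}"
  proof (intro equalityI subsetI)
    fix z assume "z \<in> {z \<in> \<Omega>. \<sigma> z \<in> E}"
    then have "\<psi> (\<sigma> z) \<in> E'" "\<theta> (\<psi> (\<sigma> z)) = z" using E(3) \<pi>_\<sigma> by (auto simp: E'_def \<theta>_def)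
    then show "z \<in> \<theta> ` E'" by (metis imageI)
  qed (use \<xi> in auto)
  show "open {z \<in> \<Omega>. \<sigma> z \<in> E}" using inv(1) img by simp
  have "smooth_on (\<theta> ` E') (\<lambda>z. \<psi> (\<sigma> z))"
  proof (rule smooth_on_cong[OF inv(1) _ inv(2)])
    fix z assume "z \<in> \<theta> ` E'"
    then obtain w where w: "w \<in> E'" "z = \<theta> w" by auto
    then show "inv_into E' \<theta> z = \<psi> (\<sigma> z)" using inj\<theta> \<xi> by simp
  qed
  then show "smooth_on {z \<in> \<Omega>. \<sigma> z \<in> E} (\<lambda>z. \<psi> (\<sigma> z))" using img by simp
qed

text \<open>The isometry is \<open>\<sigma>\<close> after \<open>H\<close> after
  \<open>\<phi>\<close>. The atlas of the model contains all its regular parametrizations, so the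
  conditions concern arbitrary pairs of charts; each is reduced to the one chart
  \<open>\<phi>\<close> and to the parameters read by \<open>\<pi>\<close>.\<close>

theorem isometry_betweenI:
  fixes M :: "('a, 2) geometry"
  assumes M: "pseudo_riemannian M k" and c: "(C, \<phi>) \<in> atlas M"
    and U0: "open U0" "U0 \<subseteq> \<phi> ` C" and H: "smooth_on U0 H" "inj_on H U0" "H ` U0 \<subseteq> \<Omega>"
    and detH: "\<And>x. x \<in> U0 \<Longrightarrow> det (jacobian_at H x) \<noteq> 0"
    and met: "\<And>x i j. x \<in> U0 \<Longrightarrow> metric M (C, \<phi>) x $ i $ j =
      pseudo_inner s (partial_deriv i (\<lambda>x. \<sigma> (H x)) x) (partial_deriv j (\<lambda>x. \<sigma> (H x)) x)"
  obtains V f where "openin (top_of_set S) V"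
    "isometry_between M (induced_geometry s S) {p \<in> C. \<phi> p \<in> U0} V f"
proof -
  let ?N = "induced_geometry s S :: (real^'m::{finite,ring_1}, 2) geometry"
  note sm = smooth_manifoldD[OF pseudo_riemannianD(1)[OF M]]
  note C = is_chartD[OF sm(2)[OF c]]
  define U where "U = {p \<in> C. \<phi> p \<in> U0}"
  define f where "f p = \<sigma> (H (\<phi> p))" for p
  define V where "V = \<sigma> ` (H ` U0)"
  note invH = smooth_inverse_function[OF U0(1) H(1,2) detH]
  have oU: "openin (mtop M) U" unfolding U_def by (rule C(5)[OF U0(1)])
  have UC: "U \<subseteq> C" by (auto simp: U_def)
  have \<phi>U: "\<phi> ` U = U0" using U0(2) by (auto simp: U_def)
  have oV: "openin (top_of_set S) V" unfolding V_def by (rule openin_\<sigma>_image[OF invH(1) H(3)])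
  have VS: "V \<subseteq> S" using openin_imp_subset[OF oV] .
  have H\<Omega>: "H (\<phi> p) \<in> \<Omega>" if "p \<in> U" for p using that H(3) by (auto simp: U_def)
  have \<pi>f: "\<pi> (f p) = H (\<phi> p)" if "p \<in> U" for p using H\<Omega>[OF that] by (simp add: f_def \<pi>_\<sigma>)
  have injf: "inj_on f U"
  proof (rule inj_onI)
    fix p q assume pq: "p \<in> U" "q \<in> U" "f p = f q"
    then have "H (\<phi> p) = H (\<phi> q)" using \<pi>f by metis
    then have "\<phi> p = \<phi> q" using pq H(2) by (auto simp: U_def inj_on_def)
    then show "p = q" using pq C(3) by (auto simp: U_def inj_on_def)
  qed
  have fU: "f ` U = V" unfolding V_def \<phi>U[symmetric] by (auto simp: f_def)
  \<comment> \<open>The inverse undoes the three factors in turn: \<open>\<pi>\<close> undoes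
    \<open>\<sigma>\<close>, then come the inverses of \<open>H\<close> and of
    \<open>\<phi>\<close>.\<close>
  define fi where "fi q = inv_into C \<phi> (inv_into U0 H (\<pi> q))" for q
  have fi: "inv_into U f q = fi q" "fi q \<in> U" "f (fi q) = q" "\<phi> (fi q) = inv_into U0 H (\<pi> q)" "\<pi> q \<in> H ` U0" if "q \<in> V" for q
  proof -
    have "q \<in> f ` U" using that fU by simp
    then obtain p where p: "p \<in> U" "q = f p" by blast
    then have "fi q = p" using H(2) C(3) by (auto simp: fi_def \<pi>f U_def)
    then show "inv_into U f q = fi q" "fi q \<in> U" "f (fi q) = q" "\<pi> q \<in> H ` U0" using p injf \<pi>f by (auto simp: U_def)
    show "\<phi> (fi q) = inv_into U0 H (\<pi> q)" using \<open>fi q = p\<close> p H(2) by (auto simp: \<pi>f U_def)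
  qed
  have top: "topspace (subtopology (mtop M) U) = U"
    using openin_subset[OF oU] by auto
  have contf: "continuous_map (subtopology (mtop M) U) (top_of_set S) f"
  proof -
    have 1: "continuous_map (subtopology (mtop M) U) (top_of_set U0) \<phi>"
      using continuous_map_from_subtopology_mono[OF C(6) UC] top by (auto simp: continuous_map_in_subtopology U_def)
    have "continuous_on U0 (\<lambda>x. \<sigma> (H x))"
      by (rule continuous_on_compose2[OF smooth_onD(3)[OF smooth_\<sigma>] smooth_onD(3)[OF H(1)] H(3)])
    then have "continuous_map (top_of_set U0) (top_of_set S) (\<lambda>x. \<sigma> (H x))"
      using VS by (auto simp: continuous_map_in_subtopology V_def)
    from continuous_map_compose[OF 1 this] show ?thesis by (simp add: o_def f_def[abs_def])
  qed
  have contfi: "continuous_map (subtopology (top_of_set S) V) (mtop M) (inv_into U f)"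
  proof -
    have "continuous_on V (\<lambda>q. inv_into U0 H (\<pi> q))"
      using fi(5) by (intro continuous_on_compose2[OF smooth_onD(3)[OF invH(2)] linear_continuous_on[OF linear_\<pi>]]) auto
    then have 1: "continuous_map (top_of_set V) (top_of_set (\<phi> ` C)) (\<lambda>q. inv_into U0 H (\<pi> q))"
      using inv_into_into[OF fi(5)] U0(2) by (auto simp: continuous_map_in_subtopology)
    have "subtopology (top_of_set S) V = top_of_set V"
      using VS by (simp add: subtopology_subtopology Int_absorb1)
    then show ?thesis
      using continuous_map_compose[OF 1 C(7)] fi(1) by (auto simp: o_def fi_def intro: continuous_map_eq)
  qed
  have trans: "smooth_on (\<phi>' ` (U \<inter> C')) (\<lambda>x. \<phi> (inv_into C' \<phi>' x))" "open (\<phi>' ` (U \<inter> C'))" if "(C', \<phi>') \<in> atlas M" for C' \<phi>'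
    using smooth_on_subset[OF sm(4)[OF that c], of "\<phi>' ` (U \<inter> C')"] UC is_chartD(1,4)[OF sm(2)[OF that]] oU
    by (auto simp: o_def)
  have smf: "smooth_on (\<phi>' ` {p \<in> U \<inter> C'. f p \<in> E}) (\<psi> \<circ> f \<circ> inv_into C' \<phi>')" "open (\<phi>' ` {p \<in> U \<inter> C'. f p \<in> E})"
    if c': "(C', \<phi>') \<in> atlas M" and e: "(E, \<psi>) \<in> atlas ?N" for C' \<phi>' E \<psi>
  proof -
    let ?Z = "{z \<in> \<Omega>. \<sigma> z \<in> E}"
    note C' = is_chartD[OF sm(2)[OF c']] and Z = smooth_chart_\<sigma>[OF e]
    define T where "T = {p \<in> U \<inter> C'. f p \<in> E}"
    have eq: "T = {p \<in> C. \<phi> p \<in> U0 \<inter> H -` ?Z} \<inter> C'"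
      using H\<Omega> by (auto simp: T_def U_def f_def)
    have op: "open (U0 \<inter> H -` ?Z)"
      using continuous_open_preimage[OF smooth_onD(3)[OF H(1)] U0(1) Z(1)] .
    have oT: "openin (mtop M) T" unfolding eq by (rule openin_Int[OF C(5)[OF op] C'(1)])
    show 1: "open (\<phi>' ` {p \<in> U \<inter> C'. f p \<in> E})" using C'(4)[OF oT] by (auto simp: T_def)
    have T: "inv_into C' \<phi>' x \<in> T" if "x \<in> \<phi>' ` T" for x
      using that C'(3) by (auto simp: T_def)
    have "smooth_on (\<phi>' ` T) (\<lambda>x. \<phi> (inv_into C' \<phi>' x))"
      by (rule smooth_on_subset[OF trans(1)[OF c']]) (auto simp: T_def)
    moreover have "(\<lambda>x. \<phi> (inv_into C' \<phi>' x)) ` \<phi>' ` T \<subseteq> U0" using T by (auto simp: T_def U_def)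
    ultimately have "smooth_on (\<phi>' ` T) (\<lambda>x. H (\<phi> (inv_into C' \<phi>' x)))"
      using smooth_on_compose[OF _ U0(1) H(1)] 1 by (simp add: T_def)
    moreover have "(\<lambda>x. H (\<phi> (inv_into C' \<phi>' x))) ` \<phi>' ` T \<subseteq> ?Z" using T H\<Omega> by (auto simp: T_def f_def)
    ultimately have "smooth_on (\<phi>' ` T) (\<lambda>x. \<psi> (\<sigma> (H (\<phi> (inv_into C' \<phi>' x)))))"
      using smooth_on_compose[OF _ Z(1,2)] 1 by (simp add: T_def)
    then show "smooth_on (\<phi>' ` {p \<in> U \<inter> C'. f p \<in> E}) (\<psi> \<circ> f \<circ> inv_into C' \<phi>')"
      by (simp add: T_def o_def f_def)
  qed
  have smfi: "smooth_on (\<psi> ` {q \<in> V \<inter> E. inv_into U f q \<in> C'}) (\<phi>' \<circ> inv_into U f \<circ> inv_into E \<psi>)"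
    if c': "(C', \<phi>') \<in> atlas M" and e: "(E, \<psi>) \<in> atlas ?N" for C' \<phi>' E \<psi>
  proof -
    have chart: "is_chart (top_of_set S) (E, \<psi>)" and sm\<xi>: "smooth_on (\<psi> ` E) (inv_into E \<psi>)"
      using e by (auto simp: induced_geometry_def)
    note C' = is_chartD[OF sm(2)[OF c']] and E = is_chartD[OF chart]
    define T where "T = {q \<in> V \<inter> E. inv_into U f q \<in> C'}"
    have oCC: "open (\<phi> ` (U \<inter> C'))" using C(4)[of "U \<inter> C'"] oU C'(1) UC by auto
    have subU0: "\<phi> ` (U \<inter> C') \<subseteq> U0" using \<phi>U by blast
    have "open (H ` \<phi> ` (U \<inter> C'))"
      using invariance_of_domain[of "\<phi> ` (U \<inter> C')" H] oCC subU0 H(2) smooth_onD(3)[OF H(1)]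
      by (meson continuous_on_subset inj_on_subset)
    then have "openin (top_of_set S) (\<sigma> ` H ` \<phi> ` (U \<inter> C'))"
      by (rule openin_\<sigma>_image) (use H(3) subU0 in blast)
    moreover have "T = (\<sigma> ` H ` \<phi> ` (U \<inter> C')) \<inter> E"
    proof -
      have "\<sigma> ` H ` \<phi> ` (U \<inter> C') = {q \<in> V. inv_into U f q \<in> C'}"
        using injf fi unfolding fU[symmetric] by (auto simp: image_image f_def[symmetric])
      then show ?thesis by (auto simp: T_def)
    qed
    ultimately have oT: "open (\<psi> ` T)" using E(1) by (intro E(4)) auto
    have T: "inv_into E \<psi> x \<in> T" if "x \<in> \<psi> ` T" for x
      using that E(3) by (auto simp: T_def)
    have "smooth_on (\<psi> ` T) (\<lambda>x. \<pi> (inv_into E \<psi> x))"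
      by (rule smooth_on_bounded_linear[OF linear_\<pi> oT smooth_on_subset[OF sm\<xi>]]) (auto simp: T_def)
    moreover have "(\<lambda>x. \<pi> (inv_into E \<psi> x)) ` \<psi> ` T \<subseteq> H ` U0" using T fi(5) by (auto simp: T_def)
    ultimately have "smooth_on (\<psi> ` T) (\<lambda>x. inv_into U0 H (\<pi> (inv_into E \<psi> x)))"
      using smooth_on_compose[OF oT invH(1) invH(2)] by blast
    moreover have "(\<lambda>x. inv_into U0 H (\<pi> (inv_into E \<psi> x))) ` \<psi> ` T \<subseteq> \<phi> ` (U \<inter> C')"
    proof clarify
      fix x assume "x \<in> T"
      then have "inv_into E \<psi> (\<psi> x) = x" "x \<in> V" "fi x \<in> U \<inter> C'" using E(3) fi by (auto simp: T_def)
      then show "inv_into U0 H (\<pi> (inv_into E \<psi> (\<psi> x))) \<in> \<phi> ` (U \<inter> C')"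
        using fi(4)[of x] by (metis imageI)
    qed
    moreover have "smooth_on (\<phi> ` (U \<inter> C')) (\<phi>' \<circ> inv_into C \<phi>)"
      by (rule smooth_on_subset[OF sm(4)[OF c c']]) (use UC in auto)
    ultimately have "smooth_on (\<psi> ` T) (\<lambda>x. (\<phi>' \<circ> inv_into C \<phi>) (inv_into U0 H (\<pi> (inv_into E \<psi> x))))"
      using smooth_on_compose[OF oT oCC] by blast
    then have "smooth_on (\<psi> ` T) (\<phi>' \<circ> inv_into U f \<circ> inv_into E \<psi>)"
      by (rule smooth_on_cong[OF oT, rotated]) (use T fi(1) in \<open>auto simp: T_def fi_def\<close>)
    then show ?thesis by (simp add: T_def)
  qed
  have isom: "metric M (C', \<phi>') (\<phi>' p) = transpose (jacobian_at (\<psi> \<circ> f \<circ> inv_into C' \<phi>') (\<phi>' p))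
        ** metric ?N (E, \<psi>) (\<psi> (f p)) ** jacobian_at (\<psi> \<circ> f \<circ> inv_into C' \<phi>') (\<phi>' p)"
    if c': "(C', \<phi>') \<in> atlas M" and e: "(E, \<psi>) \<in> atlas ?N" and p: "p \<in> U \<inter> C'" "f p \<in> E" for C' \<phi>' E \<psi> p
  proof -
    note C' = is_chartD[OF sm(2)[OF c']]
    have chart: "is_chart (top_of_set S) (E, \<psi>)" and sm\<xi>: "smooth_on (\<psi> ` E) (inv_into E \<psi>)"
      using e by (auto simp: induced_geometry_def)
    define x where "x = \<phi>' p"
    define \<rho> where "\<rho> = \<psi> \<circ> f \<circ> inv_into C' \<phi>'"
    define \<tau> where "\<tau> = \<phi> \<circ> inv_into C' \<phi>'"
    define F where "F = (\<lambda>x. \<sigma> (H x))"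
    have pU: "p \<in> U" "p \<in> C" "\<phi> p \<in> U0" using p by (auto simp: U_def)
    have x: "inv_into C' \<phi>' x = p" "x \<in> \<phi>' ` {p \<in> U \<inter> C'. f p \<in> E}" "x \<in> \<phi>' ` (U \<inter> C')" using p C'(3) by (auto simp: x_def)
    have d\<rho>: "(\<rho> has_derivative frechet_derivative \<rho> (at x)) (at x)"
      unfolding \<rho>_def by (rule smooth_onD(1)[OF smf(1)[OF c' e] x(2)])
    have d\<tau>: "(\<tau> has_derivative frechet_derivative \<tau> (at x)) (at x)"
      using smooth_onD(1)[OF trans(1)[OF c'] x(3)] by (simp add: \<tau>_def o_def)
    have \<rho>x: "\<rho> x = \<psi> (f p)" "\<tau> x = \<phi> p" by (simp_all add: \<rho>_def \<tau>_def x)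
    have d\<xi>: "(inv_into E \<psi> has_derivative frechet_derivative (inv_into E \<psi>) (at (\<rho> x))) (at (\<rho> x))"
      by (rule smooth_onD(1)[OF sm\<xi>]) (use p \<rho>x in auto)
    have "smooth_on U0 F" unfolding F_def by (rule smooth_on_compose[OF U0(1) open_\<Omega> smooth_\<sigma> H(1,3)])
    then have dF: "(F has_derivative frechet_derivative F (at (\<tau> x))) (at (\<tau> x))"
      by (rule smooth_onD(1)) (use pU \<rho>x in auto)
    \<comment> \<open>Both composites express the same map \<open>f\<close> into the ambient space
      in the coordinates \<open>\<phi>'\<close>, once through the chart of the model and once
      through \<open>\<phi>\<close>.\<close>
    have eq: "partial_deriv i (inv_into E \<psi> \<circ> \<rho>) x = partial_deriv i (F \<circ> \<tau>) x" for i
    proof (rule partial_deriv_cong[OF smf(2)[OF c' e] x(2)])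
      fix y assume "y \<in> \<phi>' ` {p \<in> U \<inter> C'. f p \<in> E}"
      then obtain q where "q \<in> U \<inter> C'" "f q \<in> E" "y = \<phi>' q" by auto
      then show "(inv_into E \<psi> \<circ> \<rho>) y = (F \<circ> \<tau>) y"
        using C'(3) is_chartD(3)[OF chart] by (auto simp: \<rho>_def \<tau>_def F_def f_def)
    qed
    have "transpose (jacobian_at \<rho> x) ** metric ?N (E, \<psi>) (\<psi> (f p)) ** jacobian_at \<rho> x
      = (\<chi> i j. pseudo_inner s (partial_deriv i (inv_into E \<psi> \<circ> \<rho>) x) (partial_deriv j (inv_into E \<psi> \<circ> \<rho>) x))"
      unfolding pseudo_inner_pullback[OF d\<xi> d\<rho>] by (simp add: induced_geometry_def \<rho>x)
    also have "\<dots> = (\<chi> i j. pseudo_inner s (partial_deriv i (F \<circ> \<tau>) x) (partial_deriv j (F \<circ> \<tau>) x))"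
      unfolding eq ..
    also have "\<dots> = transpose (jacobian_at \<tau> x) ** metric M (C, \<phi>) (\<phi> p) ** jacobian_at \<tau> x"
    proof -
      have "metric M (C, \<phi>) (\<phi> p) = (\<chi> a b. pseudo_inner s (partial_deriv a F (\<tau> x)) (partial_deriv b F (\<tau> x)))"
        using met[OF pU(3)] by (simp add: vec_eq_iff \<rho>x F_def)
      then show ?thesis unfolding pseudo_inner_pullback[OF dF d\<tau>] by simp
    qed
    also have "\<dots> = metric M (C', \<phi>') (\<phi>' p)"
      using pseudo_riemannianD(6)[OF M c' c, of p] p pU by (simp add: \<tau>_def x_def)
    finally show ?thesis by (simp add: \<rho>_def x_def)
  qed
  have "isometry_between M ?N U V f"
    unfolding isometry_between_def smooth_map_on_def Let_def
    using injf fU contf contfi smf(1) smfi isom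
    by (auto simp: bij_betw_def induced_geometry_def)
  then show thesis using that oV by (simp add: U_def)
qed

end

subsection \<open>The model surfaces\<close>

lemma pseudo_inner_2: "pseudo_inner 1 (x :: real^2) y = x $ 1 * y $ 1 - x $ 2 * y $ 2"
proof -
  have "sum f {Suc (Suc 0)..2} = f 2" for f :: "nat \<Rightarrow> real"
    by (simp add: numeral_2_eq_2)
  then show ?thesis by (simp add: pseudo_inner_def)
qed

lemma pseudo_inner_3_1: "pseudo_inner 1 (x :: real^3) y = x $ 1 * y $ 1 + x $ 2 * y $ 2 - x $ 3 * y $ 3"
proof -
  have "{1..CARD(3) - 1} = {1, 2}" "{CARD(3) - 1 + 1..CARD(3)} = {3}" by auto
  then show ?thesis unfolding pseudo_inner_def by simp
qed

lemma pseudo_inner_3_2: "pseudo_inner 2 (x :: real^3) y = x $ 1 * y $ 1 - x $ 2 * y $ 2 - x $ 3 * y $ 3"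
proof -
  have "{1..CARD(3) - 2} = {1}" "{CARD(3) - 2 + 1..CARD(3)} = {2, 3}" by auto
  then show ?thesis unfolding pseudo_inner_def by simp
qed

lemmas pseudo_inner_simps = pseudo_inner_2 pseudo_inner_3_1 pseudo_inner_3_2
  pseudo_inner_2[unfolded One_nat_def] pseudo_inner_3_1[unfolded One_nat_def]

lemma lorentz_surface_chart:
  assumes M: "lorentz_surface M" and c: "(C, \<phi>) \<in> atlas M"
  shows "metric2 (metric M (C, \<phi>)) (\<phi> ` C)" "x \<in> \<phi> ` C \<Longrightarrow> det (metric M (C, \<phi>) x) < 0"
    "has_constant_curvature M K \<Longrightarrow> metric2.has_curvature (metric M (C, \<phi>)) (\<phi> ` C) K"
proof -
  have M: "pseudo_riemannian M 1" using M by (simp add: lorentz_surface_def)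
  have neg: "det (metric M (C, \<phi>) x) < 0" if "x \<in> \<phi> ` C" for x
    by (rule det_neg_if_index_1[OF pseudo_riemannianD(3,4,5)[OF M c that]])
  then show "x \<in> \<phi> ` C \<Longrightarrow> det (metric M (C, \<phi>) x) < 0" .
  show m: "metric2 (metric M (C, \<phi>)) (\<phi> ` C)"
  proof
    show "open (\<phi> ` C)"
      by (rule is_chartD(2)[OF smooth_manifoldD(2)[OF pseudo_riemannianD(1)[OF M] c]])
    show "smooth_on (\<phi> ` C) (metric M (C, \<phi>))" by (rule pseudo_riemannianD(2)[OF M c])
    show "transpose (metric M (C, \<phi>) x) = metric M (C, \<phi>) x" if "x \<in> \<phi> ` C" for x
      by (rule pseudo_riemannianD(3)[OF M c that])
    show "det (metric M (C, \<phi>) x) \<noteq> 0" if "x \<in> \<phi> ` C" for x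
      using neg[OF that] by simp
  qed
  show "metric2.has_curvature (metric M (C, \<phi>)) (\<phi> ` C) K" if "has_constant_curvature M K"
    using that c by (auto simp: metric2.has_curvature_def[OF m] has_constant_curvature_def gaussian_curvature_def)
qed

lemma smooth_on_power2:
  fixes f :: "'a::real_normed_vector \<Rightarrow> real"
  shows "open S \<Longrightarrow> smooth_on S f \<Longrightarrow> smooth_on S (\<lambda>x. (f x)\<^sup>2)"
  unfolding power2_eq_square by (rule smooth_on_mult)

text \<open>The ambient vectors have Gram matrix diag(K, 1, -1), so that h0 e0 + h1 e1 + h2 e2
  induces exactly the metric found for the solutions. The hypothesis \<open>emb\<close> says that
  these points lie in the graph patch over (h1, h2).\<close>

lemma (in model_chart) locally_isometricI:
  fixes M :: "('a, 2) geometry"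
  assumes M: "lorentz_surface M" and K: "has_constant_curvature M K" "K \<in> {- 1, 0, 1}"
    and emb: "\<And>a b c. 0 < a \<Longrightarrow> (K \<noteq> 0 \<Longrightarrow> a\<^sup>2 = 1 - K * (b\<^sup>2 - c\<^sup>2)) \<Longrightarrow>
      vector [b, c] \<in> \<Omega> \<and> \<sigma> (vector [b, c]) = a *\<^sub>R e0 + b *\<^sub>R e1 + c *\<^sub>R e2"
    and e: "pseudo_inner s e0 e0 = K" "pseudo_inner s e1 e1 = 1" "pseudo_inner s e2 e2 = - 1"
      "pseudo_inner s e0 e1 = 0" "pseudo_inner s e0 e2 = 0" "pseudo_inner s e1 e2 = 0"
      "pseudo_inner s e1 e0 = 0" "pseudo_inner s e2 e0 = 0" "pseudo_inner s e2 e1 = 0"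
  shows "locally_isometric M (induced_geometry s S)"
  unfolding locally_isometric_def
proof
  fix p assume p: "p \<in> topspace (mtop M)"
  have M1: "pseudo_riemannian M 1" using M by (simp add: lorentz_surface_def)
  note sm = smooth_manifoldD[OF pseudo_riemannianD(1)[OF M1]]
  obtain C \<phi> where c: "(C, \<phi>) \<in> atlas M" and pC: "p \<in> C" using sm(3)[OF p] by blast
  interpret G: metric2 "metric M (C, \<phi>)" "\<phi> ` C" by (rule lorentz_surface_chart(1)[OF M c])
  have x0: "\<phi> p \<in> \<phi> ` C" using pC by simp
  obtain U h0 h1 h2 where U2: "\<phi> p \<in> U" and smh0: "smooth_on U h0" and ob: "G.obata K U h1" "G.obata K U h2"
    and inj: "inj_on (\<lambda>x. vector [h1 x, h2 x] :: real^2) U"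
    and W: "\<And>x. x \<in> U \<Longrightarrow> partial_deriv 1 h1 x * partial_deriv 2 h2 x - partial_deriv 2 h1 x * partial_deriv 1 h2 x \<noteq> 0"
    and g: "\<And>x i j. x \<in> U \<Longrightarrow> metric M (C, \<phi>) x $ i $ j = K * (partial_deriv i h0 x * partial_deriv j h0 x)
        + partial_deriv i h1 x * partial_deriv j h1 x - partial_deriv i h2 x * partial_deriv j h2 x"
    and h0: "\<And>x. x \<in> U \<Longrightarrow> h0 x > 0" "\<And>x. x \<in> U \<Longrightarrow> K \<noteq> 0 \<Longrightarrow> (h0 x)\<^sup>2 = 1 - K * ((h1 x)\<^sup>2 - (h2 x)\<^sup>2)"
    using G.obata_immersion_exists[OF lorentz_surface_chart(3)[OF M c K(1)] K(2) x0 lorentz_surface_chart(2)[OF M c x0]]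
    by blast
  have U: "open U" "\<phi> p \<in> U" "U \<subseteq> \<phi> ` C" using ob U2 by (auto simp: G.obata_def)
  have smh: "smooth_on U h0" "smooth_on U h1" "smooth_on U h2" using ob smh0 by (auto simp: G.obata_def)
  define H where "H x = (vector [h1 x, h2 x] :: real^2)" for x
  have smH: "smooth_on U H"
    unfolding H_def[abs_def] by (rule smooth_on_vector_2) (rule U(1) smh)+
  have jH: "jacobian_at H x $ 1 $ i = partial_deriv i h1 x" "jacobian_at H x $ 2 $ i = partial_deriv i h2 x" if "x \<in> U" for x i
    unfolding H_def[abs_def] by (rule jacobian_at_vector_2; rule U(1) smh that)+
  have \<sigma>H: "H x \<in> \<Omega>" "\<sigma> (H x) = h0 x *\<^sub>R e0 + h1 x *\<^sub>R e1 + h2 x *\<^sub>R e2" if "x \<in> U" for x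
    using emb[OF h0[OF that]] by (auto simp: H_def)
  have pd: "partial_deriv i (\<lambda>x. \<sigma> (H x)) x = partial_deriv i h0 x *\<^sub>R e0 + partial_deriv i h1 x *\<^sub>R e1 + partial_deriv i h2 x *\<^sub>R e2"
    if "x \<in> U" for x i
  proof -
    have "((\<lambda>x. h0 x *\<^sub>R e0 + h1 x *\<^sub>R e1 + h2 x *\<^sub>R e2) has_derivative
      (\<lambda>v. frechet_derivative h0 (at x) v *\<^sub>R e0 + frechet_derivative h1 (at x) v *\<^sub>R e1 + frechet_derivative h2 (at x) v *\<^sub>R e2)) (at x)"
      by (intro has_derivative_add has_derivative_scaleR_left smooth_onD(1)[OF _ that] smh)
    from partial_deriv_eqI[OF this, of i] partial_deriv_cong[OF U(1) that \<sigma>H(2), where i = i]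
    show ?thesis by (simp add: partial_deriv_def)
  qed
  interpret B: bounded_bilinear "pseudo_inner s :: real^'m::{finite,ring_1} \<Rightarrow> real^'m::{finite,ring_1} \<Rightarrow> real"
    by (rule bounded_bilinear_pseudo_inner)
  obtain V f where "openin (top_of_set S) V" "isometry_between M (induced_geometry s S) {p \<in> C. \<phi> p \<in> U} V f"
  proof (rule isometry_betweenI[OF M1 c U(1,3) smH])
    show "inj_on H U" using inj by (simp add: H_def[abs_def])
    show "H ` U \<subseteq> \<Omega>" using \<sigma>H by blast
    show "det (jacobian_at H x) \<noteq> 0" if "x \<in> U" for x
      using W[OF that] unfolding det_2 jH[OF that] .
    show "metric M (C, \<phi>) x $ i $ j = pseudo_inner s (partial_deriv i (\<lambda>x. \<sigma> (H x)) x) (partial_deriv j (\<lambda>x. \<sigma> (H x)) x)"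
      if "x \<in> U" for x i j
      unfolding g[OF that] pd[OF that] by (simp add: B.add_left B.add_right B.scaleR_left B.scaleR_right e)
  qed
  then show "\<exists>U V f. openin (mtop M) U \<and> p \<in> U \<and> openin (mtop (induced_geometry s S :: (real^'m::{finite,ring_1}, 2) geometry)) V \<and>
      isometry_between M (induced_geometry s S) U V f"
    using is_chartD(5)[OF sm(2)[OF c] U(1)] pC U(2)
    by (intro exI[of _ "{p \<in> C. \<phi> p \<in> U}"] exI[of _ V] exI[of _ f]) (auto simp: induced_geometry_def)
qed

lemma bounded_linear_vector_2:
  fixes f h :: "'a::real_normed_vector \<Rightarrow> real"
  assumes "bounded_linear f" "bounded_linear h"
  shows "bounded_linear (\<lambda>x. vector [f x, h x] :: real^2)"
  unfolding vector_2_axis using assms by (simp add: bounded_linear_add bounded_linear_scaleR_const)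

lemma smooth_on_vector_3:
  assumes "open S" "smooth_on S f" "smooth_on S g" "smooth_on S h"
  shows "smooth_on S (\<lambda>x. vector [f x, g x, h x] :: real^3)"
proof (rule smooth_on_vec[OF assms(1)])
  show "smooth_on S (\<lambda>x. (vector [f x, g x, h x] :: real^3) $ i)" for i
    using exhaust_3[of i] assms by auto
qed

lemma locally_isometric_minkowski_plane:
  assumes "lorentz_surface M" "has_constant_curvature M 0"
  shows "locally_isometric M minkowski_plane"
proof -
  interpret model_chart UNIV UNIV "\<lambda>z. z" "\<lambda>z :: real^2. z"
    by (rule model_chart.intro) (auto intro: smooth_on_id bounded_linear_ident)
  show ?thesis
    unfolding minkowski_plane_def
    \<comment> \<open>In the flat case \<open>e0 = 0\<close>: the first solution has no counterpart
      in the plane.\<close>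
    by (rule locally_isometricI[OF assms, of 0 "axis 1 1" "axis 2 1"])
      (auto simp: pseudo_inner_simps vec_eq_iff forall_2 axis_def)
qed

lemma smooth_on_hyperboloid_radius:
  fixes k :: real
  shows "open {z :: real^2. 0 < 1 - k * ((z $ 1)\<^sup>2 - (z $ 2)\<^sup>2)}"
    "smooth_on {z :: real^2. 0 < 1 - k * ((z $ 1)\<^sup>2 - (z $ 2)\<^sup>2)} (\<lambda>z. sqrt (1 - k * ((z $ 1)\<^sup>2 - (z $ 2)\<^sup>2)))"
proof -
  let ?\<Omega> = "{z :: real^2. 0 < 1 - k * ((z $ 1)\<^sup>2 - (z $ 2)\<^sup>2)}"
  show o: "open ?\<Omega>"
    by (intro open_Collect_less continuous_intros)
  have 1: "smooth_on ?\<Omega> (\<lambda>z. 1 - k * ((z $ 1)\<^sup>2 - (z $ 2)\<^sup>2))"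
    by (intro smooth_on_diff smooth_on_mult smooth_on_power2 smooth_on_const smooth_on_vec_nth smooth_on_id o)
  show "smooth_on ?\<Omega> (\<lambda>z. sqrt (1 - k * ((z $ 1)\<^sup>2 - (z $ 2)\<^sup>2)))"
    by (rule smooth_on_compose[OF o _ smooth_on_sqrt 1]) (auto simp: open_Collect_less continuous_intros)
qed

text \<open>The half with positive first coordinate is a graph over the other two, whose form has
  signature (1, 1). The spacelike first axis carries \<open>h0\<close>.\<close>

lemma locally_isometric_de_sitter:
  assumes "lorentz_surface M" "has_constant_curvature M 1"
  shows "locally_isometric M de_sitter"
proof -
  \<comment> \<open>The factor 1 is the value of K, left in place so that the radius has the shape
    required by \<open>locally_isometricI\<close>.\<close>
  define r where "r z = sqrt (1 - 1 * ((z $ 1)\<^sup>2 - (z $ 2)\<^sup>2))" for z :: "real^2"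
  define \<Omega> where "\<Omega> = {z :: real^2. 0 < 1 - 1 * ((z $ 1)\<^sup>2 - (z $ 2)\<^sup>2)}"
  define \<sigma> where "\<sigma> z = (vector [r z, z $ 1, z $ 2] :: real^3)" for z
  define S where "S = {x :: real^3. pseudo_inner 1 x x = 1}"
  have img: "\<sigma> ` \<Omega> = S \<inter> {x. 0 < x $ 1}"
  proof (intro equalityI subsetI)
    fix x assume "x \<in> S \<inter> {x. 0 < x $ 1}"
    then have x: "(x $ 1)\<^sup>2 = 1 - 1 * ((x $ 2)\<^sup>2 - (x $ 3)\<^sup>2)" "0 < x $ 1"
      by (auto simp: S_def pseudo_inner_simps power2_eq_square)
    then have "0 < 1 - 1 * ((x $ 2)\<^sup>2 - (x $ 3)\<^sup>2)" by (metis zero_less_power)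
    moreover have "r (vector [x $ 2, x $ 3]) = sqrt ((x $ 1)\<^sup>2)" unfolding x(1) by (simp add: r_def)
    then have "r (vector [x $ 2, x $ 3]) = x $ 1" using x(2) by simp
    ultimately show "x \<in> \<sigma> ` \<Omega>"
      by (intro image_eqI[of _ _ "vector [x $ 2, x $ 3]"]) (auto simp: \<sigma>_def \<Omega>_def vec_eq_iff forall_3)
  qed (auto simp: \<sigma>_def \<Omega>_def S_def r_def pseudo_inner_simps power2_eq_square)
  interpret model_chart S \<Omega> \<sigma> "\<lambda>x. vector [x $ 2, x $ 3]"
  proof (rule model_chart.intro)
    show "open \<Omega>" "smooth_on \<Omega> \<sigma>"
      unfolding \<sigma>_def \<Omega>_def r_def
      by (intro smooth_on_vector_3 smooth_on_hyperboloid_radius smooth_on_vec_nth smooth_on_id)+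
    show "bounded_linear (\<lambda>x. vector [x $ 2, x $ 3] :: real^2)"
      by (intro bounded_linear_vector_2 bounded_linear_vec_nth)
    have "open {x :: real^3. 0 < x $ 1}" by (intro open_Collect_less continuous_intros)
    then show "openin (top_of_set S) (\<sigma> ` \<Omega>)" unfolding img by (rule openin_open_Int)
  qed (simp add: \<sigma>_def vec_eq_iff forall_2)
  have emb: "vector [b, c] \<in> \<Omega> \<and> \<sigma> (vector [b, c]) = a *\<^sub>R axis 1 1 + b *\<^sub>R axis 2 1 + c *\<^sub>R axis 3 1"
    if "0 < a" "1 \<noteq> (0::real) \<Longrightarrow> a\<^sup>2 = 1 - 1 * (b\<^sup>2 - c\<^sup>2)" for a b c :: real
  proof -
    have a: "a\<^sup>2 = 1 - 1 * (b\<^sup>2 - c\<^sup>2)" using that by simp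
    then have "0 < 1 - 1 * (b\<^sup>2 - c\<^sup>2)" using that(1) by (metis zero_less_power)
    moreover have "r (vector [b, c]) = sqrt (a\<^sup>2)" unfolding a by (simp add: r_def)
    then have "r (vector [b, c]) = a" using that(1) by simp
    ultimately show ?thesis by (simp add: \<Omega>_def \<sigma>_def vec_eq_iff forall_3 axis_def)
  qed
  show ?thesis
    unfolding de_sitter_def S_def[symmetric]
    by (rule locally_isometricI[OF assms _ emb])
      (auto simp: pseudo_inner_simps axis_def)
qed

text \<open>Now \<open>h0\<close> must have negative square, so the third, timelike axis carries it
  and the graph lies over the first two coordinates.\<close>

lemma locally_isometric_anti_de_sitter:
  assumes "lorentz_surface M" "has_constant_curvature M (- 1)"
  shows "locally_isometric M anti_de_sitter"
proof -
  define r where "r z = sqrt (1 - (- 1) * ((z $ 1)\<^sup>2 - (z $ 2)\<^sup>2))" for z :: "real^2"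
  define \<Omega> where "\<Omega> = {z :: real^2. 0 < 1 - (- 1) * ((z $ 1)\<^sup>2 - (z $ 2)\<^sup>2)}"
  define \<sigma> where "\<sigma> z = (vector [z $ 1, z $ 2, r z] :: real^3)" for z
  define S where "S = {x :: real^3. pseudo_inner 2 x x = - 1}"
  have img: "\<sigma> ` \<Omega> = S \<inter> {x. 0 < x $ 3}"
  proof (intro equalityI subsetI)
    fix x assume "x \<in> S \<inter> {x. 0 < x $ 3}"
    then have x: "(x $ 3)\<^sup>2 = 1 - (- 1) * ((x $ 1)\<^sup>2 - (x $ 2)\<^sup>2)" "0 < x $ 3"
      by (auto simp: S_def pseudo_inner_simps power2_eq_square)
    then have "0 < 1 - (- 1) * ((x $ 1)\<^sup>2 - (x $ 2)\<^sup>2)" by (metis zero_less_power)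
    moreover have "r (vector [x $ 1, x $ 2]) = sqrt ((x $ 3)\<^sup>2)" unfolding x(1) by (simp add: r_def)
    then have "r (vector [x $ 1, x $ 2]) = x $ 3" using x(2) by simp
    ultimately show "x \<in> \<sigma> ` \<Omega>"
      by (intro image_eqI[of _ _ "vector [x $ 1, x $ 2]"]) (auto simp: \<sigma>_def \<Omega>_def vec_eq_iff forall_3)
  qed (auto simp: \<sigma>_def \<Omega>_def S_def r_def pseudo_inner_simps power2_eq_square)
  interpret model_chart S \<Omega> \<sigma> "\<lambda>x. vector [x $ 1, x $ 2]"
  proof (rule model_chart.intro)
    show "open \<Omega>" "smooth_on \<Omega> \<sigma>"
      unfolding \<sigma>_def \<Omega>_def r_def
      by (intro smooth_on_vector_3 smooth_on_hyperboloid_radius smooth_on_vec_nth smooth_on_id)+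
    show "bounded_linear (\<lambda>x. vector [x $ 1, x $ 2] :: real^2)"
      by (intro bounded_linear_vector_2 bounded_linear_vec_nth)
    have "open {x :: real^3. 0 < x $ 3}" by (intro open_Collect_less continuous_intros)
    then show "openin (top_of_set S) (\<sigma> ` \<Omega>)" unfolding img by (rule openin_open_Int)
  qed (simp add: \<sigma>_def vec_eq_iff forall_2)
  have emb: "vector [b, c] \<in> \<Omega> \<and> \<sigma> (vector [b, c]) = a *\<^sub>R axis 3 1 + b *\<^sub>R axis 1 1 + c *\<^sub>R axis 2 1"
    if "0 < a" "- 1 \<noteq> (0::real) \<Longrightarrow> a\<^sup>2 = 1 - (- 1) * (b\<^sup>2 - c\<^sup>2)" for a b c :: real
  proof -
    have a: "a\<^sup>2 = 1 - (- 1) * (b\<^sup>2 - c\<^sup>2)" using that by simp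
    then have "0 < 1 - (- 1) * (b\<^sup>2 - c\<^sup>2)" using that(1) by (metis zero_less_power)
    moreover have "r (vector [b, c]) = sqrt (a\<^sup>2)" unfolding a by (simp add: r_def)
    then have "r (vector [b, c]) = a" using that(1) by simp
    ultimately show ?thesis by (simp add: \<Omega>_def \<sigma>_def vec_eq_iff forall_3 axis_def)
  qed
  show ?thesis
    unfolding anti_de_sitter_def S_def[symmetric]
    by (rule locally_isometricI[OF assms _ emb])
      (auto simp: pseudo_inner_simps axis_def)
qed

section \<open>Geodesics\<close>

lemma partial_deriv_compose:
  fixes f :: "real^'k \<Rightarrow> real" and \<tau> :: "real^'l \<Rightarrow> real^'k"
  assumes f: "smooth_on T f" and \<tau>: "smooth_on S \<tau>" and x: "x \<in> S" "\<tau> x \<in> T"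
  shows "partial_deriv i (\<lambda>x. f (\<tau> x)) x = (\<Sum>c\<in>UNIV. partial_deriv c f (\<tau> x) * jacobian_at \<tau> x $ c $ i)"
proof -
  have "((\<lambda>x. f (\<tau> x)) has_derivative (\<lambda>v. frechet_derivative f (at (\<tau> x)) (frechet_derivative \<tau> (at x) v))) (at x)"
    by (rule has_derivative_compose[OF smooth_onD(1)[OF \<tau> x(1)] smooth_onD(1)[OF f x(2)]])
  from partial_deriv_eqI[OF this, of i] show ?thesis
    using has_derivative_partial_deriv[OF smooth_onD(1)[OF f x(2)], of "frechet_derivative \<tau> (at x) (axis i 1)"]
    by (simp add: jacobian_at_nth[OF \<tau> x(1)] partial_deriv_def[of i \<tau>] mult.commute)
qed

lemma matrix_vector_mult_eq_0:
  fixes A :: "real^'n^'n"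
  assumes "det A \<noteq> 0" "A *v w = 0"
  shows "w = 0"
  using assms by (metis invertible_det_nz invertible_left_inverse matrix_left_invertible_ker)

context metric2
begin

section \<open>Covariant differentiation along curves\<close>

definition Gam :: "real^2 \<Rightarrow> real^2 \<Rightarrow> real^2 \<Rightarrow> real^2" where
  "Gam x a b = (\<chi> k. \<Sum>i\<in>UNIV. \<Sum>j\<in>UNIV. \<Gamma> k i j x * a $ i * b $ j)"

definition differential :: "(real^2 \<Rightarrow> real) \<Rightarrow> real^2 \<Rightarrow> real^2 \<Rightarrow> real" where
  "differential h x v = (\<Sum>j\<in>UNIV. partial_deriv j h x * v $ j)"

lemma smooth_on_along_curve:
  fixes f :: "real^2 \<Rightarrow> real"
  assumes "smooth_on S f" "X t \<in> S" "(X has_vector_derivative X') (at t)"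
  shows "((\<lambda>t. f (X t)) has_real_derivative differential f (X t) X') (at t)"
proof -
  have "((\<lambda>t. f (X t)) has_derivative (\<lambda>h. \<Sum>i\<in>UNIV. (h *\<^sub>R X') $ i *\<^sub>R partial_deriv i f (X t))) (at t)"
    by (rule has_derivative_compose[OF assms(3)[unfolded has_vector_derivative_def] smooth_on_has_derivative[OF assms(1,2)]])
  then show ?thesis
    unfolding has_field_derivative_def by (rule has_derivative_eq_rhs) (auto simp: differential_def sum_2 algebra_simps)
qed

lemma vec_nth_derivative: "(V has_vector_derivative V') F \<Longrightarrow> ((\<lambda>t. V t $ i) has_real_derivative V' $ i) F"
  unfolding has_real_derivative_iff_has_vector_derivative
  by (rule bounded_linear.has_vector_derivative[OF bounded_linear_vec_nth])

lemma form_g: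
  "x \<in> D \<Longrightarrow> form (g x) v w = g x $ 1 $ 1 * v $ 1 * w $ 1 + g x $ 1 $ 2 * (v $ 1 * w $ 2 + v $ 2 * w $ 1) + g x $ 2 $ 2 * v $ 2 * w $ 2"
  by (simp add: form_2 g_sym[of x 2 1] algebra_simps)

lemma form_commute: "x \<in> D \<Longrightarrow> form (g x) v w = form (g x) w v"
  by (simp add: form_g algebra_simps)

text \<open>Here \<open>V' + Gam (X t) X' (V t)\<close> is the covariant derivative of \<open>V\<close> along \<open>X\<close>.\<close>

lemma form_along_curve:
  assumes X: "X t \<in> D" "(X has_vector_derivative X') (at t)"
    and V: "(V has_vector_derivative V') (at t)" and W: "(W has_vector_derivative W') (at t)"
  shows "((\<lambda>t. form (g (X t)) (V t) (W t)) has_real_derivative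
    form (g (X t)) (V' + Gam (X t) X' (V t)) (W t) + form (g (X t)) (V t) (W' + Gam (X t) X' (W t))) (at t)"
proof -
  have s: "g (X t) $ 2 $ 1 = g (X t) $ 1 $ 2" by (rule g_sym[OF X(1)])
  note d = smooth_on_along_curve[OF smooth_g_nth X] vec_nth_derivative[OF V] vec_nth_derivative[OF W]
  have "((\<lambda>t. form (g (X t)) (V t) (W t)) has_real_derivative
     ((differential (\<lambda>x. g x $ 1 $ 1) (X t) X' * V t $ 1 + g (X t) $ 1 $ 1 * V' $ 1) * W t $ 1 + g (X t) $ 1 $ 1 * V t $ 1 * W' $ 1)
   + ((differential (\<lambda>x. g x $ 1 $ 2) (X t) X' * V t $ 1 + g (X t) $ 1 $ 2 * V' $ 1) * W t $ 2 + g (X t) $ 1 $ 2 * V t $ 1 * W' $ 2)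
   + ((differential (\<lambda>x. g x $ 2 $ 1) (X t) X' * V t $ 2 + g (X t) $ 2 $ 1 * V' $ 2) * W t $ 1 + g (X t) $ 2 $ 1 * V t $ 2 * W' $ 1)
   + ((differential (\<lambda>x. g x $ 2 $ 2) (X t) X' * V t $ 2 + g (X t) $ 2 $ 2 * V' $ 2) * W t $ 2 + g (X t) $ 2 $ 2 * V t $ 2 * W' $ 2)) (at t)"
    unfolding form_2 by (rule derivative_eq_intros d refl)+ (simp add: algebra_simps)
  then show ?thesis
    by (rule DERIV_cong) (simp add: form_g[OF X(1)] differential_def metric_compat[OF X(1)] Gam_def sum_2 s algebra_simps)
qed

text \<open>The derivative of dh(V) along the curve is dh of the covariant derivative of V plus Hess
  h(X', V), and the Hessian is - K h g. If \<open>V\<close> is parallel and orthogonal to the curve,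
  dh(V) is constant.\<close>

lemma obata_along_curve:
  assumes h: "obata K U h" and X: "X t \<in> U" "(X has_vector_derivative X') (at t)"
    and V: "(V has_vector_derivative V') (at t)"
  shows "((\<lambda>t. h (X t)) has_real_derivative differential h (X t) X') (at t)"
    "((\<lambda>t. differential h (X t) (V t)) has_real_derivative
      differential h (X t) (V' + Gam (X t) X' (V t)) - K * h (X t) * form (g (X t)) X' (V t)) (at t)"
proof -
  have XD: "X t \<in> D" using h X by (auto simp: obata_def)
  have s: "g (X t) $ 2 $ 1 = g (X t) $ 1 $ 2" by (rule g_sym[OF XD])
  show "((\<lambda>t. h (X t)) has_real_derivative differential h (X t) X') (at t)"
    by (rule smooth_on_along_curve[OF obata_partial_deriv(1)[OF h] X])
  note d = smooth_on_along_curve[OF obata_partial_deriv(2)[OF h] X] vec_nth_derivative[OF V]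
  have "((\<lambda>t. differential h (X t) (V t)) has_real_derivative
     (differential (partial_deriv 1 h) (X t) X' * V t $ 1 + partial_deriv 1 h (X t) * V' $ 1)
     + (differential (partial_deriv 2 h) (X t) X' * V t $ 2 + partial_deriv 2 h (X t) * V' $ 2)) (at t)"
    unfolding differential_def[of h] sum_2 by (rule derivative_eq_intros d refl)+ (simp add: algebra_simps)
  then show "((\<lambda>t. differential h (X t) (V t)) has_real_derivative
      differential h (X t) (V' + Gam (X t) X' (V t)) - K * h (X t) * form (g (X t)) X' (V t)) (at t)"
    by (rule DERIV_cong) (simp add: differential_def form_g[OF XD] obata_partial_deriv(3)[OF h X(1)] Gam_def sum_2 s algebra_simps)
qed

section \<open>Orthonormal frames along a geodesic\<close>

text \<open>The Gram determinant is the determinant of the metric times the squared area. It shows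
  that orthogonal vectors of nonzero square are independent and, in Lorentz signature, have squares
  of opposite sign.\<close>

lemma gram_det:
  "x \<in> D \<Longrightarrow> form (g x) T T * form (g x) N N
    = (form (g x) T N)\<^sup>2 + det (g x) * (N $ 1 * T $ 2 - N $ 2 * T $ 1)\<^sup>2"
  unfolding form_g det_g_eq by (simp add: power2_eq_square algebra_simps)

lemma form_nondegenerate:
  assumes x: "x \<in> D" and T: "form (g x) T T \<noteq> 0" and N: "form (g x) T N = 0" "form (g x) N N \<noteq> 0"
    and v: "form (g x) v T = 0" "form (g x) v N = 0"
  shows "v = 0"
proof -
  have "N $ 1 * T $ 2 - N $ 2 * T $ 1 \<noteq> 0"
  proof
    assume z: "N $ 1 * T $ 2 - N $ 2 * T $ 1 = 0"
    show False using gram_det[OF x, of T N] z T N by simp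
  qed
  moreover define b where "b = g x *v v"
  have b: "b $ 1 * w $ 1 + b $ 2 * w $ 2 = form (g x) v w" for w
    unfolding form_g[OF x] by (simp add: b_def matrix_vector_mult_def sum_2 g_sym[OF x, of 2 1] algebra_simps)
  have "(N $ 1 * T $ 2 - N $ 2 * T $ 1) * b $ 1 = 0" "(N $ 1 * T $ 2 - N $ 2 * T $ 1) * b $ 2 = 0"
    using b[of T] b[of N] v by algebra+
  ultimately have "b = 0" by (simp add: vec_eq_iff forall_2)
  then show ?thesis using matrix_vector_mult_eq_0[OF det_g[OF x]] by (simp add: b_def)
qed

text \<open>The normal obtained by raising the index of \<open>*T\<close>; it is parallel along a geodesic with velocity \<open>T\<close>.\<close>

definition rot :: "real^2 \<Rightarrow> real^2 \<Rightarrow> real^2" where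
  "rot x T = (1 / sqrt (- det (g x))) *\<^sub>R
     vector [- (g x $ 1 $ 2 * T $ 1 + g x $ 2 $ 2 * T $ 2), g x $ 1 $ 1 * T $ 1 + g x $ 1 $ 2 * T $ 2]"

lemma form_rot:
  assumes x: "x \<in> D" "det (g x) < 0"
  shows "form (g x) T (rot x T) = 0" "form (g x) (rot x T) (rot x T) = - form (g x) T T"
proof -
  define c where "c = 1 / sqrt (- det (g x))"
  have c: "c * c * det (g x) = - 1" using x(2) by (simp add: c_def divide_simps)
  show "form (g x) T (rot x T) = 0"
    unfolding form_g[OF x(1)] by (simp add: rot_def algebra_simps)
  have "form (g x) (rot x T) (rot x T) = c * c * det (g x) * form (g x) T T"
    unfolding form_g[OF x(1)] det_g_eq[OF x(1)] by (simp add: rot_def c_def[symmetric] algebra_simps)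
  then show "form (g x) (rot x T) (rot x T) = - form (g x) T T" unfolding c by simp
qed

lemma normal_eq_rot:
  assumes x: "x \<in> D" "det (g x) < 0" and T: "form (g x) T T = \<epsilon>" "\<epsilon> \<noteq> 0"
    and N: "form (g x) T N = 0" "form (g x) N N = - \<epsilon>"
  shows "N = rot x T \<or> N = - rot x T"
proof -
  \<comment> \<open>The coefficient of the projection onto \<open>rot x T\<close>, whose square is
    \<open>- \<epsilon>\<close>; what remains of \<open>N\<close> is orthogonal to the whole
    frame.\<close>
  define \<mu> where "\<mu> = - form (g x) N (rot x T) / \<epsilon>"
  have lin: "form (g x) (a - k *\<^sub>R b) c = form (g x) a c - k * form (g x) b c" for a b c k
    unfolding form_g[OF x(1)] by (simp add: algebra_simps)
  have "N - \<mu> *\<^sub>R rot x T = 0"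
  proof (rule form_nondegenerate[OF x(1), of T "rot x T"])
    show "form (g x) (N - \<mu> *\<^sub>R rot x T) T = 0" "form (g x) (N - \<mu> *\<^sub>R rot x T) (rot x T) = 0"
      using N T form_rot[OF x, of T] form_commute[OF x(1), of N T] form_commute[OF x(1), of "rot x T" T]
      unfolding lin by (simp_all add: \<mu>_def)
  qed (use T form_rot[OF x] in auto)
  then have N\<mu>: "N = \<mu> *\<^sub>R rot x T" by simp
  have "form (g x) N N = \<mu> * \<mu> * form (g x) (rot x T) (rot x T)"
    unfolding N\<mu> form_g[OF x(1)] by (simp add: algebra_simps)
  then have "\<mu> * \<mu> = 1" using N T form_rot[OF x] by simp
  then have "\<mu> = 1 \<or> \<mu> = - 1" by (simp add: square_eq_1_iff)
  then show ?thesis using N\<mu> by auto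
qed

lemma rot_differentiable:
  assumes X: "X t \<in> D" "det (g (X t)) < 0" "(X has_vector_derivative X') (at t)" and T: "(T has_vector_derivative T') (at t)"
  obtains N' where "((\<lambda>t. rot (X t) (T t)) has_vector_derivative N') (at t)"
proof -
  note d = smooth_on_along_curve[OF smooth_g_nth X(1,3)] smooth_on_along_curve[OF smooth_det X(1,3)] vec_nth_derivative[OF T]
  have "\<exists>c. ((\<lambda>t. 1 / sqrt (- det (g (X t)))) has_real_derivative c) (at t)"
    using X(2) by (intro exI) (rule derivative_eq_intros d refl | simp)+
  then obtain c where c: "((\<lambda>t. 1 / sqrt (- det (g (X t)))) has_real_derivative c) (at t)" ..
  have "\<exists>a. ((\<lambda>t. - (g (X t) $ 1 $ 2 * T t $ 1 + g (X t) $ 2 $ 2 * T t $ 2)) has_real_derivative a) (at t)"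
    by (intro exI) (rule derivative_eq_intros d refl)+
  then obtain a where a: "((\<lambda>t. - (g (X t) $ 1 $ 2 * T t $ 1 + g (X t) $ 2 $ 2 * T t $ 2)) has_real_derivative a) (at t)" ..
  have "\<exists>a. ((\<lambda>t. g (X t) $ 1 $ 1 * T t $ 1 + g (X t) $ 1 $ 2 * T t $ 2) has_real_derivative a) (at t)"
    by (intro exI) (rule derivative_eq_intros d refl)+
  then obtain b where b: "((\<lambda>t. g (X t) $ 1 $ 1 * T t $ 1 + g (X t) $ 1 $ 2 * T t $ 2) has_real_derivative b) (at t)" ..
  note n = has_vector_derivative_add[OF has_vector_derivative_scaleR[OF a has_vector_derivative_const[of "axis 1 1 :: real^2"]]
      has_vector_derivative_scaleR[OF b has_vector_derivative_const[of "axis 2 1 :: real^2"]]]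
  show thesis
    by (rule that) (use has_vector_derivative_scaleR[OF c n] in \<open>simp only: rot_def vector_2_axis\<close>)
qed

text \<open>Differentiating <N, N> = - \<open>\<epsilon>\<close> and <T, N> = 0 along a geodesic
  shows that the covariant derivative of N is orthogonal to both N and T, hence zero. No formula for
  the derivative of \<open>rot\<close> is needed, only that it exists.\<close>

lemma rot_parallel:
  assumes S: "open S" "t \<in> S" and XD: "\<And>t. t \<in> S \<Longrightarrow> X t \<in> D" "\<And>t. t \<in> S \<Longrightarrow> det (g (X t)) < 0"
    and X: "\<And>t. t \<in> S \<Longrightarrow> (X has_vector_derivative T t) (at t)" and T: "(T has_vector_derivative T') (at t)"
    and geo: "T' + Gam (X t) (T t) (T t) = 0" and unit: "\<And>t. t \<in> S \<Longrightarrow> form (g (X t)) (T t) (T t) = \<epsilon>" and \<epsilon>: "\<epsilon> \<noteq> 0"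
  obtains N' where "((\<lambda>t. rot (X t) (T t)) has_vector_derivative N') (at t)" "N' + Gam (X t) (T t) (rot (X t) (T t)) = 0"
proof -
  note t = XD(1)[OF S(2)] XD(2)[OF S(2)] X[OF S(2)]
  obtain N' where N': "((\<lambda>t. rot (X t) (T t)) has_vector_derivative N') (at t)"
    using rot_differentiable[OF t T] by blast
  let ?N = "rot (X t) (T t)" and ?cov = "N' + Gam (X t) (T t) (rot (X t) (T t))"
  have zero: "form (g (X t)) 0 v = 0" for v by (simp add: form_2)
  have const: "d = 0" if "(f has_real_derivative d) (at t)" "\<And>t. t \<in> S \<Longrightarrow> f t = c" for f d c
  proof -
    have "((\<lambda>t. c) has_real_derivative d) (at t)"
      by (rule has_field_derivative_transform_within_open[OF that(1) S that(2)])
    then show ?thesis using DERIV_const DERIV_unique by blast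
  qed
  have "form (g (X t)) ?cov ?N + form (g (X t)) ?N ?cov = 0"
    using form_rot[OF XD] unit by (intro const[OF form_along_curve[OF t(1,3) N' N'], of "- \<epsilon>"]) auto
  then have 1: "form (g (X t)) ?cov ?N = 0" using form_commute[OF t(1), of ?N ?cov] by simp
  have "form (g (X t)) (T' + Gam (X t) (T t) (T t)) ?N + form (g (X t)) (T t) ?cov = 0"
    using form_rot[OF XD] by (intro const[OF form_along_curve[OF t(1,3) T N'], of 0]) auto
  then have 2: "form (g (X t)) ?cov (T t) = 0" using form_commute[OF t(1), of "T t"] by (simp add: geo zero)
  have "?cov = 0"
    using form_rot[OF t(1,2), of "T t"] unit[OF S(2)] \<epsilon> by (intro form_nondegenerate[OF t(1) _ _ _ 2 1]) auto
  then show thesis using that N' by blast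
qed

end

section \<open>The connection under a change of chart\<close>

text \<open>Differentiating the pullback formula and combining the derivatives as in the lowered
  Christoffel symbols gives the law with its index lowered, because the second derivatives of
  \<open>\<tau>\<close> are symmetric.\<close>

lemma christoffel_transform:
  assumes m: "metric2 g D" and m': "metric2 g' D'" and D1: "open D1" "D1 \<subseteq> D"
    and \<tau>: "smooth_on D1 \<tau>" "\<tau> ` D1 \<subseteq> D'"
    and pull: "\<And>x. x \<in> D1 \<Longrightarrow> g x = transpose (jacobian_at \<tau> x) ** g' (\<tau> x) ** jacobian_at \<tau> x"
    and x: "x \<in> D1"
  shows "(\<Sum>m\<in>UNIV. jacobian_at \<tau> x $ k $ m * christoffel g x m i j) =
    (\<Sum>a\<in>UNIV. \<Sum>b\<in>UNIV. christoffel g' (\<tau> x) k a b * jacobian_at \<tau> x $ a $ i * jacobian_at \<tau> x $ b $ j)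
    + partial_deriv i (partial_deriv j (\<lambda>x. \<tau> x $ k)) x"
proof -
  interpret A: metric2 g D by (rule m)
  interpret B: metric2 g' D' by (rule m')
  have xD: "x \<in> D" "\<tau> x \<in> D'" using x D1 \<tau> by auto
  have sm: "smooth_on D1 (\<lambda>x. \<tau> x $ a)" for a by (rule smooth_on_vec_nth[OF D1(1) \<tau>(1)])
  define p where "p a i = partial_deriv i (\<lambda>x. \<tau> x $ a)" for a i
  have smp: "smooth_on D1 (p a i)" for a i unfolding p_def by (rule smooth_on_partial_deriv[OF sm])
  have J: "jacobian_at \<tau> x $ a $ i = p a i x" if "x \<in> D1" for x a i
    unfolding p_def by (rule jacobian_at_component[OF \<tau>(1) that])
  define q where "q a i j = partial_deriv i (p a j) x" for a i j
  have q_sym: "q a i j = q a j i" for a i j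
    unfolding q_def p_def by (rule partial_deriv_commute[OF D1(1) sm x])
  have smg': "smooth_on D1 (\<lambda>x. g' (\<tau> x) $ a $ b)" for a b
    by (rule smooth_on_compose[OF D1(1) B.open_D B.smooth_g_nth \<tau>(1,2)])
  have pg': "partial_deriv k (\<lambda>x. g' (\<tau> x) $ a $ b) x = (\<Sum>c\<in>UNIV. B.dg c a b (\<tau> x) * p c k x)" for a b k
    using partial_deriv_compose[OF B.smooth_g_nth \<tau>(1) x xD(2), of k a b] by (simp add: J[OF x])
  have g: "g y $ i $ j = (\<Sum>a\<in>UNIV. \<Sum>b\<in>UNIV. g' (\<tau> y) $ a $ b * p a i y * p b j y)" if "y \<in> D1" for y i j
    unfolding pull[OF that] by (simp add: matrix_matrix_mult_def transpose_def sum_2 J[OF that] algebra_simps)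
  have dg: "A.dg k i j x = (\<Sum>a\<in>UNIV. \<Sum>b\<in>UNIV. ((\<Sum>c\<in>UNIV. B.dg c a b (\<tau> x) * p c k x) * p a i x + g' (\<tau> x) $ a $ b * q a k i) * p b j x
      + g' (\<tau> x) $ a $ b * p a i x * q b k j)" for k i j
  proof -
    have "A.dg k i j x = partial_deriv k (\<lambda>y. \<Sum>a\<in>UNIV. \<Sum>b\<in>UNIV. g' (\<tau> y) $ a $ b * p a i y * p b j y) x"
      by (rule partial_deriv_cong[OF D1(1) x g])
    then show ?thesis unfolding sum_2
      by (simp add: partial_deriv_add[OF _ _ x] partial_deriv_mult[OF _ _ x] smooth_on_add smooth_on_mult smp smg' D1(1) pg' q_def sum_2)
  qed
  have s': "g' (\<tau> x) $ 2 $ 1 = g' (\<tau> x) $ 1 $ 2" by (rule B.g_sym[OF xD(2)])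
  have ds': "B.dg c 2 1 (\<tau> x) = B.dg c 1 2 (\<tau> x)" for c by (rule B.dg_sym[OF xD(2)])
  \<comment> \<open>The discrepancy between the two sides of the law; the lowered identity puts it
    into the kernel of the invertible matrix formed by the transposed Jacobian and
    \<open>g'\<close>.\<close>
  define w :: "real^2" where "w = (\<chi> b. (\<Sum>m\<in>UNIV. p b m x * christoffel g x m i j) -
      ((\<Sum>c\<in>UNIV. \<Sum>d\<in>UNIV. christoffel g' (\<tau> x) b c d * p c i x * p d j x) + q b i j))"
  have low: "(\<Sum>m\<in>UNIV. g x $ l $ m * christoffel g x m i j)
      = (\<Sum>a\<in>UNIV. p a l x * ((\<Sum>c\<in>UNIV. \<Sum>d\<in>UNIV. (\<Sum>b\<in>UNIV. g' (\<tau> x) $ a $ b * christoffel g' (\<tau> x) b c d) * p c i x * p d j x)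
        + (\<Sum>b\<in>UNIV. g' (\<tau> x) $ a $ b * q b i j)))" for l
    unfolding A.christoffel_lower[OF xD(1)] B.christoffel_lower[OF xD(2)] dg
    by (simp add: sum_2 s' ds' q_sym[of _ i l] q_sym[of _ j l] q_sym[of _ j i] field_simps)
  have "(transpose (jacobian_at \<tau> x) *v (g' (\<tau> x) *v w)) $ l = 0" for l
    using low[of l] unfolding g[OF x]
    by (simp add: matrix_vector_mult_def transpose_def J[OF x] w_def sum_2 algebra_simps)
  then have "transpose (jacobian_at \<tau> x) *v (g' (\<tau> x) *v w) = 0" by (simp add: vec_eq_iff)
  moreover have "det (g x) = det (transpose (jacobian_at \<tau> x)) * det (g' (\<tau> x)) * det (jacobian_at \<tau> x)"
    unfolding pull[OF x] by (simp add: det_mul)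
  then have "det (transpose (jacobian_at \<tau> x)) \<noteq> 0" using A.det_g[OF xD(1)] by auto
  ultimately have "w = 0" using matrix_vector_mult_eq_0 B.det_g[OF xD(2)] by metis
  then have "w $ k = 0" by simp
  then show ?thesis by (simp add: w_def J[OF x] q_def p_def)
qed

section \<open>Fermi-type coordinates\<close>

text \<open>\<open>cs \<kappa>\<close> and \<open>sn \<kappa>\<close> solve \<open>y'' = - \<kappa> y\<close> with initial data \<open>(1, 0)\<close> and \<open>(0, 1)\<close>;
  only \<open>\<kappa> \<in> {-1, 0, 1}\<close> is meaningful.\<close>

definition cs :: "real \<Rightarrow> real \<Rightarrow> real" where
  "cs \<kappa> t = (if \<kappa> = 1 then cos t else if \<kappa> = - 1 then cosh t else 1)"

definition sn :: "real \<Rightarrow> real \<Rightarrow> real" where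
  "sn \<kappa> t = (if \<kappa> = 1 then sin t else if \<kappa> = - 1 then sinh t else t)"

lemma cs_sn_0: "cs \<kappa> 0 = 1" "sn \<kappa> 0 = 0"
  by (auto simp: cs_def sn_def)

lemma DERIV_cs_sn:
  assumes "\<kappa> \<in> {- 1, 0, 1}"
  shows "(cs \<kappa> has_real_derivative - \<kappa> * sn \<kappa> t) (at t)" "(sn \<kappa> has_real_derivative cs \<kappa> t) (at t)"
  using assms unfolding cs_def[abs_def] sn_def[abs_def]
  by (auto intro!: derivative_eq_intros)

lemma cs_sn_square: "\<kappa> \<in> {- 1, 0, 1} \<Longrightarrow> cs \<kappa> t * cs \<kappa> t + \<kappa> * (sn \<kappa> t * sn \<kappa> t) = 1"
  using cosh_square_eq[of t] by (auto simp: cs_def sn_def power2_eq_square[symmetric])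

lemma cs_sn_add:
  assumes "\<kappa> \<in> {- 1, 0, 1}"
  shows "cs \<kappa> (s + t) = cs \<kappa> s * cs \<kappa> t - \<kappa> * (sn \<kappa> s * sn \<kappa> t)" "sn \<kappa> (s + t) = sn \<kappa> s * cs \<kappa> t + cs \<kappa> s * sn \<kappa> t"
  using assms by (auto simp: cs_def sn_def cos_add sin_add cosh_add sinh_add)

lemma continuous_on_cs_sn:
  assumes "\<kappa> \<in> {- 1, 0, 1}"
  shows "continuous_on S (cs \<kappa>)" "continuous_on S (sn \<kappa>)"
  using DERIV_cs_sn[OF assms] by (meson DERIV_isCont continuous_at_imp_continuous_on)+

text \<open>The combinations y cs - z sn and z cs + \<open>\<kappa>\<close> y sn have derivative
  zero. Since cs^2 + \<open>\<kappa>\<close> sn^2 = 1, they can be solved for y and z.\<close>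

lemma harmonic_ode_unique:
  assumes \<kappa>: "\<kappa> \<in> {- 1, 0, 1}"
    and y: "\<And>t. t \<in> closed_segment a b \<Longrightarrow> (y has_real_derivative z t) (at t)"
    and z: "\<And>t. t \<in> closed_segment a b \<Longrightarrow> (z has_real_derivative - \<kappa> * y t) (at t)"
    and t: "t \<in> closed_segment a b"
  shows "y t = cs \<kappa> (t - a) * y a + sn \<kappa> (t - a) * z a"
    "z t = - \<kappa> * sn \<kappa> (t - a) * y a + cs \<kappa> (t - a) * z a"
proof -
  let ?c = "\<lambda>t. cs \<kappa> (t - a)" and ?s = "\<lambda>t. sn \<kappa> (t - a)"
  have dc: "(?c has_real_derivative - \<kappa> * ?s t) (at t)" and ds: "(?s has_real_derivative ?c t) (at t)" for t
    using DERIV_shift[of "cs \<kappa>" _ t "- a"] DERIV_shift[of "sn \<kappa>" _ t "- a"] DERIV_cs_sn[OF \<kappa>, of "t - a"] by simp_all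
  have const: "f t = f a" if "\<And>t. t \<in> closed_segment a b \<Longrightarrow> (f has_real_derivative 0) (at t)" for f :: "real \<Rightarrow> real"
    using has_field_derivative_zero_constant[of "closed_segment a b" f] that t
    by (metis convex_closed_segment ends_in_segment(1) has_field_derivative_at_within)
  have "y t * ?c t - z t * ?s t = y a * ?c a - z a * ?s a"
  proof (rule const)
    fix t assume t: "t \<in> closed_segment a b"
    show "((\<lambda>t. y t * ?c t - z t * ?s t) has_real_derivative 0) (at t)"
      by (rule DERIV_cong[OF DERIV_diff[OF DERIV_mult[OF y[OF t] dc] DERIV_mult[OF z[OF t] ds]]]) (simp add: algebra_simps)
  qed
  moreover have "z t * ?c t + \<kappa> * (y t * ?s t) = z a * ?c a + \<kappa> * (y a * ?s a)"
  proof (rule const)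
    fix t assume t: "t \<in> closed_segment a b"
    show "((\<lambda>t. z t * ?c t + \<kappa> * (y t * ?s t)) has_real_derivative 0) (at t)"
      by (rule DERIV_cong[OF DERIV_add[OF DERIV_mult[OF z[OF t] dc] DERIV_cmult[OF DERIV_mult[OF y[OF t] ds]]]]) (simp add: algebra_simps)
  qed
  ultimately have 1: "y t * ?c t - z t * ?s t = y a" "z t * ?c t + \<kappa> * (y t * ?s t) = z a"
    by (simp_all add: cs_sn_0)
  note sq = cs_sn_square[OF \<kappa>, of "t - a"]
  have "?c t * y a + ?s t * z a = y t * (?c t * ?c t + \<kappa> * (?s t * ?s t))"
    unfolding 1[symmetric] by (simp add: algebra_simps)
  then show "y t = ?c t * y a + ?s t * z a" unfolding sq by simp
  have "- \<kappa> * ?s t * y a + ?c t * z a = z t * (?c t * ?c t + \<kappa> * (?s t * ?s t))"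
    unfolding 1[symmetric] by (simp add: algebra_simps)
  then show "z t = - \<kappa> * ?s t * y a + ?c t * z a" unfolding sq by simp
qed

lemma closed_segment_subset_real: "u \<in> closed_segment a (b::real) \<Longrightarrow> closed_segment a u \<subseteq> closed_segment a b"
  by (auto simp: closed_segment_eq_real_ivl split: if_splits)

context metric2
begin

lemma differential_0: "differential h x 0 = 0"
  by (simp add: differential_def)

lemma differential_linear:
  "differential h x (v + w) = differential h x v + differential h x w" "differential h x (c *\<^sub>R v) = c * differential h x v"
  "differential h x (v - w) = differential h x v - differential h x w" "differential h x (- v) = - differential h x v"
  by (simp_all add: differential_def sum_2 algebra_simps)

lemma form_linear:
  "form (g x) (c *\<^sub>R v) w = c * form (g x) v w" "form (g x) v (c *\<^sub>R w) = c * form (g x) v w"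
  "form (g x) 0 w = 0" "form (g x) v 0 = 0"
  by (simp_all add: form_2 algebra_simps)

lemma speed_constant:
  assumes X: "\<And>t. t \<in> closed_segment a b \<Longrightarrow> X t \<in> D" "\<And>t. t \<in> closed_segment a b \<Longrightarrow> (X has_vector_derivative T t) (at t)"
    and T: "\<And>t. t \<in> closed_segment a b \<Longrightarrow> (T has_vector_derivative T' t) (at t)"
      "\<And>t. t \<in> closed_segment a b \<Longrightarrow> T' t + Gam (X t) (T t) (T t) = 0" and t: "t \<in> closed_segment a b"
  shows "form (g (X t)) (T t) (T t) = form (g (X a)) (T a) (T a)"
proof -
  have "((\<lambda>t. form (g (X t)) (T t) (T t)) has_real_derivative 0) (at t)" if "t \<in> closed_segment a b" for t
    using form_along_curve[OF X[OF that] T(1)[OF that] T(1)[OF that]] by (simp add: T(2)[OF that] form_linear)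
  then have "\<exists>c. \<forall>t\<in>closed_segment a b. form (g (X t)) (T t) (T t) = c"
    by (intro has_field_derivative_zero_constant) (auto intro: has_field_derivative_at_within)
  then show ?thesis using t ends_in_segment(1)[of a b] by auto
qed

lemma obata_along_geodesic:
  assumes h: "obata K U h" and \<kappa>: "\<kappa> = K * \<epsilon>" "\<kappa> \<in> {- 1, 0, 1}"
    and X: "\<And>t. t \<in> closed_segment a b \<Longrightarrow> X t \<in> U" "\<And>t. t \<in> closed_segment a b \<Longrightarrow> (X has_vector_derivative T t) (at t)"
    and T: "\<And>t. t \<in> closed_segment a b \<Longrightarrow> (T has_vector_derivative T' t) (at t)"
      "\<And>t. t \<in> closed_segment a b \<Longrightarrow> T' t + Gam (X t) (T t) (T t) = 0"
    and unit: "form (g (X a)) (T a) (T a) = \<epsilon>" and t: "t \<in> closed_segment a b"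
  shows "h (X t) = cs \<kappa> (t - a) * h (X a) + sn \<kappa> (t - a) * differential h (X a) (T a)"
    "differential h (X t) (T t) = - \<kappa> * sn \<kappa> (t - a) * h (X a) + cs \<kappa> (t - a) * differential h (X a) (T a)"
proof -
  have XD: "X t \<in> D" if "t \<in> closed_segment a b" for t using X(1)[OF that] h by (auto simp: obata_def)
  have speed: "form (g (X t)) (T t) (T t) = \<epsilon>" if "t \<in> closed_segment a b" for t
    using speed_constant[OF XD X(2) T that] unit by simp
  note d = obata_along_curve[OF h X(1) X(2) T(1)]
  have 2: "((\<lambda>t. differential h (X t) (T t)) has_real_derivative - \<kappa> * h (X t)) (at t)" if "t \<in> closed_segment a b" for t
    using d(2)[OF that that that] by (simp add: T(2)[OF that] speed[OF that] differential_0 \<kappa>(1) mult_ac)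
  note harmonic_ode_unique[OF \<kappa>(2), of a b "\<lambda>t. h (X t)" "\<lambda>t. differential h (X t) (T t)", OF d(1) 2 t]
  then show "h (X t) = cs \<kappa> (t - a) * h (X a) + sn \<kappa> (t - a) * differential h (X a) (T a)"
    "differential h (X t) (T t) = - \<kappa> * sn \<kappa> (t - a) * h (X a) + cs \<kappa> (t - a) * differential h (X a) (T a)"
    by blast+
qed

text \<open>First-order data at \<open>v0\<close> of a family of geodesics with positions \<open>X v\<close> and velocities \<open>T v\<close>:
  the variation field is \<open>f N\<close> and its covariant derivative along the geodesic is \<open>f' N\<close>.\<close>

definition jacobi :: "real \<Rightarrow> real \<Rightarrow> real \<Rightarrow> real \<Rightarrow> (real \<Rightarrow> real^2) \<Rightarrow> (real \<Rightarrow> real^2) \<Rightarrow> bool" where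
  "jacobi \<epsilon> f f' v0 X T \<longleftrightarrow> X v0 \<in> D \<and> (\<exists>N \<xi>. (X has_vector_derivative f *\<^sub>R N) (at v0) \<and> (T has_vector_derivative \<xi>) (at v0) \<and>
     \<xi> + Gam (X v0) (f *\<^sub>R N) (T v0) = f' *\<^sub>R N \<and>
     form (g (X v0)) (T v0) (T v0) = \<epsilon> \<and> form (g (X v0)) (T v0) N = 0 \<and> form (g (X v0)) N N = - \<epsilon>)"

end

section \<open>Chart independence of the first-order data\<close>

lemma form_pullback:
  fixes A B J :: "real^'n^'n"
  assumes "A = transpose J ** B ** J"
  shows "form A v w = form B (J *v v) (J *v w)"
proof -
  have "form A v w = v \<bullet> (transpose J *v (B *v (J *v w)))"
    by (simp add: form_def assms matrix_vector_mul_assoc matrix_mul_assoc)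
  also have "\<dots> = (J *v v) \<bullet> (B *v (J *v w))"
    by (metis dot_lmul_matrix transpose_matrix_vector transpose_transpose inner_commute)
  finally show ?thesis by (simp add: form_def)
qed

lemma has_vector_derivative_vec_2:
  fixes V :: "real \<Rightarrow> real^2"
  assumes "\<And>k. ((\<lambda>t. V t $ k) has_real_derivative V' $ k) (at t within S)"
  shows "(V has_vector_derivative V') (at t within S)"
proof -
  have vec: "w = (w $ 1) *\<^sub>R axis 1 1 + (w $ 2) *\<^sub>R axis 2 1" for w :: "real^2"
    by (simp add: vec_eq_iff forall_2 axis_def)
  have "((\<lambda>t. (V t $ 1) *\<^sub>R axis 1 1 + (V t $ 2) *\<^sub>R axis 2 1 :: real^2) has_vector_derivative (V' $ 1) *\<^sub>R axis 1 1 + (V' $ 2) *\<^sub>R axis 2 1) (at t within S)"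
    using has_vector_derivative_add[OF has_vector_derivative_scaleR[OF assms[of 1] has_vector_derivative_const[of "axis 1 1 :: real^2"]]
      has_vector_derivative_scaleR[OF assms[of 2] has_vector_derivative_const[of "axis 2 1 :: real^2"]]] by simp
  then show ?thesis by (simp only: vec[symmetric])
qed

text \<open>Variation field and velocity are multiplied by the Jacobian of \<open>\<tau>\<close>.
  The second derivatives of \<open>\<tau>\<close> arising when the velocity is differentiated cancel
  against those in \<open>christoffel_transform\<close>, so the covariant derivative is multiplied
  by the Jacobian as well.\<close>

lemma jacobi_transform:
  assumes m: "metric2 g D" and m': "metric2 g' D'" and D1: "open D1" "D1 \<subseteq> D"
    and \<tau>: "smooth_on D1 \<tau>" "\<tau> ` D1 \<subseteq> D'"
    and pull: "\<And>x. x \<in> D1 \<Longrightarrow> g x = transpose (jacobian_at \<tau> x) ** g' (\<tau> x) ** jacobian_at \<tau> x"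
    and X0: "X v0 \<in> D1" and jac: "metric2.jacobi g D \<epsilon> f f' v0 X T"
    and ev: "\<forall>\<^sub>F v in nhds v0. X' v = \<tau> (X v) \<and> T' v = jacobian_at \<tau> (X v) *v T v"
  shows "metric2.jacobi g' D' \<epsilon> f f' v0 X' T'"
proof -
  interpret A: metric2 g D by (rule m)
  interpret B: metric2 g' D' by (rule m')
  define J where "J = jacobian_at \<tau> (X v0)"
  obtain N \<xi> where X: "(X has_vector_derivative f *\<^sub>R N) (at v0)" and T: "(T has_vector_derivative \<xi>) (at v0)"
    and cov: "\<xi> + A.Gam (X v0) (f *\<^sub>R N) (T v0) = f' *\<^sub>R N"
    and forms: "form (g (X v0)) (T v0) (T v0) = \<epsilon>" "form (g (X v0)) (T v0) N = 0" "form (g (X v0)) N N = - \<epsilon>"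
    using jac by (auto simp: A.jacobi_def)
  have X'0: "X' v0 = \<tau> (X v0)" "T' v0 = J *v T v0" using eventually_nhds_x_imp_x[OF ev] by (auto simp: J_def)
  have sm: "smooth_on D1 (\<lambda>x. \<tau> x $ a)" for a by (rule smooth_on_vec_nth[OF D1(1) \<tau>(1)])
  define p where "p a i = partial_deriv i (\<lambda>x. \<tau> x $ a)" for a i
  have smp: "smooth_on D1 (p a i)" for a i unfolding p_def by (rule smooth_on_partial_deriv[OF sm])
  have Jp: "jacobian_at \<tau> x $ a $ i = p a i x" if "x \<in> D1" for x a i
    unfolding p_def by (rule jacobian_at_component[OF \<tau>(1) that])
  have "continuous (at v0) X" using X has_vector_derivative_continuous by blast
  then have evX: "\<forall>\<^sub>F v in nhds v0. X v \<in> D1"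
    using D1(1) X0 by (simp add: continuous_at tendsto_nhds_iff topological_tendstoD eventually_nhds_conv_at)
  have dX': "(X' has_vector_derivative J *v (f *\<^sub>R N)) (at v0)"
  proof -
    have "((\<lambda>v. \<tau> (X v)) has_derivative (\<lambda>h. frechet_derivative \<tau> (at (X v0)) (h *\<^sub>R (f *\<^sub>R N)))) (at v0)"
      by (rule has_derivative_compose[OF X[unfolded has_vector_derivative_def] smooth_onD(1)[OF \<tau>(1) X0]])
    then have "((\<lambda>v. \<tau> (X v)) has_vector_derivative J *v (f *\<^sub>R N)) (at v0)"
      unfolding has_vector_derivative_def by (simp add: jacobian_at_works[OF \<tau>(1) X0] J_def matrix_vector_mult_scaleR)
    moreover obtain S where "open S" "v0 \<in> S" "\<And>v. v \<in> S \<Longrightarrow> X' v = \<tau> (X v)"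
      using ev unfolding eventually_nhds by blast
    ultimately show ?thesis
      using has_vector_derivative_transform_within_open[of "\<lambda>v. \<tau> (X v)" _ v0 S X'] by simp
  qed
  define \<xi>' :: "real^2" where "\<xi>' = (\<chi> k. \<Sum>m\<in>UNIV. A.differential (p k m) (X v0) (f *\<^sub>R N) * T v0 $ m + p k m (X v0) * \<xi> $ m)"
  have dT': "(T' has_vector_derivative \<xi>') (at v0)"
  proof (rule has_vector_derivative_vec_2)
    fix k
    note d = A.smooth_on_along_curve[OF smp X0 X] A.vec_nth_derivative[OF T]
    have "((\<lambda>v. \<Sum>m\<in>UNIV. p k m (X v) * T v $ m) has_real_derivative \<xi>' $ k) (at v0)"
      unfolding sum_2 \<xi>'_def by (rule derivative_eq_intros d refl)+ (simp add: sum_2 algebra_simps)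
    moreover have "\<forall>\<^sub>F v in nhds v0. (\<Sum>m\<in>UNIV. p k m (X v) * T v $ m) = T' v $ k"
      using ev evX by eventually_elim (simp add: matrix_vector_mult_def Jp)
    ultimately show "((\<lambda>t. T' t $ k) has_real_derivative \<xi>' $ k) (at v0)"
      using DERIV_cong_ev[of v0 v0 "\<lambda>v. \<Sum>m\<in>UNIV. p k m (X v) * T v $ m" "\<lambda>t. T' t $ k"] by blast
  qed
  have tr: "(\<Sum>m\<in>UNIV. p k m (X v0) * christoffel g (X v0) m i j) =
    (\<Sum>a\<in>UNIV. \<Sum>b\<in>UNIV. christoffel g' (\<tau> (X v0)) k a b * p a i (X v0) * p b j (X v0)) + partial_deriv i (p k j) (X v0)" for k i j
    using christoffel_transform[OF m m' D1 \<tau> pull X0, of k i j] by (simp add: Jp[OF X0] p_def)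
  have "\<xi>' + B.Gam (\<tau> (X v0)) (J *v (f *\<^sub>R N)) (J *v T v0) = J *v (\<xi> + A.Gam (X v0) (f *\<^sub>R N) (T v0))"
  proof -
    have pd: "partial_deriv i (p k j) (X v0) = (\<Sum>m\<in>UNIV. p k m (X v0) * christoffel g (X v0) m i j)
        - (\<Sum>a\<in>UNIV. \<Sum>b\<in>UNIV. christoffel g' (\<tau> (X v0)) k a b * p a i (X v0) * p b j (X v0))" for k i j
      using tr[of k i j] by simp
    show ?thesis
      by (simp add: vec_eq_iff \<xi>'_def A.differential_def B.Gam_def A.Gam_def matrix_vector_mult_def J_def Jp[OF X0] pd sum_2 algebra_simps)
  qed
  then have "\<xi>' + B.Gam (\<tau> (X v0)) (f *\<^sub>R (J *v N)) (J *v T v0) = f' *\<^sub>R (J *v N)"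
    by (simp add: cov matrix_vector_mult_scaleR)
  moreover note fp = form_pullback[OF pull[OF X0], folded J_def]
  moreover have "\<tau> (X v0) \<in> D'" using X0 \<tau>(2) by blast
  ultimately show ?thesis
    unfolding B.jacobi_def X'0 using dX' dT' forms by (auto simp: matrix_vector_mult_scaleR)
qed

lemma (in metric2) rot_differential_constant:
  assumes ob: "obata K U h" and S: "open S" "closed_segment a b \<subseteq> S"
    and X: "\<And>t. t \<in> S \<Longrightarrow> X t \<in> U" "\<And>t. t \<in> S \<Longrightarrow> (X has_vector_derivative T t) (at t)"
    and T: "\<And>t. t \<in> S \<Longrightarrow> (T has_vector_derivative T' t) (at t)"
      "\<And>t. t \<in> S \<Longrightarrow> T' t + Gam (X t) (T t) (T t) = 0"
    and neg: "\<And>x. x \<in> D \<Longrightarrow> det (g x) < 0" and unit: "form (g (X a)) (T a) (T a) = \<epsilon>" "\<epsilon> \<noteq> 0"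
  shows "differential h (X b) (rot (X b) (T b)) = differential h (X a) (rot (X a) (T a))"
proof -
  have XD: "X t \<in> D" if "t \<in> S" for t using X(1)[OF that] ob by (auto simp: obata_def)
  have speed: "form (g (X t)) (T t) (T t) = form (g (X s)) (T s) (T s)" if "closed_segment s t \<subseteq> S" for s t
    by (rule speed_constant[where T' = T']) (use that XD X(2) T in auto)
  have "((\<lambda>t. differential h (X t) (rot (X t) (T t))) has_real_derivative 0) (at t)" if t: "t \<in> closed_segment a b" for t
  proof -
    have tS: "t \<in> S" using t S(2) by blast
    \<comment> \<open>\<open>rot_parallel\<close> wants constant speed on an open set around
      \<open>t\<close>; \<open>S\<close> need not be connected, so the speed is carried from
      \<open>a\<close> to \<open>t\<close> and from there over a ball.\<close>
    obtain \<delta> where \<delta>: "\<delta> > 0" "ball t \<delta> \<subseteq> S" using S(1) tS openE by blast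
    have ut: "form (g (X t)) (T t) (T t) = \<epsilon>"
      using speed[of a t] closed_segment_subset_real[OF t] S(2) unit(1) by simp
    have us: "form (g (X s)) (T s) (T s) = \<epsilon>" if "s \<in> ball t \<delta>" for s
    proof -
      have "closed_segment t s \<subseteq> ball t \<delta>" by (rule closed_segment_subset) (use that \<delta> in auto)
      then show ?thesis using speed[of t s] \<delta>(2) ut by auto
    qed
    obtain N' where N': "((\<lambda>t. rot (X t) (T t)) has_vector_derivative N') (at t)" "N' + Gam (X t) (T t) (rot (X t) (T t)) = 0"
      by (rule rot_parallel[of "ball t \<delta>" t X T "T' t" \<epsilon>]) (use \<delta> XD X(2) T tS neg us unit(2) in auto)
    show ?thesis
      using obata_along_curve(2)[OF ob X(1,2)[OF tS] N'(1)] form_rot(1)[OF XD[OF tS] neg[OF XD[OF tS]]]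
      by (simp add: N'(2) differential_0)
  qed
  then have "\<exists>c. \<forall>t\<in>closed_segment a b. differential h (X t) (rot (X t) (T t)) = c"
    by (intro has_field_derivative_zero_constant) (auto intro: has_field_derivative_at_within)
  then show ?thesis by auto
qed

section \<open>Curves and geodesics read in charts\<close>

lemma smooth_curve_chart:
  assumes M: "smooth_manifold M" and \<gamma>: "smooth_curve M I \<gamma>" and c: "(C, \<phi>) \<in> atlas M"
  shows "open I" "openin (mtop M) P \<Longrightarrow> open {t \<in> I. \<gamma> t \<in> P}"
    and "t \<in> I \<Longrightarrow> \<gamma> t \<in> C \<Longrightarrow> ((\<lambda>t. \<phi> (\<gamma> t)) has_vector_derivative velocity (C, \<phi>) \<gamma> t) (at t)"
    and "t \<in> I \<Longrightarrow> \<gamma> t \<in> C \<Longrightarrow> (velocity (C, \<phi>) \<gamma> has_vector_derivative vector_derivative (velocity (C, \<phi>) \<gamma>) (at t)) (at t)"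
proof -
  show oI: "open I" using \<gamma> by (simp add: smooth_curve_def open_interval_def)
  have cont: "continuous_map (top_of_set I) (mtop M) \<gamma>" using \<gamma> by (simp add: smooth_curve_def)
  have op: "open {t \<in> I. \<gamma> t \<in> P}" if "openin (mtop M) P" for P
    using openin_continuous_map_preimage[OF cont that] oI by (simp add: openin_open_eq)
  then show "openin (mtop M) P \<Longrightarrow> open {t \<in> I. \<gamma> t \<in> P}" .
  define S where "S = {t \<in> I. \<gamma> t \<in> C}"
  have oS: "open S" unfolding S_def by (rule op[OF is_chartD(1)[OF smooth_manifoldD(2)[OF M c]]])
  have sm: "smooth_on S (\<lambda>t. \<phi> (\<gamma> t))"
    using \<gamma> c by (auto simp: smooth_curve_def S_def o_def)
  have d: "((\<lambda>t. \<phi> (\<gamma> t)) has_vector_derivative frechet_derivative (\<lambda>t. \<phi> (\<gamma> t)) (at t) 1) (at t)" if "t \<in> S" for t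
  proof -
    have "frechet_derivative (\<lambda>t. \<phi> (\<gamma> t)) (at t) h = h *\<^sub>R frechet_derivative (\<lambda>t. \<phi> (\<gamma> t)) (at t) 1" for h :: real
      using linear_cmul[OF frechet_derivative_linear[OF sm that], of h 1] by simp
    then show ?thesis
      using smooth_onD(1)[OF sm that] unfolding has_vector_derivative_def by (metis (no_types, lifting) ext)
  qed
  have v: "velocity (C, \<phi>) \<gamma> t = frechet_derivative (\<lambda>t. \<phi> (\<gamma> t)) (at t) 1" if "t \<in> S" for t
    using vector_derivative_at[OF d[OF that]] by (simp add: velocity_def o_def)
  show "((\<lambda>t. \<phi> (\<gamma> t)) has_vector_derivative velocity (C, \<phi>) \<gamma> t) (at t)" if "t \<in> I" "\<gamma> t \<in> C"
    using d[of t] v[of t] that by (simp add: S_def)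
  show "(velocity (C, \<phi>) \<gamma> has_vector_derivative vector_derivative (velocity (C, \<phi>) \<gamma>) (at t)) (at t)" if t: "t \<in> I" "\<gamma> t \<in> C"
  proof -
    have tS: "t \<in> S" using t by (simp add: S_def)
    have "(velocity (C, \<phi>) \<gamma> has_derivative frechet_derivative (\<lambda>t. frechet_derivative (\<lambda>t. \<phi> (\<gamma> t)) (at t) 1) (at t)) (at t)"
      by (rule has_derivative_transform_within_open[OF smooth_onD(1)[OF smooth_onD(2)[OF sm] tS] oS tS]) (simp add: v)
    then show ?thesis
      using vector_derivative_works differentiable_def by blast
  qed
qed

lemma velocity_transition:
  assumes M: "smooth_manifold M" and \<gamma>: "smooth_curve M I \<gamma>" and c: "(C, \<phi>) \<in> atlas M" and c': "(C', \<phi>') \<in> atlas M"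
    and t: "t \<in> I" "\<gamma> t \<in> C" "\<gamma> t \<in> C'"
  shows "velocity (C', \<phi>') \<gamma> t = jacobian_at (\<phi>' \<circ> inv_into C \<phi>) (\<phi> (\<gamma> t)) *v velocity (C, \<phi>) \<gamma> t"
proof -
  let ?\<tau> = "\<phi>' \<circ> inv_into C \<phi>"
  note C = is_chartD[OF smooth_manifoldD(2)[OF M c]] and C' = is_chartD[OF smooth_manifoldD(2)[OF M c']]
  have sm: "smooth_on (\<phi> ` (C \<inter> C')) ?\<tau>" by (rule smooth_manifoldD(4)[OF M c c'])
  have x: "\<phi> (\<gamma> t) \<in> \<phi> ` (C \<inter> C')" using t by simp
  have "((\<lambda>t. ?\<tau> (\<phi> (\<gamma> t))) has_derivative (\<lambda>h. frechet_derivative ?\<tau> (at (\<phi> (\<gamma> t))) (h *\<^sub>R velocity (C, \<phi>) \<gamma> t))) (at t)"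
    by (rule has_derivative_compose[OF smooth_curve_chart(3)[OF M \<gamma> c t(1,2), unfolded has_vector_derivative_def] smooth_onD(1)[OF sm x]])
  then have "((\<lambda>t. ?\<tau> (\<phi> (\<gamma> t))) has_vector_derivative jacobian_at ?\<tau> (\<phi> (\<gamma> t)) *v velocity (C, \<phi>) \<gamma> t) (at t)"
    unfolding has_vector_derivative_def by (simp add: jacobian_at_works[OF sm x] matrix_vector_mult_scaleR)
  then have "((\<lambda>t. \<phi>' (\<gamma> t)) has_vector_derivative jacobian_at ?\<tau> (\<phi> (\<gamma> t)) *v velocity (C, \<phi>) \<gamma> t) (at t)"
  proof (rule has_vector_derivative_transform_within_open)
    show "open {t \<in> I. \<gamma> t \<in> C}" by (rule smooth_curve_chart(2)[OF M \<gamma> c C(1)])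
    show "?\<tau> (\<phi> (\<gamma> s)) = \<phi>' (\<gamma> s)" if "s \<in> {t \<in> I. \<gamma> t \<in> C}" for s
      using that C(3) by simp
  qed (use t in auto)
  then show ?thesis using vector_derivative_at by (fastforce simp: velocity_def o_def)
qed

lemma geodesic_chart:
  assumes M: "lorentz_surface M" and \<gamma>: "geodesic M I \<gamma>" and c: "(C, \<phi>) \<in> atlas M" and t: "t \<in> I" "\<gamma> t \<in> C"
  shows "vector_derivative (velocity (C, \<phi>) \<gamma>) (at t)
    + metric2.Gam (metric M (C, \<phi>)) (\<phi> (\<gamma> t)) (velocity (C, \<phi>) \<gamma> t) (velocity (C, \<phi>) \<gamma> t) = 0"
proof -
  interpret G: metric2 "metric M (C, \<phi>)" "\<phi> ` C" by (rule lorentz_surface_chart(1)[OF M c])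
  have "\<forall>c\<in>atlas M. \<forall>t\<in>I. \<gamma> t \<in> fst c \<longrightarrow> (\<forall>k. vector_derivative (velocity c \<gamma>) (at t) $ k +
      (\<Sum>i\<in>UNIV. \<Sum>j\<in>UNIV. christoffel (metric M c) (snd c (\<gamma> t)) k i j * velocity c \<gamma> t $ i * velocity c \<gamma> t $ j) = 0)"
    using \<gamma> unfolding geodesic_def by blast
  from bspec[OF bspec[OF this c] t(1)] t(2) show ?thesis
    by (simp add: vec_eq_iff G.Gam_def)
qed

text \<open>The explicit solutions \<open>E\<close> of the linear equations satisfied by \<open>h1\<close> and \<open>h2\<close> along the geodesic tell
  where it has to be as long as it stays in the chart; if they remain in the image of the chart, it cannot leave.\<close>

lemma geodesic_stays_in_chart:
  fixes M :: "('a, 2) geometry"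
  assumes M: "lorentz_surface M" and c: "(C, \<phi>) \<in> atlas M" and \<gamma>: "geodesic M I \<gamma>" and L: "closed_segment a b \<subseteq> I"
    and ob: "metric2.obata (metric M (C, \<phi>)) (\<phi> ` C) K U h1" "metric2.obata (metric M (C, \<phi>)) (\<phi> ` C) K U h2"
    and H: "\<And>x. H x = vector [h1 x, h2 x]" "smooth_on U H" "inj_on H U" "\<And>x. x \<in> U \<Longrightarrow> det (jacobian_at H x) \<noteq> 0"
    and \<kappa>: "\<kappa> = K * \<epsilon>" "\<kappa> \<in> {- 1, 0, 1}"
    and start: "\<gamma> a \<in> C" "\<phi> (\<gamma> a) \<in> U" "form (metric M (C, \<phi>) (\<phi> (\<gamma> a))) (velocity (C, \<phi>) \<gamma> a) (velocity (C, \<phi>) \<gamma> a) = \<epsilon>"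
    and E: "\<And>u. E u = vector [cs \<kappa> (u - a) * h1 (\<phi> (\<gamma> a)) + sn \<kappa> (u - a) * metric2.differential h1 (\<phi> (\<gamma> a)) (velocity (C, \<phi>) \<gamma> a),
      cs \<kappa> (u - a) * h2 (\<phi> (\<gamma> a)) + sn \<kappa> (u - a) * metric2.differential h2 (\<phi> (\<gamma> a)) (velocity (C, \<phi>) \<gamma> a)]"
    and EU: "\<And>u. u \<in> closed_segment a b \<Longrightarrow> E u \<in> H ` U" and u: "u \<in> closed_segment a b"
  shows "\<gamma> u \<in> C \<and> \<phi> (\<gamma> u) \<in> U"
proof -
  have M1: "smooth_manifold M" using M pseudo_riemannianD(1) by (auto simp: lorentz_surface_def)
  have sc: "smooth_curve M I \<gamma>" using \<gamma> by (simp add: geodesic_def)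
  note C = is_chartD[OF smooth_manifoldD(2)[OF M1 c]] and cur = smooth_curve_chart[OF M1 sc c]
  interpret G: metric2 "metric M (C, \<phi>)" "\<phi> ` C" by (rule lorentz_surface_chart(1)[OF M c])
  have U: "open U" "U \<subseteq> \<phi> ` C" using ob by (auto simp: G.obata_def)
  note inv = smooth_inverse_function[OF U(1) H(2,3,4)]
  define P where "P = {p \<in> C. \<phi> p \<in> U}"
  have oP: "openin (mtop M) P" unfolding P_def by (rule C(5)[OF U(1)])
  let ?L = "closed_segment a b"
  define q where "q u = inv_into C \<phi> (inv_into U H (E u))" for u
  have qP: "q u \<in> P" if "u \<in> ?L" for u
  proof -
    have "inv_into U H (E u) \<in> U" using EU[OF that] by (rule inv_into_into)
    then show ?thesis using U(2) by (auto simp: P_def q_def inv_into_into f_inv_into_f)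
  qed
  have contE: "continuous_on ?L E"
  proof -
    show ?thesis
      unfolding E vector_2_axis
      by (intro continuous_intros continuous_on_compose2[OF continuous_on_cs_sn(1)[OF \<kappa>(2)]] continuous_on_compose2[OF continuous_on_cs_sn(2)[OF \<kappa>(2)]]) auto
  qed
  have contq: "continuous_map (top_of_set ?L) (mtop M) q"
  proof -
    have "continuous_on ?L (\<lambda>u. inv_into U H (E u))"
      by (rule continuous_on_compose2[OF smooth_onD(3)[OF inv(2)] contE]) (use EU in auto)
    then have 1: "continuous_map (top_of_set ?L) (top_of_set (\<phi> ` C)) (\<lambda>u. inv_into U H (E u))"
      using inv_into_into[OF EU] U(2) by (auto simp: continuous_map_in_subtopology)
    show ?thesis using continuous_map_compose[OF 1 C(7)] by (simp add: o_def q_def[abs_def])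
  qed
  have cont\<gamma>: "continuous_map (top_of_set ?L) (mtop M) \<gamma>"
    using sc L continuous_map_from_subtopology_mono by (auto simp: smooth_curve_def)
  \<comment> \<open>Two continuous maps into a Hausdorff space agree on a closed set. At a limit
    parameter the geodesic therefore equals \<open>q\<close>, which lies in the open set
    \<open>P\<close>.\<close>
  have closedB: "closedin (top_of_set ?L) {u \<in> ?L. \<gamma> u = q u}"
    using closedin_continuous_maps_eq[OF smooth_manifoldD(1)[OF M1] cont\<gamma> contq] by simp
  \<comment> \<open>The whole segment up to \<open>u\<close> is required to stay in
    \<open>P\<close>, because the explicit solutions hold at \<open>u\<close> only if the geodesic
    has not left the chart in between.\<close>
  define A where "A = {u \<in> ?L. \<forall>s\<in>closed_segment a u. \<gamma> s \<in> P}"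
  have AB: "A \<subseteq> {u \<in> ?L. \<gamma> u = q u}"
  proof
    fix u assume u: "u \<in> A"
    then have uL: "u \<in> ?L" and seg: "\<And>s. s \<in> closed_segment a u \<Longrightarrow> \<gamma> s \<in> P" by (auto simp: A_def)
    have segI: "closed_segment a u \<subseteq> I" using closed_segment_subset_real[OF uL] L by blast
    have "h (\<phi> (\<gamma> u)) = cs \<kappa> (u - a) * h (\<phi> (\<gamma> a)) + sn \<kappa> (u - a) * G.differential h (\<phi> (\<gamma> a)) (velocity (C, \<phi>) \<gamma> a)"
      if "G.obata K U h" for h
      by (rule G.obata_along_geodesic(1)[OF that \<kappa> _ cur(3) cur(4) geodesic_chart[OF M \<gamma> c] start(3)])
        (use seg segI in \<open>auto simp: P_def\<close>)
    from this[OF ob(1)] this[OF ob(2)] have "H (\<phi> (\<gamma> u)) = E u" by (simp add: H(1) E)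
    moreover have "\<gamma> u \<in> P" using seg by simp
    ultimately have "q u = \<gamma> u" using H(3) C(3) by (auto simp: q_def P_def simp flip: \<open>H (\<phi> (\<gamma> u)) = E u\<close>)
    then show "u \<in> {u \<in> ?L. \<gamma> u = q u}" using uL by simp
  qed
  have openA: "openin (top_of_set ?L) A"
    unfolding openin_contains_ball
  proof (intro conjI ballI)
    show "A \<subseteq> ?L" by (auto simp: A_def)
    fix u assume u: "u \<in> A"
    then have "u \<in> I" "\<gamma> u \<in> P" using L by (auto simp: A_def)
    then obtain e where e: "e > 0" "ball u e \<subseteq> {t \<in> I. \<gamma> t \<in> P}"
      using cur(2)[OF oP] unfolding open_contains_ball by blast
    have "ball u e \<inter> ?L \<subseteq> A"
    proof
      fix w assume w: "w \<in> ball u e \<inter> ?L"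
      have "\<gamma> s \<in> P" if s: "s \<in> closed_segment a w" for s
      proof (cases "s \<in> closed_segment a u")
        case False
        then have "s \<in> closed_segment u w" using s by (auto simp: closed_segment_eq_real_ivl split: if_splits)
        moreover have "closed_segment u w \<subseteq> ball u e" by (rule closed_segment_subset) (use w e in auto)
        ultimately show ?thesis using e(2) by auto
      qed (use u in \<open>auto simp: A_def\<close>)
      then show "w \<in> A" using w by (auto simp: A_def)
    qed
    then show "\<exists>e. 0 < e \<and> ball u e \<inter> ?L \<subseteq> A" using e(1) by blast
  qed
  have closedA: "closedin (top_of_set ?L) A"
    unfolding closedin_limpt
  proof (intro conjI allI impI)
    show "A \<subseteq> ?L" by (auto simp: A_def)
    fix u assume u: "u islimpt A \<and> u \<in> ?L"
    then have "\<gamma> u = q u" using closedB islimpt_subset[OF _ AB] unfolding closedin_limpt by blast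
    then have uP: "\<gamma> u \<in> P" using qP u by simp
    have "\<gamma> s \<in> P" if s: "s \<in> closed_segment a u" for s
    proof (cases "s = u")
      case False
      then have "0 < dist s u" by simp
      then obtain w where w: "w \<in> A" "dist w u < dist s u" using u unfolding islimpt_approachable by blast
      then have "s \<in> closed_segment a w" using s
        by (auto simp: closed_segment_eq_real_ivl dist_real_def abs_if split: if_splits)
      then show ?thesis using w by (auto simp: A_def)
    qed (use uP in simp)
    then show "u \<in> A" using u by (auto simp: A_def)
  qed
  have "a \<in> A" using start by (auto simp: A_def P_def)
  then have "A = ?L"
    using connected_clopen[of ?L] openA closedA by auto
  then have "\<gamma> u \<in> P" using u by (auto simp: A_def)
  then show ?thesis by (simp add: P_def)
qed

section \<open>Variations through geodesics\<close>

lemma DERIV_imp_eventually_close: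
  fixes f :: "real \<Rightarrow> real"
  assumes "(f has_real_derivative d) (at v0)" "e > 0"
  shows "\<forall>\<^sub>F v in nhds v0. \<bar>f v - f v0\<bar> < e"
proof -
  have "(f \<longlongrightarrow> f v0) (nhds v0)"
    using DERIV_isCont[OF assms(1)] by (simp add: isCont_def tendsto_nhds_iff)
  from tendstoD[OF this assms(2)] show ?thesis by (simp add: dist_real_def)
qed

lemma has_vector_derivative_transform_eventually:
  assumes "(f has_vector_derivative f') (at v0)" "\<forall>\<^sub>F v in nhds v0. f v = g v"
  shows "(g has_vector_derivative f') (at v0)"
proof -
  obtain S where "open S" "v0 \<in> S" "\<And>v. v \<in> S \<Longrightarrow> f v = g v"
    using assms(2) unfolding eventually_nhds by blast
  then show ?thesis using has_vector_derivative_transform_within_open[OF assms(1)] by blast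
qed

text \<open>Nothing is assumed about the dependence of \<open>x\<close> on \<open>v\<close>:
  \<open>geo\<close> only provides geodesics that reach \<open>u0\<close> for \<open>v\<close> near
  \<open>v0\<close>. The regularity needed at \<open>v0\<close> is what is carried along the
  geodesic.\<close>

locale geodesic_variation =
  fixes M :: "('a, 2) geometry" and K \<epsilon> \<kappa> :: real and x :: "real \<Rightarrow> real \<Rightarrow> 'a" and J :: "real \<Rightarrow> real set" and v0 u0 :: real
  assumes M: "lorentz_surface M" and K: "has_constant_curvature M K" "K \<in> {- 1, 0, 1}"
    and \<epsilon>: "\<epsilon> \<in> {- 1, 1}" and \<kappa>: "\<kappa> = K * \<epsilon>"
    and geo: "\<forall>\<^sub>F v in nhds v0. geodesic M (J v) (\<lambda>u. x u v) \<and> unit_speed M (J v) (\<lambda>u. x u v) \<and> closed_segment 0 u0 \<subseteq> J v"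
begin

lemma \<kappa>_cases: "\<kappa> \<in> {- 1, 0, 1}"
  using K \<epsilon> \<kappa> by auto

lemma manifold: "smooth_manifold M"
  using M pseudo_riemannianD(1) by (auto simp: lorentz_surface_def)

text \<open>The two factors are the solution of f'' = - \<open>\<kappa>\<close> f with f(0) = 1,
  f'(0) = 0 and its derivative. Nearby points must lie in \<open>C\<close>, for coordinates mean
  nothing outside it.\<close>

definition jacobi_chart :: "'a set \<Rightarrow> ('a \<Rightarrow> real^2) \<Rightarrow> real \<Rightarrow> bool" where
  "jacobi_chart C \<phi> u \<longleftrightarrow> (\<forall>\<^sub>F v in nhds v0. x u v \<in> C) \<and>
     metric2.jacobi (metric M (C, \<phi>)) (\<phi> ` C) \<epsilon> (cs \<kappa> u) (- \<kappa> * sn \<kappa> u) v0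
       (\<lambda>v. \<phi> (x u v)) (\<lambda>v. velocity (C, \<phi>) (\<lambda>s. x s v) u)"

lemma jacobi_chart_transition:
  assumes c: "(C, \<phi>) \<in> atlas M" and c': "(C', \<phi>') \<in> atlas M" and u: "u \<in> closed_segment 0 u0"
    and jac: "jacobi_chart C \<phi> u" and x: "x u v0 \<in> C'"
  shows "jacobi_chart C' \<phi>' u"
proof -
  note C = is_chartD[OF smooth_manifoldD(2)[OF manifold c]] and C' = is_chartD[OF smooth_manifoldD(2)[OF manifold c']]
  have g: "metric2 (metric M (C, \<phi>)) (\<phi> ` C)" "metric2 (metric M (C', \<phi>')) (\<phi>' ` C')"
    using lorentz_surface_chart(1)[OF M] c c' by blast+
  interpret A: metric2 "metric M (C, \<phi>)" "\<phi> ` C" by (rule g(1))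
  let ?\<tau> = "\<phi>' \<circ> inv_into C \<phi>" and ?D1 = "\<phi> ` (C \<inter> C')"
  have evC: "\<forall>\<^sub>F v in nhds v0. x u v \<in> C"
    and j: "A.jacobi \<epsilon> (cs \<kappa> u) (- \<kappa> * sn \<kappa> u) v0 (\<lambda>v. \<phi> (x u v)) (\<lambda>v. velocity (C, \<phi>) (\<lambda>s. x s v) u)"
    using jac by (auto simp: jacobi_chart_def)
  have xC: "x u v0 \<in> C" using eventually_nhds_x_imp_x[OF evC] .
  have oD: "open ?D1" using C(4)[of "C \<inter> C'"] C(1) C'(1) by auto
  \<comment> \<open>Differentiability in the old chart implies continuity, so for \<open>v\<close>
    near \<open>v0\<close> the point also lies in the new chart.\<close>
  obtain w where "((\<lambda>v. \<phi> (x u v)) has_vector_derivative w) (at v0)" using j by (auto simp: A.jacobi_def)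
  then have "continuous (at v0) (\<lambda>v. \<phi> (x u v))" using has_vector_derivative_continuous by blast
  then have "((\<lambda>v. \<phi> (x u v)) \<longlongrightarrow> \<phi> (x u v0)) (nhds v0)" by (simp add: continuous_at tendsto_nhds_iff)
  then have "\<forall>\<^sub>F v in nhds v0. \<phi> (x u v) \<in> ?D1" using oD xC x by (intro topological_tendstoD) auto
  then have evC': "\<forall>\<^sub>F v in nhds v0. x u v \<in> C'"
    using evC by eventually_elim (use C(3) in \<open>auto simp: inj_on_def\<close>)
  have "metric2.jacobi (metric M (C', \<phi>')) (\<phi>' ` C') \<epsilon> (cs \<kappa> u) (- \<kappa> * sn \<kappa> u) v0 (\<lambda>v. \<phi>' (x u v)) (\<lambda>v. velocity (C', \<phi>') (\<lambda>s. x s v) u)"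
  proof (rule jacobi_transform[OF g oD _ smooth_manifoldD(4)[OF manifold c c'] _ _ _ j])
    show "?\<tau> ` ?D1 \<subseteq> \<phi>' ` C'" using C(3) by auto
    show "metric M (C, \<phi>) y = transpose (jacobian_at ?\<tau> y) ** metric M (C', \<phi>') (?\<tau> y) ** jacobian_at ?\<tau> y" if "y \<in> ?D1" for y
    proof -
      obtain p where "p \<in> C \<inter> C'" "y = \<phi> p" using \<open>y \<in> ?D1\<close> by blast
      then show ?thesis
        using pseudo_riemannianD(6)[OF _ c c'] M C(3) by (simp add: lorentz_surface_def)
    qed
    show "\<forall>\<^sub>F v in nhds v0. \<phi>' (x u v) = ?\<tau> (\<phi> (x u v)) \<and> velocity (C', \<phi>') (\<lambda>s. x s v) u = jacobian_at ?\<tau> (\<phi> (x u v)) *v velocity (C, \<phi>) (\<lambda>s. x s v) u"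
      using evC evC' geo
    proof eventually_elim
      case (elim v)
      then have "smooth_curve M (J v) (\<lambda>s. x s v)" "u \<in> J v" using u by (auto simp: geodesic_def)
      then show ?case using velocity_transition[OF manifold _ c c', of "J v" "\<lambda>s. x s v" u] elim C(3) by simp
    qed
  qed (use xC x in auto)
  then show ?thesis using evC' by (simp add: jacobi_chart_def)
qed

text \<open>The values and slopes of solutions at \<open>u2\<close> are explicit linear expressions
  in their values and slopes at \<open>u1\<close>, hence differentiable in \<open>v\<close>. Two
  solutions serve as coordinates, so position and velocity at \<open>u2\<close> are differentiable
  too, and their derivatives are identified by testing with dh1 and dh2.\<close>

lemma jacobi_chart_step:
  assumes c: "(C, \<phi>) \<in> atlas M"
    and ob: "metric2.obata (metric M (C, \<phi>)) (\<phi> ` C) K U h1" "metric2.obata (metric M (C, \<phi>)) (\<phi> ` C) K U h2"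
    and inj: "inj_on (\<lambda>y. vector [h1 y, h2 y] :: real^2) U"
    and W: "\<And>y. y \<in> U \<Longrightarrow> partial_deriv 1 h1 y * partial_deriv 2 h2 y - partial_deriv 2 h1 y * partial_deriv 1 h2 y \<noteq> 0"
    and L: "closed_segment u1 u2 \<subseteq> closed_segment 0 u0" and xL: "\<And>u. u \<in> closed_segment u1 u2 \<Longrightarrow> x u v0 \<in> C \<and> \<phi> (x u v0) \<in> U"
    and jac: "jacobi_chart C \<phi> u1"
  shows "jacobi_chart C \<phi> u2"
proof -
  let ?L = "closed_segment u1 u2"
  interpret G: metric2 "metric M (C, \<phi>)" "\<phi> ` C" by (rule lorentz_surface_chart(1)[OF M c])
  let ?g = "metric M (C, \<phi>)"
  note C = is_chartD[OF smooth_manifoldD(2)[OF manifold c]]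
  have neg: "det (?g y) < 0" if "y \<in> \<phi> ` C" for y by (rule lorentz_surface_chart(2)[OF M c that])
  have U: "open U" "U \<subseteq> \<phi> ` C" using ob by (auto simp: G.obata_def)
  define H where "H y = (vector [h1 y, h2 y] :: real^2)" for y
  have smH: "smooth_on U H"
    unfolding H_def[abs_def] by (rule smooth_on_vector_2) (rule U(1) G.obata_partial_deriv(1)[OF ob(1)] G.obata_partial_deriv(1)[OF ob(2)])+
  have jH: "jacobian_at H y $ 1 $ i = partial_deriv i h1 y" "jacobian_at H y $ 2 $ i = partial_deriv i h2 y" if "y \<in> U" for y i
    unfolding H_def[abs_def] by (rule jacobian_at_vector_2; rule U(1) G.obata_partial_deriv(1)[OF ob(1)] G.obata_partial_deriv(1)[OF ob(2)] that)+
  have detH: "det (jacobian_at H y) \<noteq> 0" if "y \<in> U" for y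
    using W[OF that] unfolding det_2 jH[OF that] .
  have injH: "inj_on H U" using inj by (simp add: H_def[abs_def])
  note inv = smooth_inverse_function[OF U(1) smH injH detH]
  define X where "X u v = \<phi> (x u v)" for u v
  define V where "V u v = velocity (C, \<phi>) (\<lambda>s. x s v) u" for u v
  have evC: "\<forall>\<^sub>F v in nhds v0. x u1 v \<in> C" using jac by (simp add: jacobi_chart_def)
  have "G.jacobi \<epsilon> (cs \<kappa> u1) (- \<kappa> * sn \<kappa> u1) v0 (X u1) (V u1)"
    using jac by (simp add: jacobi_chart_def X_def[abs_def] V_def[abs_def])
  then obtain N1 \<xi>1 where dX1: "(X u1 has_vector_derivative cs \<kappa> u1 *\<^sub>R N1) (at v0)" and dV1: "(V u1 has_vector_derivative \<xi>1) (at v0)"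
    and cov1: "\<xi>1 + G.Gam (X u1 v0) (cs \<kappa> u1 *\<^sub>R N1) (V u1 v0) = (- \<kappa> * sn \<kappa> u1) *\<^sub>R N1"
    and forms1: "form (?g (X u1 v0)) (V u1 v0) (V u1 v0) = \<epsilon>" "form (?g (X u1 v0)) (V u1 v0) N1 = 0" "form (?g (X u1 v0)) N1 N1 = - \<epsilon>"
    unfolding G.jacobi_def by blast
  have X1U: "X u1 v0 \<in> U" and X1D: "X u1 v0 \<in> \<phi> ` C" using xL[of u1] by (auto simp: X_def)
  have X2U: "X u2 v0 \<in> U" and X2D: "X u2 v0 \<in> \<phi> ` C" using xL[of u2] by (auto simp: X_def)
  \<comment> \<open>Value and slope predicted at \<open>u\<close> from the data at
    \<open>u1\<close>; they are defined whether or not the geodesic is still in the chart.\<close>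
  define val where "val h u v = cs \<kappa> (u - u1) * h (X u1 v) + sn \<kappa> (u - u1) * G.differential h (X u1 v) (V u1 v)" for h u v
  define slope where "slope h u v = - \<kappa> * sn \<kappa> (u - u1) * h (X u1 v) + cs \<kappa> (u - u1) * G.differential h (X u1 v) (V u1 v)" for h u v
  \<comment> \<open>Both the value and the slope at \<open>u1\<close> vary with \<open>v\<close>
    proportionally to dh(N), with factors f(u1) and f'(u1). The addition theorems turn these into
    the factors at \<open>u2\<close>.\<close>
  define n where "n h = G.differential h (X u1 v0) N1" for h
  have da: "((\<lambda>v. h (X u1 v)) has_real_derivative cs \<kappa> u1 * n h) (at v0)"
    and db: "((\<lambda>v. G.differential h (X u1 v) (V u1 v)) has_real_derivative - \<kappa> * sn \<kappa> u1 * n h) (at v0)"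
    if h: "G.obata K U h" for h
    using G.obata_along_curve[OF h X1U dX1 dV1] G.form_commute[OF X1D, of N1 "V u1 v0"]
    by (simp_all add: cov1 G.differential_linear G.form_linear forms1 n_def)
  have cs2: "cs \<kappa> u2 = cs \<kappa> (u2 - u1) * cs \<kappa> u1 - \<kappa> * (sn \<kappa> (u2 - u1) * sn \<kappa> u1)"
    and sn2: "sn \<kappa> u2 = sn \<kappa> (u2 - u1) * cs \<kappa> u1 + cs \<kappa> (u2 - u1) * sn \<kappa> u1"
    using cs_sn_add[OF \<kappa>_cases, of "u2 - u1" u1] by simp_all
  have dval: "((\<lambda>v. val h u2 v) has_real_derivative cs \<kappa> u2 * n h) (at v0)" if h: "G.obata K U h" for h
    unfolding val_def
    by (rule DERIV_cong[OF DERIV_add[OF DERIV_cmult[OF da[OF h]] DERIV_cmult[OF db[OF h]]]]) (simp add: cs2 algebra_simps)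
  have dslope: "((\<lambda>v. slope h u2 v) has_real_derivative - \<kappa> * sn \<kappa> u2 * n h) (at v0)" if h: "G.obata K U h" for h
    unfolding slope_def
    by (rule DERIV_cong[OF DERIV_add[OF DERIV_cmult[OF da[OF h]] DERIV_cmult[OF db[OF h]]]]) (simp add: sn2 algebra_simps)
  have along: "h (X u v) = val h u v \<and> G.differential h (X u v) (V u v) = slope h u v"
    if h: "G.obata K U h" and v: "geodesic M (J v) (\<lambda>u. x u v)" "closed_segment 0 u0 \<subseteq> J v"
      "\<And>u. u \<in> ?L \<Longrightarrow> x u v \<in> C \<and> X u v \<in> U" "form (?g (X u1 v)) (V u1 v) (V u1 v) = \<epsilon>" and u: "u \<in> ?L" for h u v
  proof -
    have sc: "smooth_curve M (J v) (\<lambda>u. x u v)" using v(1) by (simp add: geodesic_def)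
    have inJ: "t \<in> J v" "x t v \<in> C" "\<phi> (x t v) \<in> U" if "t \<in> ?L" for t using that L v(2,3) by (auto simp: X_def)
    note r = G.obata_along_geodesic[OF h \<kappa> \<kappa>_cases inJ(3) smooth_curve_chart(3)[OF manifold sc c inJ(1,2)]
      smooth_curve_chart(4)[OF manifold sc c inJ(1,2)] geodesic_chart[OF M v(1) c inJ(1,2)] v(4)[unfolded X_def V_def] u]
    then show ?thesis by (simp add: val_def slope_def X_def V_def)
  qed
  note geo0 = eventually_nhds_x_imp_x[OF geo]
  have along0: "h (X u v0) = val h u v0" if "G.obata K U h" "u \<in> ?L" for h u
    using along[OF that(1) _ _ _ forms1(1) that(2)] geo0 xL by (auto simp: X_def)
  define E where "E u v = (vector [val h1 u v, val h2 u v] :: real^2)" for u v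
  have E0: "E u v0 \<in> H ` U" if "u \<in> ?L" for u
  proof (rule image_eqI)
    show "E u v0 = H (X u v0)" using along0[OF ob(1) that] along0[OF ob(2) that] by (simp add: E_def H_def)
  qed (use xL[OF that] in \<open>simp add: X_def\<close>)
  have cE: "continuous_on ?L (\<lambda>u. E u v0)"
    unfolding E_def vector_2_axis val_def
    by (intro continuous_intros continuous_on_compose2[OF continuous_on_cs_sn(1)[OF \<kappa>_cases]] continuous_on_compose2[OF continuous_on_cs_sn(2)[OF \<kappa>_cases]]) auto
  obtain \<delta> where \<delta>: "\<delta> > 0" "(\<Union>y\<in>(\<lambda>u. E u v0) ` ?L. ball y \<delta>) \<subseteq> H ` U"
    by (rule compact_subset_open_imp_ball_epsilon_subset[of "(\<lambda>u. E u v0) ` ?L" "H ` U"])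
      (use compact_continuous_image[OF cE] inv(1) E0 in auto)
  obtain B where B: "B > 0" "\<And>u. u \<in> ?L \<Longrightarrow> \<bar>cs \<kappa> (u - u1)\<bar> \<le> B" "\<And>u. u \<in> ?L \<Longrightarrow> \<bar>sn \<kappa> (u - u1)\<bar> \<le> B"
  proof -
    have "bounded ((\<lambda>u. cs \<kappa> (u - u1)) ` ?L)" "bounded ((\<lambda>u. sn \<kappa> (u - u1)) ` ?L)"
      by (intro compact_imp_bounded compact_continuous_image compact_segment continuous_intros
          continuous_on_compose2[OF continuous_on_cs_sn(1)[OF \<kappa>_cases]] continuous_on_compose2[OF continuous_on_cs_sn(2)[OF \<kappa>_cases]]; auto)+
    then obtain B1 B2 where "\<forall>u\<in>?L. \<bar>cs \<kappa> (u - u1)\<bar> \<le> B1" "\<forall>u\<in>?L. \<bar>sn \<kappa> (u - u1)\<bar> \<le> B2"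
      by (auto simp: bounded_iff)
    then show thesis by (intro that[of "max 1 (max B1 B2)"]) fastforce+
  qed
  \<comment> \<open>Two components with two terms each, every term below \<open>B * e\<close>, add
    up to less than \<open>\<delta>\<close>.\<close>
  define e where "e = \<delta> / (4 * B)"
  have e: "e > 0" using B \<delta> by (simp add: e_def)
  have evE: "\<forall>\<^sub>F v in nhds v0. \<forall>u\<in>?L. E u v \<in> H ` U"
    using DERIV_imp_eventually_close[OF da[OF ob(1)] e] DERIV_imp_eventually_close[OF da[OF ob(2)] e]
      DERIV_imp_eventually_close[OF db[OF ob(1)] e] DERIV_imp_eventually_close[OF db[OF ob(2)] e]
  proof eventually_elim
    case (elim v)
    show ?case
    proof
      fix u assume u: "u \<in> ?L"
      have bd: "\<bar>val h u v - val h u v0\<bar> < 2 * B * e"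
        if "\<bar>h (X u1 v) - h (X u1 v0)\<bar> < e" "\<bar>G.differential h (X u1 v) (V u1 v) - G.differential h (X u1 v0) (V u1 v0)\<bar> < e" for h
      proof -
        have "val h u v - val h u v0 = cs \<kappa> (u - u1) * (h (X u1 v) - h (X u1 v0))
            + sn \<kappa> (u - u1) * (G.differential h (X u1 v) (V u1 v) - G.differential h (X u1 v0) (V u1 v0))"
          by (simp add: val_def algebra_simps)
        also have "\<bar>\<dots>\<bar> \<le> B * \<bar>h (X u1 v) - h (X u1 v0)\<bar>
            + B * \<bar>G.differential h (X u1 v) (V u1 v) - G.differential h (X u1 v0) (V u1 v0)\<bar>"
          by (rule order_trans[OF abs_triangle_ineq]) (unfold abs_mult, intro add_mono mult_right_mono B u abs_ge_zero)
        also have "\<dots> < B * e + B * e"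
          using that B(1) by (intro add_strict_mono mult_strict_left_mono)
        finally show ?thesis by simp
      qed
      have "dist (E u v0) (E u v) \<le> \<bar>val h1 u v - val h1 u v0\<bar> + \<bar>val h2 u v - val h2 u v0\<bar>"
        unfolding dist_norm using norm_le_l1_cart[of "E u v0 - E u v"] by (simp add: sum_2 E_def abs_minus_commute)
      also have "\<dots> < 2 * B * e + 2 * B * e"
        using bd[of h1] bd[of h2] elim by (intro add_strict_mono) auto
      also have "\<dots> = \<delta>" using B by (simp add: e_def)
      finally have "E u v \<in> ball (E u v0) \<delta>" by simp
      then show "E u v \<in> H ` U" using \<delta>(2) u by blast
    qed
  qed
  have evU: "\<forall>\<^sub>F v in nhds v0. X u1 v \<in> U"
  proof -
    have "continuous (at v0) (X u1)" using dX1 has_vector_derivative_continuous by blast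
    then have "(X u1 \<longlongrightarrow> X u1 v0) (nhds v0)" by (simp add: continuous_at tendsto_nhds_iff)
    then show ?thesis using U(1) X1U by (rule topological_tendstoD)
  qed
  \<comment> \<open>Unit speed leaves only the values 1 and -1, which are 2 apart; staying within
    distance 1 of the value at \<open>v0\<close> fixes the sign.\<close>
  have ev\<epsilon>: "\<forall>\<^sub>F v in nhds v0. form (?g (X u1 v)) (V u1 v) (V u1 v) = \<epsilon>"
    using DERIV_imp_eventually_close[OF G.form_along_curve[OF X1D dX1 dV1 dV1] zero_less_one] evC geo
  proof eventually_elim
    case (elim v)
    have "u1 \<in> J v" using elim L by auto
    then have "tangent_inner M (C, \<phi>) (x u1 v) (V u1 v) (V u1 v) \<in> {1, -1}"
      using elim c unfolding unit_speed_def V_def by fastforce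
    then have "form (?g (X u1 v)) (V u1 v) (V u1 v) \<in> {1, -1}" by (simp add: tangent_inner_def X_def)
    then show ?case using elim \<epsilon> forms1(1) by auto
  qed
  have good: "\<forall>\<^sub>F v in nhds v0. (\<forall>u\<in>?L. x u v \<in> C \<and> X u v \<in> U) \<and> (\<forall>h. G.obata K U h \<longrightarrow> h (X u2 v) = val h u2 v \<and> G.differential h (X u2 v) (V u2 v) = slope h u2 v)"
    using evE evU ev\<epsilon> evC geo
  proof eventually_elim
    case (elim v)
    have stay: "x u v \<in> C \<and> X u v \<in> U" if "u \<in> ?L" for u
      unfolding X_def
      by (rule geodesic_stays_in_chart[OF M c _ _ ob H_def smH injH detH \<kappa> \<kappa>_cases, of "J v" "\<lambda>u. x u v" u1 u2 "\<lambda>u. E u v"])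
        (use elim L that in \<open>auto simp: X_def V_def E_def val_def\<close>)
    moreover have "h (X u2 v) = val h u2 v \<and> G.differential h (X u2 v) (V u2 v) = slope h u2 v" if "G.obata K U h" for h
      by (rule along[OF that]) (use elim stay in auto)
    ultimately show ?case by blast
  qed
  have dE: "((\<lambda>v. E u2 v) has_vector_derivative vector [cs \<kappa> u2 * n h1, cs \<kappa> u2 * n h2]) (at v0)"
  proof (rule has_vector_derivative_vec_2)
    show "((\<lambda>v. E u2 v $ k) has_real_derivative (vector [cs \<kappa> u2 * n h1, cs \<kappa> u2 * n h2] :: real^2) $ k) (at v0)" for k
      using exhaust_2[of k] dval[OF ob(1)] dval[OF ob(2)] by (auto simp: E_def)
  qed
  obtain w where dX2: "(X u2 has_vector_derivative w) (at v0)"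
  proof -
    have "((\<lambda>v. inv_into U H (E u2 v)) has_derivative
      (\<lambda>t. frechet_derivative (inv_into U H) (at (E u2 v0)) (t *\<^sub>R vector [cs \<kappa> u2 * n h1, cs \<kappa> u2 * n h2]))) (at v0)"
      by (rule has_derivative_compose[OF dE[unfolded has_vector_derivative_def] smooth_onD(1)[OF inv(2)]]) (rule E0[OF ends_in_segment(2)] | assumption)+
    then have "(\<lambda>v. inv_into U H (E u2 v)) differentiable (at v0)" by (auto simp: differentiable_def)
    then have "((\<lambda>v. inv_into U H (E u2 v)) has_vector_derivative vector_derivative (\<lambda>v. inv_into U H (E u2 v)) (at v0)) (at v0)"
      by (simp add: vector_derivative_works)
    moreover have "\<forall>\<^sub>F v in nhds v0. inv_into U H (E u2 v) = X u2 v"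
      using good
    proof eventually_elim
      case (elim v)
      then have "H (X u2 v) = E u2 v" "X u2 v \<in> U" using ob by (auto simp: H_def E_def)
      then show ?case using injH by (metis inv_into_f_f)
    qed
    ultimately show thesis using that has_vector_derivative_transform_eventually by blast
  qed
  \<comment> \<open>The velocity at \<open>u2\<close> solves the linear system dhi(V) =
    \<open>slope\<close> of \<open>hi\<close>. Cramer's rule with this determinant exhibits it as a
    differentiable function of \<open>v\<close>.\<close>
  define Wf where "Wf y = partial_deriv 1 h1 y * partial_deriv 2 h2 y - partial_deriv 2 h1 y * partial_deriv 1 h2 y" for y
  obtain \<xi>2 where dV2: "(V u2 has_vector_derivative \<xi>2) (at v0)"
  proof -
    note d = G.smooth_on_along_curve[OF G.obata_partial_deriv(2)[OF ob(1)] X2U dX2]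
      G.smooth_on_along_curve[OF G.obata_partial_deriv(2)[OF ob(2)] X2U dX2] dslope[OF ob(1)] dslope[OF ob(2)]
    have nz: "partial_deriv 1 h1 (X u2 v0) * partial_deriv 2 h2 (X u2 v0) - partial_deriv 2 h1 (X u2 v0) * partial_deriv 1 h2 (X u2 v0) \<noteq> 0"
      by (rule W[OF X2U])
    have "\<exists>c. ((\<lambda>v. (partial_deriv 2 h2 (X u2 v) * slope h1 u2 v - partial_deriv 2 h1 (X u2 v) * slope h2 u2 v) / Wf (X u2 v)) has_real_derivative c) (at v0)"
      unfolding Wf_def by (intro exI) (rule derivative_eq_intros d refl nz)+
    then obtain c1 where c1: "((\<lambda>v. (partial_deriv 2 h2 (X u2 v) * slope h1 u2 v - partial_deriv 2 h1 (X u2 v) * slope h2 u2 v) / Wf (X u2 v)) has_real_derivative c1) (at v0)" ..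
    have "\<exists>c. ((\<lambda>v. (partial_deriv 1 h1 (X u2 v) * slope h2 u2 v - partial_deriv 1 h2 (X u2 v) * slope h1 u2 v) / Wf (X u2 v)) has_real_derivative c) (at v0)"
      unfolding Wf_def by (intro exI) (rule derivative_eq_intros d refl nz)+
    then obtain c2 where c2: "((\<lambda>v. (partial_deriv 1 h1 (X u2 v) * slope h2 u2 v - partial_deriv 1 h2 (X u2 v) * slope h1 u2 v) / Wf (X u2 v)) has_real_derivative c2) (at v0)" ..
    let ?V = "\<lambda>v. vector [(partial_deriv 2 h2 (X u2 v) * slope h1 u2 v - partial_deriv 2 h1 (X u2 v) * slope h2 u2 v) / Wf (X u2 v),
        (partial_deriv 1 h1 (X u2 v) * slope h2 u2 v - partial_deriv 1 h2 (X u2 v) * slope h1 u2 v) / Wf (X u2 v)] :: real^2"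
    have "(?V has_vector_derivative vector [c1, c2]) (at v0)"
    proof (rule has_vector_derivative_vec_2)
      show "((\<lambda>v. ?V v $ k) has_real_derivative (vector [c1, c2] :: real^2) $ k) (at v0)" for k
        using exhaust_2[of k] c1 c2 by auto
    qed
    moreover have "\<forall>\<^sub>F v in nhds v0. ?V v = V u2 v"
      using good
    proof eventually_elim
      case (elim v)
      then have s: "slope h1 u2 v = G.differential h1 (X u2 v) (V u2 v)" "slope h2 u2 v = G.differential h2 (X u2 v) (V u2 v)"
        and XU: "X u2 v \<in> U" using ob by auto
      have "Wf (X u2 v) \<noteq> 0" using W[OF XU] by (simp add: Wf_def)
      then show ?case
        unfolding s G.differential_def sum_2 by (simp add: vec_eq_iff forall_2 divide_eq_eq) (simp add: Wf_def algebra_simps)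
    qed
    ultimately show thesis using that has_vector_derivative_transform_eventually by blast
  qed
  \<comment> \<open>The unit normal at \<open>u1\<close> is \<open>rot\<close> up to sign. The same
    sign times \<open>rot\<close> at \<open>u2\<close> is the parallel normal, on which every dh
    keeps its value.\<close>
  have N: "\<exists>N2. (\<forall>h. G.obata K U h \<longrightarrow> G.differential h (X u2 v0) N2 = n h) \<and>
     form (?g (X u2 v0)) (V u2 v0) (V u2 v0) = \<epsilon> \<and> form (?g (X u2 v0)) (V u2 v0) N2 = 0 \<and> form (?g (X u2 v0)) N2 N2 = - \<epsilon>"
  proof -
    define P where "P = {p \<in> C. \<phi> p \<in> U}"
    have oP: "openin (mtop M) P" unfolding P_def by (rule C(5)[OF U(1)])
    have gd: "geodesic M (J v0) (\<lambda>u. x u v0)" and LJ: "closed_segment 0 u0 \<subseteq> J v0" using geo0 by auto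
    have sc: "smooth_curve M (J v0) (\<lambda>u. x u v0)" using gd by (simp add: geodesic_def)
    define S where "S = {u \<in> J v0. x u v0 \<in> P}"
    have oS: "open S" unfolding S_def by (rule smooth_curve_chart(2)[OF manifold sc c oP])
    have LS: "?L \<subseteq> S" using L LJ xL by (auto simp: S_def P_def)
    have S: "t \<in> J v0" "x t v0 \<in> C" "\<phi> (x t v0) \<in> U" if "t \<in> S" for t using that by (auto simp: S_def P_def)
    have \<epsilon>0: "\<epsilon> \<noteq> 0" using \<epsilon> by auto
    have r: "G.differential h (X u2 v0) (G.rot (X u2 v0) (V u2 v0)) = G.differential h (X u1 v0) (G.rot (X u1 v0) (V u1 v0))"
      if h: "G.obata K U h" for h
      unfolding X_def V_def
      by (rule G.rot_differential_constant[OF h oS LS S(3) smooth_curve_chart(3)[OF manifold sc c S(1,2)]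
        smooth_curve_chart(4)[OF manifold sc c S(1,2)] geodesic_chart[OF M gd c S(1,2)] neg forms1(1)[unfolded X_def V_def] \<epsilon>0])
    have f2: "form (?g (X u2 v0)) (V u2 v0) (V u2 v0) = \<epsilon>"
      using G.speed_constant[of u1 u2 "\<lambda>u. \<phi> (x u v0)" "velocity (C, \<phi>) (\<lambda>u. x u v0)", OF _ smooth_curve_chart(3)[OF manifold sc c S(1,2)]
          smooth_curve_chart(4)[OF manifold sc c S(1,2)] geodesic_chart[OF M gd c S(1,2)], of u2] LS S forms1(1) U(2)
      by (auto simp: X_def V_def)
    have rot2: "form (?g (X u2 v0)) (V u2 v0) (G.rot (X u2 v0) (V u2 v0)) = 0"
      "form (?g (X u2 v0)) (G.rot (X u2 v0) (V u2 v0)) (G.rot (X u2 v0) (V u2 v0)) = - \<epsilon>"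
      using G.form_rot[OF X2D neg[OF X2D], of "V u2 v0"] f2 by auto
    have "\<exists>s. N1 = s *\<^sub>R G.rot (X u1 v0) (V u1 v0) \<and> s * s = 1"
      using G.normal_eq_rot[OF X1D neg[OF X1D] forms1(1) \<epsilon>0 forms1(2,3)]
      by (auto intro: exI[of _ 1] exI[of _ "- 1"])
    then obtain s where s: "N1 = s *\<^sub>R G.rot (X u1 v0) (V u1 v0)" "s * s = 1" by blast
    show ?thesis
      by (intro exI[of _ "s *\<^sub>R G.rot (X u2 v0) (V u2 v0)"])
        (use r rot2 f2 s(2) in \<open>auto simp: n_def s(1) G.differential_linear G.form_linear mult.assoc[symmetric]\<close>)
  qed
  then obtain N2 where N2: "\<And>h. G.obata K U h \<Longrightarrow> G.differential h (X u2 v0) N2 = n h"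
    and forms2: "form (?g (X u2 v0)) (V u2 v0) (V u2 v0) = \<epsilon>" "form (?g (X u2 v0)) (V u2 v0) N2 = 0" "form (?g (X u2 v0)) N2 N2 = - \<epsilon>"
    by blast
  \<comment> \<open>Since dh1 and dh2 are independent, an identity between vectors at this point can
    be tested on \<open>h1\<close> and \<open>h2\<close>.\<close>
  have zero: "y = 0" if "G.differential h1 (X u2 v0) y = 0" "G.differential h2 (X u2 v0) y = 0" for y
  proof -
    have "jacobian_at H (X u2 v0) *v y = 0"
      using that by (simp add: vec_eq_iff forall_2 matrix_vector_mult_def jH[OF X2U] G.differential_def)
    then show ?thesis using matrix_vector_mult_eq_0 detH[OF X2U] by blast
  qed
  have ev1: "\<forall>\<^sub>F v in nhds v0. val h u2 v = h (X u2 v)" and ev2: "\<forall>\<^sub>F v in nhds v0. slope h u2 v = G.differential h (X u2 v) (V u2 v)"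
    if "G.obata K U h" for h
    using good that by (auto elim: eventually_mono)
  have w: "w = cs \<kappa> u2 *\<^sub>R N2"
  proof -
    have "G.differential h (X u2 v0) w = cs \<kappa> u2 * n h" if h: "G.obata K U h" for h
    proof (rule DERIV_unique[OF G.obata_along_curve(1)[OF h X2U dX2 dV2]])
      show "((\<lambda>v. h (X u2 v)) has_real_derivative cs \<kappa> u2 * n h) (at v0)"
        using dval[OF h] DERIV_cong_ev[OF refl ev1[OF h] refl] by blast
    qed
    then have "w - cs \<kappa> u2 *\<^sub>R N2 = 0"
      using ob by (intro zero) (simp_all add: G.differential_linear N2)
    then show ?thesis by simp
  qed
  have "\<xi>2 + G.Gam (X u2 v0) (cs \<kappa> u2 *\<^sub>R N2) (V u2 v0) = (- \<kappa> * sn \<kappa> u2) *\<^sub>R N2"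
  proof -
    have fw: "form (?g (X u2 v0)) w (V u2 v0) = 0"
      using forms2(2) G.form_commute[OF X2D, of N2] by (simp add: w G.form_linear)
    have "G.differential h (X u2 v0) (\<xi>2 + G.Gam (X u2 v0) w (V u2 v0)) = - \<kappa> * sn \<kappa> u2 * n h" if h: "G.obata K U h" for h
    proof -
      have "((\<lambda>v. G.differential h (X u2 v) (V u2 v)) has_real_derivative - \<kappa> * sn \<kappa> u2 * n h) (at v0)"
        using dslope[OF h] DERIV_cong_ev[OF refl ev2[OF h] refl] by blast
      from DERIV_unique[OF G.obata_along_curve(2)[OF h X2U dX2 dV2] this] show ?thesis by (simp add: fw)
    qed
    then have d: "G.differential h (X u2 v0) ((\<xi>2 + G.Gam (X u2 v0) w (V u2 v0)) - (- \<kappa> * sn \<kappa> u2) *\<^sub>R N2) = 0"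
      if "G.obata K U h" for h
      unfolding G.differential_linear(2,3) N2[OF that] using that by simp
    have "(\<xi>2 + G.Gam (X u2 v0) w (V u2 v0)) - (- \<kappa> * sn \<kappa> u2) *\<^sub>R N2 = 0"
      by (rule zero[OF d[OF ob(1)] d[OF ob(2)]])
    then show ?thesis by (simp only: w right_minus_eq)
  qed
  then have "G.jacobi \<epsilon> (cs \<kappa> u2) (- \<kappa> * sn \<kappa> u2) v0 (X u2) (V u2)"
    unfolding G.jacobi_def using X2D dX2[unfolded w] dV2 forms2 by blast
  moreover have "\<forall>\<^sub>F v in nhds v0. x u2 v \<in> C" using good by (rule eventually_mono) auto
  ultimately show ?thesis by (simp add: jacobi_chart_def X_def[abs_def] V_def[abs_def])
qed

text \<open>Around each parameter the geodesic stays for a while in one domain where two solutions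
  are coordinates, so the property is locally constant along the connected segment. Demanding it in
  all charts at once makes it independent of the chart used for a step.\<close>

lemma jacobi_chart_everywhere:
  assumes base: "\<And>C \<phi>. (C, \<phi>) \<in> atlas M \<Longrightarrow> x 0 v0 \<in> C \<Longrightarrow> jacobi_chart C \<phi> 0"
    and u: "u \<in> closed_segment 0 u0" and c: "(C, \<phi>) \<in> atlas M" "x u v0 \<in> C"
  shows "jacobi_chart C \<phi> u"
proof -
  let ?S = "closed_segment 0 u0"
  define P where "P u \<longleftrightarrow> (\<forall>C \<phi>. (C, \<phi>) \<in> atlas M \<longrightarrow> x u v0 \<in> C \<longrightarrow> jacobi_chart C \<phi> u)" for u
  note geo0 = eventually_nhds_x_imp_x[OF geo]
  have sc: "smooth_curve M (J v0) (\<lambda>u. x u v0)" using geo0 by (simp add: geodesic_def)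
  have SJ: "?S \<subseteq> J v0" using geo0 by simp
  have "P u"
  proof (rule connected_induction_simple[of ?S 0 u P])
    show "P 0" using base by (simp add: P_def)
    fix a assume a: "a \<in> ?S"
    have "continuous_map (top_of_set (J v0)) (mtop M) (\<lambda>u. x u v0)" using sc by (simp add: smooth_curve_def)
    then have "x a v0 \<in> topspace (mtop M)" using a SJ by (auto simp: continuous_map_def)
    then obtain C \<phi> where c: "(C, \<phi>) \<in> atlas M" "x a v0 \<in> C" using smooth_manifoldD(3)[OF manifold] by blast
    interpret G: metric2 "metric M (C, \<phi>)" "\<phi> ` C" by (rule lorentz_surface_chart(1)[OF M c(1)])
    have x0: "\<phi> (x a v0) \<in> \<phi> ` C" using c by simp
    obtain U h1 h2 where U: "\<phi> (x a v0) \<in> U" and ob: "G.obata K U h1" "G.obata K U h2"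
      and inj: "inj_on (\<lambda>y. vector [h1 y, h2 y] :: real^2) U"
      and W: "\<And>y. y \<in> U \<Longrightarrow> partial_deriv 1 h1 y * partial_deriv 2 h2 y - partial_deriv 2 h1 y * partial_deriv 1 h2 y \<noteq> 0"
      by (rule G.obata_immersion_exists[OF lorentz_surface_chart(3)[OF M c(1) K(1)] K(2) x0 lorentz_surface_chart(2)[OF M c(1) x0]])
        (rule that; assumption)
    have oU: "open U" using ob by (simp add: G.obata_def)
    define S0 where "S0 = {u \<in> J v0. x u v0 \<in> {p \<in> C. \<phi> p \<in> U}}"
    have "open S0"
      unfolding S0_def
      by (rule smooth_curve_chart(2)[OF manifold sc c(1) is_chartD(5)[OF smooth_manifoldD(2)[OF manifold c(1)] oU]])
    moreover have "a \<in> S0" using a SJ c U by (auto simp: S0_def)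
    ultimately obtain \<delta> where \<delta>: "\<delta> > 0" "ball a \<delta> \<subseteq> S0" using openE by blast
    \<comment> \<open>The two parameters are arbitrary in the ball, in either order, as the
      induction over a connected set requires.\<close>
    have "P u2" if u: "u1 \<in> ?S \<inter> ball a \<delta>" "u2 \<in> ?S \<inter> ball a \<delta>" and P: "P u1" for u1 u2
    proof -
      have seg: "closed_segment u1 u2 \<subseteq> ?S" "closed_segment u1 u2 \<subseteq> ball a \<delta>"
        using u by (intro closed_segment_subset; auto)+
      have x: "x t v0 \<in> C \<and> \<phi> (x t v0) \<in> U" if "t \<in> closed_segment u1 u2" for t
        using that seg(2) \<delta>(2) by (auto simp: S0_def)
      have "jacobi_chart C \<phi> u1" using P c(1) x[of u1] by (simp add: P_def)
      then have "jacobi_chart C \<phi> u2"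
        by (intro jacobi_chart_step[OF c(1) ob inj W seg(1) x])
      then show ?thesis using jacobi_chart_transition[OF c(1) _ _ _] u(2) by (auto simp: P_def)
    qed
    then show "\<exists>T. openin (top_of_set ?S) T \<and> a \<in> T \<and> (\<forall>x\<in>T. \<forall>y\<in>T. P x \<longrightarrow> P y)"
    proof (intro exI conjI)
      show "openin (top_of_set ?S) (?S \<inter> ball a \<delta>)" by (rule openin_open_Int) simp
      show "a \<in> ?S \<inter> ball a \<delta>" using a \<delta>(1) by simp
    qed blast
  qed (use u in auto)
  then show ?thesis using c by (simp add: P_def)
qed

end

section \<open>The metric in Fermi-type coordinates\<close>

text \<open>The normal geodesics have velocities of square \<open>\<epsilon>\<close> and the base
  has square \<open>- \<epsilon>\<close>. At u = 0 the variation field is the velocity of the base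
  and the normal is parallel along it, so the data start with f = 1, f' = 0. Propagation then yields
  both coordinate vectors and all three coefficients.\<close>

lemma fermi_metric:
  fixes M :: "('a, 2) geometry"
  assumes M: "lorentz_surface M" and K: "has_constant_curvature M K" "K \<in> {- 1, 0, 1}"
    and fermi: "fermi_parametrization M I \<gamma> J x W" and \<epsilon>: "\<epsilon> \<in> {- 1, 1}"
    and causal: "\<And>t C \<phi>. t \<in> I \<Longrightarrow> (C, \<phi>) \<in> atlas M \<Longrightarrow> \<gamma> t \<in> C \<Longrightarrow>
      form (metric M (C, \<phi>) (\<phi> (\<gamma> t))) (velocity (C, \<phi>) \<gamma> t) (velocity (C, \<phi>) \<gamma> t) = - \<epsilon>"
  shows "metric_expressed_as M x W (\<lambda>u v. \<epsilon>) (\<lambda>u v. 0) (\<lambda>u v. - \<epsilon> * (cs (K * \<epsilon>) u)\<^sup>2)"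
  unfolding metric_expressed_as_def
proof safe
  fix u0 v0 C \<phi>
  assume uv: "(u0, v0) \<in> W" and c: "(C, \<phi>) \<in> atlas M" and xC: "x u0 v0 \<in> fst (C, \<phi>)"
  have \<gamma>: "geodesic M I \<gamma>" and W: "open W" "W \<subseteq> {(u, v). v \<in> I \<and> u \<in> J v}"
    and ray: "\<And>v. v \<in> I \<Longrightarrow> maximal_geodesic M (J v) (\<lambda>u. x u v) \<and> unit_speed M (J v) (\<lambda>u. x u v) \<and>
        0 \<in> J v \<and> x 0 v = \<gamma> v"
    and orth: "\<And>v c. v \<in> I \<Longrightarrow> c \<in> atlas M \<Longrightarrow> \<gamma> v \<in> fst c \<Longrightarrow> tangent_inner M c (\<gamma> v) (coord_u c x 0 v) (velocity c \<gamma> v) = 0"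
    and smu: "\<And>c. c \<in> atlas M \<Longrightarrow> smooth_on {v \<in> I. \<gamma> v \<in> fst c} (\<lambda>v. coord_u c x 0 v)"
    using fermi unfolding fermi_parametrization_def by blast+
  have v0: "v0 \<in> I" using uv W(2) by auto
  have man: "smooth_manifold M" using M pseudo_riemannianD(1) by (auto simp: lorentz_surface_def)
  have sc: "smooth_curve M I \<gamma>" using \<gamma> by (simp add: geodesic_def)
  interpret geodesic_variation M K \<epsilon> "K * \<epsilon>" x J v0 u0
  proof
    \<comment> \<open>Openness of \<open>W\<close> puts \<open>u0\<close> into \<open>J v\<close>
      for all \<open>v\<close> near \<open>v0\<close>, and the interval \<open>J v\<close> then
      contains the whole segment from 0.\<close>
    have "((\<lambda>v. (u0, v)) \<longlongrightarrow> (u0, v0)) (nhds v0)" by (intro tendsto_intros filterlim_ident)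
    then have "\<forall>\<^sub>F v in nhds v0. (u0, v) \<in> W" using W(1) uv by (rule topological_tendstoD)
    then show "\<forall>\<^sub>F v in nhds v0. geodesic M (J v) (\<lambda>u. x u v) \<and> unit_speed M (J v) (\<lambda>u. x u v) \<and> closed_segment 0 u0 \<subseteq> J v"
    proof eventually_elim
      case (elim v)
      then have v: "v \<in> I" "u0 \<in> J v" using W(2) by auto
      have g: "geodesic M (J v) (\<lambda>u. x u v)" using ray[OF v(1)] by (simp add: maximal_geodesic_def)
      then have "is_interval (J v)" by (simp add: geodesic_def smooth_curve_def open_interval_def)
      then have "closed_segment 0 u0 \<subseteq> J v"
        using ray[OF v(1)] v(2) by (intro closed_segment_subset) (auto simp: is_interval_convex)
      then show ?case using g ray[OF v(1)] by simp
    qed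
  qed (use M K \<epsilon> in auto)
  have "jacobi_chart C \<phi> u0"
  proof (rule jacobi_chart_everywhere)
    fix C \<phi> assume c: "(C, \<phi>) \<in> atlas M" and x0: "x 0 v0 \<in> C"
    interpret G: metric2 "metric M (C, \<phi>)" "\<phi> ` C" by (rule lorentz_surface_chart(1)[OF M c])
    let ?g = "metric M (C, \<phi>)"
    define S where "S = {v \<in> I. \<gamma> v \<in> C}"
    have oS: "open S"
      unfolding S_def by (rule smooth_curve_chart(2)[OF man sc c is_chartD(1)[OF smooth_manifoldD(2)[OF man c]]])
    have v0S: "v0 \<in> S" using v0 x0 ray[OF v0] by (simp add: S_def)
    define X where "X v = \<phi> (\<gamma> v)" for v
    define N where "N = velocity (C, \<phi>) \<gamma>"
    define T where "T v = velocity (C, \<phi>) (\<lambda>s. x s v) 0" for v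
    have S: "v \<in> I" "\<gamma> v \<in> C" "X v \<in> \<phi> ` C" if "v \<in> S" for v using that by (auto simp: S_def X_def)
    have dX: "(X has_vector_derivative N v) (at v)" if "v \<in> S" for v
      using smooth_curve_chart(3)[OF man sc c S(1,2)[OF that]] by (simp add: X_def[abs_def] N_def)
    have dN: "(N has_vector_derivative vector_derivative N (at v)) (at v)" if "v \<in> S" for v
      using smooth_curve_chart(4)[OF man sc c S(1,2)[OF that]] by (simp add: N_def)
    have gN: "vector_derivative N (at v) + G.Gam (X v) (N v) (N v) = 0" if "v \<in> S" for v
      using geodesic_chart[OF M \<gamma> c S(1,2)[OF that]] by (simp add: N_def X_def)
    have smT: "smooth_on S T"
      using smu[OF c] by (simp add: S_def T_def[abs_def] coord_u_def)
    define \<xi> where "\<xi> = vector_derivative T (at v0)"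
    have dT: "(T has_vector_derivative \<xi>) (at v0)"
      using smooth_onD(1)[OF smT v0S] unfolding \<xi>_def vector_derivative_works[symmetric] differentiable_def by blast
    have NN: "form (?g (X v)) (N v) (N v) = - \<epsilon>" if "v \<in> S" for v
      using causal[OF S(1)[OF that] c S(2)[OF that]] by (simp add: X_def N_def)
    have TN: "form (?g (X v)) (T v) (N v) = 0" if "v \<in> S" for v
      using orth[OF S(1)[OF that] c] S(2)[OF that] by (simp add: tangent_inner_def coord_u_def X_def N_def T_def)
    have TT: "form (?g (X v)) (T v) (T v) = \<epsilon>" if "v \<in> S" for v
    proof -
      have "tangent_inner M (C, \<phi>) (x 0 v) (T v) (T v) \<in> {1, - 1}"
        using ray[OF S(1)[OF that]] S(2)[OF that] c unfolding unit_speed_def T_def by fastforce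
      then have 1: "form (?g (X v)) (T v) (T v) \<in> {1, - 1}"
        using ray[OF S(1)[OF that]] by (simp add: tangent_inner_def X_def)
      \<comment> \<open>Unit speed leaves the sign of the normal open. The Gram determinant is
        nonpositive in Lorentz signature, so the sign is opposite to that of the base.\<close>
      have "form (?g (X v)) (T v) (T v) * (- \<epsilon>) \<le> 0"
        using G.gram_det[OF S(3)[OF that], of "T v" "N v"] lorentz_surface_chart(2)[OF M c S(3)[OF that]]
        by (simp add: TN[OF that] NN[OF that] mult_nonpos_nonneg)
      then show ?thesis using 1 \<epsilon> by auto
    qed
    have const: "d = 0" if "(f has_real_derivative d) (at v0)" "\<And>v. v \<in> S \<Longrightarrow> f v = k" for f d k
    proof -
      have "((\<lambda>v. k) has_real_derivative d) (at v0)"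
        by (rule has_field_derivative_transform_within_open[OF that(1) oS v0S that(2)])
      then show ?thesis using DERIV_const DERIV_unique by blast
    qed
    \<comment> \<open>Differentiating <T, T> and <T, N> along the base geodesic makes the covariant
      derivative of the normal orthogonal to the whole frame, hence zero.\<close>
    let ?cov = "\<xi> + G.Gam (X v0) (N v0) (T v0)"
    note D0 = S(3)[OF v0S]
    have "form (?g (X v0)) ?cov (T v0) + form (?g (X v0)) (T v0) ?cov = 0"
      by (rule const[OF G.form_along_curve[OF D0 dX[OF v0S] dT dT] TT])
    then have c1: "form (?g (X v0)) ?cov (T v0) = 0" using G.form_commute[OF D0, of "T v0" ?cov] by simp
    have "form (?g (X v0)) ?cov (N v0) + form (?g (X v0)) (T v0) (vector_derivative N (at v0) + G.Gam (X v0) (N v0) (N v0)) = 0"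
      by (rule const[OF G.form_along_curve[OF D0 dX[OF v0S] dT dN[OF v0S]] TN])
    then have c2: "form (?g (X v0)) ?cov (N v0) = 0" by (simp add: gN[OF v0S] G.form_linear)
    have cov: "?cov = 0"
      by (rule G.form_nondegenerate[OF D0 _ _ _ c1 c2]) (use TT[OF v0S] TN[OF v0S] NN[OF v0S] \<epsilon> in auto)
    have evS: "\<forall>\<^sub>F v in nhds v0. v \<in> S" by (rule eventually_nhds_in_open[OF oS v0S])
    have evX: "\<forall>\<^sub>F v in nhds v0. X v = \<phi> (x 0 v)"
      using evS by eventually_elim (use ray S(1) in \<open>simp add: X_def\<close>)
    have dX0: "((\<lambda>v. \<phi> (x 0 v)) has_vector_derivative N v0) (at v0)"
      by (rule has_vector_derivative_transform_eventually[OF dX[OF v0S] evX])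
    have X0: "\<phi> (x 0 v0) = X v0" using eventually_nhds_x_imp_x[OF evX] by simp
    have "G.jacobi \<epsilon> (cs (K * \<epsilon>) 0) (- (K * \<epsilon>) * sn (K * \<epsilon>) 0) v0 (\<lambda>v. \<phi> (x 0 v)) T"
      unfolding G.jacobi_def X0 cs_sn_0
      using D0 dX0 dT cov TT[OF v0S] TN[OF v0S] NN[OF v0S]
      by (intro conjI exI[of _ "N v0"] exI[of _ \<xi>]) auto
    moreover have "\<forall>\<^sub>F v in nhds v0. x 0 v \<in> C"
      using evS by eventually_elim (use ray S(1,2) in simp)
    ultimately show "jacobi_chart C \<phi> 0" by (simp add: jacobi_chart_def T_def[abs_def])
  qed (use c xC in auto)
  interpret G: metric2 "metric M (C, \<phi>)" "\<phi> ` C" by (rule lorentz_surface_chart(1)[OF M c])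
  let ?g = "metric M (C, \<phi>) (\<phi> (x u0 v0))" and ?T = "velocity (C, \<phi>) (\<lambda>s. x s v0) u0"
  obtain N where N: "((\<lambda>v. \<phi> (x u0 v)) has_vector_derivative cs (K * \<epsilon>) u0 *\<^sub>R N) (at v0)"
    and forms: "form ?g ?T ?T = \<epsilon>" "form ?g ?T N = 0" "form ?g N N = - \<epsilon>"
    using \<open>jacobi_chart C \<phi> u0\<close> unfolding jacobi_chart_def G.jacobi_def by blast
  have "coord_v (C, \<phi>) x u0 v0 = cs (K * \<epsilon>) u0 *\<^sub>R N"
    using vector_derivative_at[OF N] by (simp add: coord_v_def velocity_def o_def)
  then show "let xu = coord_u (C, \<phi>) x u0 v0; xv = coord_v (C, \<phi>) x u0 v0 in
      tangent_inner M (C, \<phi>) (x u0 v0) xu xu = \<epsilon> \<and> tangent_inner M (C, \<phi>) (x u0 v0) xu xv = 0 \<and>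
      tangent_inner M (C, \<phi>) (x u0 v0) xv xv = - \<epsilon> * (cs (K * \<epsilon>) u0)\<^sup>2"
    using forms by (simp add: coord_u_def tangent_inner_def G.form_linear power2_eq_square)
qed

text \<open>A spacelike base has timelike normals, so \<open>\<epsilon> = - 1\<close> and the
  argument of \<open>cs\<close> is - K: cosh for K = 1 and cos for K = -1.\<close>

lemma spacelike_fermi_metric:
  fixes M :: "('a, 2) geometry"
  assumes M: "lorentz_surface M" and K: "has_constant_curvature M K" "K \<in> {- 1, 0, 1}" and fermi: "spacelike_fermi M x W"
  shows "metric_expressed_as M x W (\<lambda>u v. - 1) (\<lambda>u v. 0) (\<lambda>u v. (cs (- K) u)\<^sup>2)"
proof -
  obtain I \<gamma> J where f: "fermi_parametrization M I \<gamma> J x W" and s: "spacelike_curve M I \<gamma>"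
    using fermi by (auto simp: spacelike_fermi_def)
  have us: "unit_speed M I \<gamma>" using f by (simp add: fermi_parametrization_def)
  have "form (metric M (C, \<phi>) (\<phi> (\<gamma> t))) (velocity (C, \<phi>) \<gamma> t) (velocity (C, \<phi>) \<gamma> t) = - (- 1)"
    if "t \<in> I" "(C, \<phi>) \<in> atlas M" "\<gamma> t \<in> C" for t C \<phi>
  proof -
    let ?X = "velocity (C, \<phi>) \<gamma> t" and ?f = "form (metric M (C, \<phi>) (\<phi> (\<gamma> t)))"
    have "?f ?X ?X \<in> {1, - 1}" using us that by (fastforce simp: unit_speed_def tangent_inner_def)
    \<comment> \<open>A spacelike velocity may be zero by definition; unit speed excludes
      this.\<close>
    moreover have "?f ?X ?X > 0 \<or> ?X = 0" using s that by (fastforce simp: spacelike_curve_def tangent_inner_def Let_def)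
    moreover have "?f 0 0 = 0" by (simp add: form_def)
    ultimately show ?thesis by auto
  qed
  from fermi_metric[OF M K f _ this] show ?thesis by simp
qed

text \<open>Here the normals are spacelike, \<open>\<epsilon> = 1\<close>, and the argument of
  \<open>cs\<close> is K itself.\<close>

lemma timelike_fermi_metric:
  fixes M :: "('a, 2) geometry"
  assumes M: "lorentz_surface M" and K: "has_constant_curvature M K" "K \<in> {- 1, 0, 1}" and fermi: "timelike_fermi M x W"
  shows "metric_expressed_as M x W (\<lambda>u v. 1) (\<lambda>u v. 0) (\<lambda>u v. - (cs K u)\<^sup>2)"
proof -
  obtain I \<gamma> J where f: "fermi_parametrization M I \<gamma> J x W" and s: "timelike_curve M I \<gamma>"
    using fermi by (auto simp: timelike_fermi_def)
  have us: "unit_speed M I \<gamma>" using f by (simp add: fermi_parametrization_def)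
  have "form (metric M (C, \<phi>) (\<phi> (\<gamma> t))) (velocity (C, \<phi>) \<gamma> t) (velocity (C, \<phi>) \<gamma> t) = - 1"
    if "t \<in> I" "(C, \<phi>) \<in> atlas M" "\<gamma> t \<in> C" for t C \<phi>
  proof -
    let ?X = "velocity (C, \<phi>) \<gamma> t" and ?f = "form (metric M (C, \<phi>) (\<phi> (\<gamma> t)))"
    have "?f ?X ?X \<in> {1, - 1}" using us that by (fastforce simp: unit_speed_def tangent_inner_def)
    moreover have "?f ?X ?X < 0" using s that by (fastforce simp: timelike_curve_def tangent_inner_def Let_def)
    ultimately show ?thesis by auto
  qed
  from fermi_metric[OF M K f _ this] show ?thesis by simp
qed

theorem theorem1p3:
  fixes M :: "('a, 2) geometry" and K :: real
  assumes "lorentz_surface M" and "topspace (mtop M) \<noteq> {}"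
    and "K \<in> {-1, 0, 1}" and "has_constant_curvature M K"
  shows "let
      case_i = K = 0 \<and> locally_isometric M minkowski_plane \<and>
        (\<forall>x W. spacelike_fermi M x W \<longrightarrow>
          metric_expressed_as M x W (\<lambda>u v. -1) (\<lambda>u v. 0) (\<lambda>u v. 1)) \<and>
        (\<forall>x W. timelike_fermi M x W \<longrightarrow>
          metric_expressed_as M x W (\<lambda>\<tau> \<theta>. 1) (\<lambda>\<tau> \<theta>. 0) (\<lambda>\<tau> \<theta>. -1));
      case_ii = K = 1 \<and> locally_isometric M de_sitter \<and>
        (\<forall>x W. spacelike_fermi M x W \<longrightarrow>
          metric_expressed_as M x W (\<lambda>u v. -1) (\<lambda>u v. 0) (\<lambda>u v. (cosh u)\<^sup>2)) \<and>
        (\<forall>x W. timelike_fermi M x W \<longrightarrow>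
          metric_expressed_as M x W (\<lambda>\<tau> \<theta>. 1) (\<lambda>\<tau> \<theta>. 0) (\<lambda>\<tau> \<theta>. - (cos \<tau>)\<^sup>2));
      case_iii = K = -1 \<and> locally_isometric M anti_de_sitter \<and>
        (\<forall>x W. spacelike_fermi M x W \<longrightarrow>
          metric_expressed_as M x W (\<lambda>u v. -1) (\<lambda>u v. 0) (\<lambda>u v. (cos u)\<^sup>2)) \<and>
        (\<forall>x W. timelike_fermi M x W \<longrightarrow>
          metric_expressed_as M x W (\<lambda>\<tau> \<theta>. 1) (\<lambda>\<tau> \<theta>. 0) (\<lambda>\<tau> \<theta>. - (cosh \<tau>)\<^sup>2))
    in (case_i \<or> case_ii \<or> case_iii) \<and>
       \<not> (case_i \<and> case_ii) \<and> \<not> (case_i \<and> case_iii) \<and> \<not> (case_ii \<and> case_iii)"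
proof -
  note spacelike = spacelike_fermi_metric[OF assms(1,4,3)] and timelike = timelike_fermi_metric[OF assms(1,4,3)]
  consider "K = 0" | "K = 1" | "K = - 1" using assms(3) by auto
  then show ?thesis
  proof cases
    case 1
    then show ?thesis
      using locally_isometric_minkowski_plane[OF assms(1)] assms(4) spacelike timelike by (simp add: cs_def Let_def)
  next
    case 2
    then show ?thesis
      using locally_isometric_de_sitter[OF assms(1)] assms(4) spacelike timelike by (simp add: cs_def Let_def)
  next
    case 3
    then show ?thesis
      using locally_isometric_anti_de_sitter[OF assms(1)] assms(4) spacelike timelike by (simp add: cs_def Let_def)
  qed
qed

end
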